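(* Let $n\ge1$, $-1<\gamma<\infty$ and $1<p<\infty$. For every $\beta\in(0,1)$ there exists a constant $C=C(p,n,\gamma,\beta)>0$ such that for every $f\in C(Q_1)\cap L^\infty(Q_1)$ and every bounded viscosity solution $u$ of $$\partial_t u-|Du|^\gamma\left[\Delta u+(p-2)\left\langle D^2u\frac{Du}{|Du|},\frac{Du}{|Du|}\right\rangle\right]=f\quad\text{in }Q_1,$$ one has, for all $x,y\in B_{15/16}$ and $t\in(-(15/16)^2,0]$, $$|u(x,t)-u(y,t)|\le C\left(\|u\|_{L^\infty(Q_1)}+\|u\|_{L^\infty(Q_1)}^{\frac{1}{1+\gamma}}+\|f\|_{L^\infty(Q_1)}^{\frac{1}{1+\gamma}}\right)|x-y|^\beta .$$
   Context: Notation: $B_r=\{x\in\mathbb{R}^n:|x|<r\}$ and $Q_r=B_r\times(-r^2,0]$. $D$, $D^2$, $\Delta$ denote the gradient, Hessian and Laplacian in the space variable $x$. The normalized $p$-Laplacian is $\Delta_p^N\varphi=\Delta\varphi+(p-2)\langle D^2\varphi\frac{D\varphi}{|D\varphi|},\frac{D\varphi}{|D\varphi|}\rangle$ (where $D\varphi\ne0$). Viscosity solutions of $\partial_t u-|Du|^\gamma\Delta_p^N u=f$ in $Q_1$. A locally bounded upper semicontinuous $u$ is a viscosity subsolution if at every point $(x_0,t_0)\in Q_1$ both of the following hold: (i) for every $\varphi\in C^2(Q_1)$ such that $u-\varphi$ has a local maximum at $(x_0,t_0)$ and $D\varphi(x_0,t_0)\neq0$, one has $\partial_t\varphi(x_0,t_0)-|D\varphi(x_0,t_0)|^\gamma\Delta_p^N\varphi(x_0,t_0)\le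 f(x_0,t_0)$; (ii) whenever there are $\delta_1>0$ and $\varphi\in C^2((t_0-\delta_1,t_0+\delta_1))$ with $\varphi(t_0)=0$, $u(x_0,t_0)\ge u(x_0,t)-\varphi(t)$ for all $t\in(t_0-\delta_1,t_0+\delta_1)$, and $x\mapsto\sup_{t\in(t_0-\delta_1,t_0+\delta_1)}(u(x,t)-\varphi(t))$ constant in a neighborhood of $x_0$, one has $\varphi'(t_0)\le f(x_0,t_0)$. A locally bounded lower semicontinuous $u$ is a viscosity supersolution if the same holds with maximum replaced by minimum, $\sup$ by $\inf$, and all the inequalities ($u(x_0,t_0)\ge\dots$ and the two conclusions) reversed. A continuous function is a viscosity solution if it is both a subsolution and a supersolution. *)

theory Defs
  imports "HOL-Analysis.Analysis" "HOL-Probability.Essential_Supremum"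
begin

text \<open>Points of space-time are pairs \<open>(x, t)\<close> of type \<^typ>\<open>(real^'n) \<times> real\<close>.\<close>

definition Q :: "real \<Rightarrow> ((real^'n) \<times> real) set" where
  "Q r = ball 0 r \<times> {- (r^2) <.. 0}"

text \<open>\<open>Q r\<close> is not open (it contains its top \<open>t = 0\<close>), so twice continuous differentiability is
  understood with Frechet derivatives relative to the set. On \<open>Q r\<close> these are unique, two-sided for
  \<open>t < 0\<close> and one-sided in time for \<open>t = 0\<close>; on open sets this is the usual notion.\<close>

definition C2_on :: "'a::real_normed_vector set \<Rightarrow> ('a \<Rightarrow> real) \<Rightarrow> bool" where
  "C2_on S \<phi> \<longleftrightarrow>
    (\<exists>(\<phi>' :: 'a \<Rightarrow> ('a \<Rightarrow>\<^sub>L real)) (\<phi>'' :: 'a \<Rightarrow> ('a \<Rightarrow>\<^sub>L ('a \<Rightarrow>\<^sub>L real))).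
       (\<forall>z\<in>S. (\<phi> has_derivative blinfun_apply (\<phi>' z)) (at z within S)) \<and>
       (\<forall>z\<in>S. (\<phi>' has_derivative blinfun_apply (\<phi>'' z)) (at z within S)) \<and>
       continuous_on S \<phi>'')"

definition dt :: "((real^'n) \<times> real \<Rightarrow> real) \<Rightarrow> (real^'n) \<times> real \<Rightarrow> real" where
  "dt \<phi> z = vector_derivative (\<lambda>s. \<phi> (fst z, s)) (at (snd z) within {-1 <.. 0})"

definition partial_x :: "'n \<Rightarrow> ((real^'n) \<times> real \<Rightarrow> real) \<Rightarrow> (real^'n) \<times> real \<Rightarrow> real" where
  "partial_x i \<phi> z = deriv (\<lambda>s. \<phi> (fst z + s *\<^sub>R axis i 1, snd z)) 0"

definition grad_x :: "((real^'n) \<times> real \<Rightarrow> real) \<Rightarrow> (real^'n) \<times> real \<Rightarrow> real^'n" where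
  "grad_x \<phi> z = (\<chi> i. partial_x i \<phi> z)"

definition hess_x :: "((real^'n) \<times> real \<Rightarrow> real) \<Rightarrow> (real^'n) \<times> real \<Rightarrow> real^'n^'n" where
  "hess_x \<phi> z = (\<chi> i j. partial_x i (partial_x j \<phi>) z)"

definition laplacian_x :: "((real^'n) \<times> real \<Rightarrow> real) \<Rightarrow> (real^'n) \<times> real \<Rightarrow> real" where
  "laplacian_x \<phi> z = (\<Sum>i\<in>UNIV. partial_x i (partial_x i \<phi>) z)"

text \<open>Meaningful only where \<open>grad_x \<phi> z \<noteq> 0\<close>.\<close>

definition normalized_p_laplacian ::
    "real \<Rightarrow> ((real^'n) \<times> real \<Rightarrow> real) \<Rightarrow> (real^'n) \<times> real \<Rightarrow> real" where
  "normalized_p_laplacian p \<phi> z =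
     (let e = grad_x \<phi> z /\<^sub>R norm (grad_x \<phi> z)
      in laplacian_x \<phi> z + (p - 2) * ((hess_x \<phi> z *v e) \<bullet> e))"

definition locally_bounded_on :: "'a::metric_space set \<Rightarrow> ('a \<Rightarrow> real) \<Rightarrow> bool" where
  "locally_bounded_on S u \<longleftrightarrow> (\<forall>z\<in>S. \<exists>r>0. bounded (u ` (S \<inter> ball z r)))"

definition usc_on :: "'a::topological_space set \<Rightarrow> ('a \<Rightarrow> real) \<Rightarrow> bool" where
  "usc_on S u \<longleftrightarrow> (\<forall>z\<in>S. \<forall>c>u z. \<forall>\<^sub>F w in at z within S. u w < c)"

definition lsc_on :: "'a::topological_space set \<Rightarrow> ('a \<Rightarrow> real) \<Rightarrow> bool" where
  "lsc_on S u \<longleftrightarrow> (\<forall>z\<in>S. \<forall>c<u z. \<forall>\<^sub>F w in at z within S. c < u w)"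

text \<open>Local maxima and minima are relative to \<open>Q 1\<close>. In the second condition the test function lives
  on the whole interval around \<open>t0\<close>, while the times at which \<open>u\<close> is evaluated are those times of
  this interval that belong to the domain; at \<open>t0 = 0\<close> this leaves \<open>t \<le> 0\<close>. The supremum and
  infimum are taken in the extended reals, since a locally bounded \<open>u\<close> may be unbounded as \<open>t\<close>
  approaches \<open>-1\<close>.\<close>

definition test_times :: "real \<Rightarrow> real \<Rightarrow> real set" where
  "test_times t0 \<delta> = {t0 - \<delta> <..< t0 + \<delta>} \<inter> {-1 <.. 0}"

definition viscosity_subsolution ::
    "real \<Rightarrow> real \<Rightarrow> ((real^'n) \<times> real \<Rightarrow> real) \<Rightarrow> ((real^'n) \<times> real \<Rightarrow> real) \<Rightarrow> bool" where
  "viscosity_subsolution \<gamma> p f u \<longleftrightarrow>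
     locally_bounded_on (Q 1) u \<and> usc_on (Q 1) u \<and>
     (\<forall>x0 t0. (x0, t0) \<in> Q 1 \<longrightarrow>
        (\<forall>\<phi>. C2_on (Q 1) \<phi> \<longrightarrow>
           (\<forall>\<^sub>F z in at (x0, t0) within Q 1. u z - \<phi> z \<le> u (x0, t0) - \<phi> (x0, t0)) \<longrightarrow>
           grad_x \<phi> (x0, t0) \<noteq> 0 \<longrightarrow>
           dt \<phi> (x0, t0) - norm (grad_x \<phi> (x0, t0)) powr \<gamma> * normalized_p_laplacian p \<phi> (x0, t0)
             \<le> f (x0, t0)) \<and>
        (\<forall>\<delta>>0. \<forall>\<phi> :: real \<Rightarrow> real. C2_on {t0 - \<delta> <..< t0 + \<delta>} \<phi> \<longrightarrow>
           \<phi> t0 = 0 \<longrightarrow>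
           (\<forall>t\<in>test_times t0 \<delta>. u (x0, t0) \<ge> u (x0, t) - \<phi> t) \<longrightarrow>
           (\<exists>c. \<forall>\<^sub>F x in nhds x0. (SUP t\<in>test_times t0 \<delta>. ereal (u (x, t) - \<phi> t)) = c) \<longrightarrow>
           deriv \<phi> t0 \<le> f (x0, t0)))"

definition viscosity_supersolution ::
    "real \<Rightarrow> real \<Rightarrow> ((real^'n) \<times> real \<Rightarrow> real) \<Rightarrow> ((real^'n) \<times> real \<Rightarrow> real) \<Rightarrow> bool" where
  "viscosity_supersolution \<gamma> p f u \<longleftrightarrow>
     locally_bounded_on (Q 1) u \<and> lsc_on (Q 1) u \<and>
     (\<forall>x0 t0. (x0, t0) \<in> Q 1 \<longrightarrow>
        (\<forall>\<phi>. C2_on (Q 1) \<phi> \<longrightarrow>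
           (\<forall>\<^sub>F z in at (x0, t0) within Q 1. u z - \<phi> z \<ge> u (x0, t0) - \<phi> (x0, t0)) \<longrightarrow>
           grad_x \<phi> (x0, t0) \<noteq> 0 \<longrightarrow>
           dt \<phi> (x0, t0) - norm (grad_x \<phi> (x0, t0)) powr \<gamma> * normalized_p_laplacian p \<phi> (x0, t0)
             \<ge> f (x0, t0)) \<and>
        (\<forall>\<delta>>0. \<forall>\<phi> :: real \<Rightarrow> real. C2_on {t0 - \<delta> <..< t0 + \<delta>} \<phi> \<longrightarrow>
           \<phi> t0 = 0 \<longrightarrow>
           (\<forall>t\<in>test_times t0 \<delta>. u (x0, t0) \<le> u (x0, t) - \<phi> t) \<longrightarrow>
           (\<exists>c. \<forall>\<^sub>F x in nhds x0. (INF t\<in>test_times t0 \<delta>. ereal (u (x, t) - \<phi> t)) = c) \<longrightarrow>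
           deriv \<phi> t0 \<ge> f (x0, t0)))"

definition viscosity_solution ::
    "real \<Rightarrow> real \<Rightarrow> ((real^'n) \<times> real \<Rightarrow> real) \<Rightarrow> ((real^'n) \<times> real \<Rightarrow> real) \<Rightarrow> bool" where
  "viscosity_solution \<gamma> p f u \<longleftrightarrow>
     continuous_on (Q 1) u \<and> viscosity_subsolution \<gamma> p f u \<and> viscosity_supersolution \<gamma> p f u"

definition in_Linf :: "'a::euclidean_space set \<Rightarrow> ('a \<Rightarrow> real) \<Rightarrow> bool" where
  "in_Linf S g \<longleftrightarrow> g \<in> borel_measurable (lebesgue_on S) \<and>
     esssup (lebesgue_on S) (\<lambda>z. ereal \<bar>g z\<bar>) < \<infinity>"

definition Linf_norm :: "'a::euclidean_space set \<Rightarrow> ('a \<Rightarrow> real) \<Rightarrow> real" where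
  "Linf_norm S g = real_of_ereal (esssup (lebesgue_on S) (\<lambda>z. ereal \<bar>g z\<bar>))"

end

theory Submission
  imports Defs "HOL-Library.Function_Algebras"
begin

text \<open>
  Ishii--Lions doubling. If the estimate failed, \<open>u(x,t) - u(y,t) - L\<bar>x - y\<bar>\<^sup>\<beta>\<close>, localised by
  quadratic terms, would have a positive maximum at some \<open>x \<noteq> y\<close>; the strict concavity of \<open>s\<^sup>\<beta>\<close> in
  the direction \<open>\<eta> = (x - y)/\<bar>x - y\<bar>\<close> then contradicts the two equations once \<open>L\<close> is large.

  The usual passage to second derivatives at the maximum (theorem on sums, Alexandrov's theorem) is
  replaced by a linear argument. After a sup-convolution of \<open>u\<close> and of \<open>-u\<close> the gradient at the maximum
  point is unique and Hessians are bounded below, so near that point both functions are viscosity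
  subsolutions of equations whose coefficients are frozen there. Linear changes of variables by square
  roots of the frozen matrices, the second one composed with the reflection at \<open>\<eta>\<close>, turn both into
  subsolutions of the heat equation in the same variable \<open>w\<close>. That the sum of two such
  subsolutions is again one follows by comparing both with a caloric polynomial; the test function
  for the sum is \<open>L\<bar>x - y\<bar>\<^sup>\<beta>\<close> plus quadratic terms along the coupled displacements of \<open>x\<close> and \<open>y\<close>.
\<close>

section \<open>Directional derivatives of polynomial functions\<close>

text \<open>All test functions are polynomials. This works because the boundary of a paraboloid is
  the zero set of a polynomial of parabolic degree two, so that the heat equation with polynomial
  lateral values has a polynomial solution, found by linear algebra. When x and y move by S1 w and
  S2 w with equal roots, |x - y| does not change and the concavity of s^\<beta> is never felt. With
  the reflection, S1 - S2 is close to a multiple of the projection to \<eta>. This gives a negative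
  term of order L s^(\<beta>-2) \<Lambda>^\<gamma>, where \<Lambda> = L \<beta> s^(\<beta>-1) is the
  size of the gradient; as s \<le> 1, it is at least a multiple of (L \<beta>)^(1+\<gamma>) for
  \<gamma> of either sign. It has to beat 2 F plus a multiple of the bound K of u, whence the powers
  1/(1+\<gamma>); the linear term in K keeps the localisation small against the gradient. The time t
  = 0 belongs to the domain. A sup-convolution is defined at all times, so the doubled maximum is
  interior even if it lies at a positive time; only the touching of u itself is relative to the
  domain.\<close>

definition dd :: "'a::real_normed_vector \<Rightarrow> ('a \<Rightarrow> real) \<Rightarrow> 'a \<Rightarrow> real" where
  "dd v f z = frechet_derivative f (at z) v"

lemma dd_eqI: "(f has_derivative f') (at z) \<Longrightarrow> dd v f z = f' v"
  by (simp add: dd_def frechet_derivative_at[symmetric])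

lemma rpf_differentiable:
  "real_polynomial_function f \<Longrightarrow> f differentiable (at z)"
proof (induction rule: real_polynomial_function.induct)
  case (linear f)
  then show ?case
    using bounded_linear_imp_differentiable by blast
qed (auto intro: differentiable_add differentiable_mult)

lemma rpf_has_derivative:
  "real_polynomial_function f \<Longrightarrow> (f has_derivative (\<lambda>v. dd v f z)) (at z)"
  using rpf_differentiable[of f z] unfolding frechet_derivative_works dd_def by simp

lemma rpf_continuous_on: "real_polynomial_function f \<Longrightarrow> continuous_on S f"
  using continuous_on_polymonial_function real_polynomial_function_eq by blast

lemma dd_const [simp]: "dd v (\<lambda>z. c) = (\<lambda>z. 0)"
  by (rule ext, rule dd_eqI) (rule derivative_intros)

lemma dd_linear: "bounded_linear f \<Longrightarrow> dd v f = (\<lambda>z. f v)"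
  by (rule ext, rule dd_eqI) (rule bounded_linear_imp_has_derivative)

lemma dd_add:
  assumes "real_polynomial_function f" "real_polynomial_function g"
  shows "dd v (\<lambda>z. f z + g z) = (\<lambda>z. dd v f z + dd v g z)"
  by (rule ext, rule dd_eqI) (intro derivative_intros assms rpf_has_derivative)

lemma dd_diff:
  assumes "real_polynomial_function f" "real_polynomial_function g"
  shows "dd v (\<lambda>z. f z - g z) = (\<lambda>z. dd v f z - dd v g z)"
  by (rule ext, rule dd_eqI) (intro derivative_intros assms rpf_has_derivative)

lemma dd_mult:
  assumes "real_polynomial_function f" "real_polynomial_function g"
  shows "dd v (\<lambda>z. f z * g z) = (\<lambda>z. f z * dd v g z + dd v f z * g z)"
  by (rule ext, rule dd_eqI) (intro derivative_intros assms rpf_has_derivative)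

lemma rpf_cmult: "real_polynomial_function f \<Longrightarrow> real_polynomial_function (\<lambda>z. c * f z)"
  by (rule real_polynomial_function.intros(4)[OF real_polynomial_function.intros(2)])

lemma dd_cmult:
  assumes "real_polynomial_function f"
  shows "dd v (\<lambda>z. c * f z) = (\<lambda>z. c * dd v f z)"
  using dd_mult[OF real_polynomial_function.intros(2) assms, of v c] by simp

lemma dd_minus:
  assumes "real_polynomial_function f"
  shows "dd v (\<lambda>z. - f z) = (\<lambda>z. - dd v f z)"
  by (rule ext, rule dd_eqI) (intro derivative_intros assms rpf_has_derivative)

lemma rpf_dd: "real_polynomial_function f \<Longrightarrow> real_polynomial_function (dd v f)"
proof (induction rule: real_polynomial_function.induct)
  case (linear f)
  then show ?case by (simp add: dd_linear real_polynomial_function.intros(2))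
next
  case (const c)
  then show ?case by (simp add: real_polynomial_function.intros(2))
qed (simp_all add: dd_add dd_mult real_polynomial_function.intros)

text \<open>Structural induction: for a product, the product rule applied twice gives an expression
  symmetric in \<open>v\<close> and \<open>w\<close>.\<close>

lemma dd_commute:
  "real_polynomial_function f \<Longrightarrow> dd v (dd w f) = dd w (dd v f)"
proof (induction rule: real_polynomial_function.induct)
  case (mult f g)
  then show ?case
    by (simp add: dd_mult dd_add rpf_dd real_polynomial_function.intros algebra_simps)
qed (simp_all add: dd_linear dd_add rpf_dd)

lemma linear_dd: "real_polynomial_function f \<Longrightarrow> linear (\<lambda>v. dd v f z)"
  using bounded_linear.linear[OF has_derivative_bounded_linear[OF rpf_has_derivative]] .

lemma dd_add_dir:
  "real_polynomial_function f \<Longrightarrow> dd (v + w) f = (\<lambda>z. dd v f z + dd w f z)"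
  using linear_add[OF linear_dd[of f]] by (simp add: fun_eq_iff)

lemma dd_scale_dir:
  "real_polynomial_function f \<Longrightarrow> dd (c *\<^sub>R v) f = (\<lambda>z. c * dd v f z)"
  using linear_scale[OF linear_dd[of f]] by (simp add: fun_eq_iff)

lemma dd_zero_dir: "real_polynomial_function f \<Longrightarrow> dd 0 f = (\<lambda>z. 0)"
  using dd_scale_dir[of f 0 0] by simp

lemma dd_sum_dir:
  assumes "real_polynomial_function f"
  shows "dd (\<Sum>i\<in>I. v i) f = (\<lambda>z. \<Sum>i\<in>I. dd (v i) f z)"
  by (induction I rule: infinite_finite_induct)
     (simp_all add: dd_zero_dir dd_add_dir assms)

lemma rpf_line_deriv:
  assumes "real_polynomial_function f"
  shows "((\<lambda>s. f (z + s *\<^sub>R v)) has_real_derivative dd v f (z + s *\<^sub>R v)) (at s)"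
proof -
  have "((\<lambda>s. z + s *\<^sub>R v) has_derivative (\<lambda>h. h *\<^sub>R v)) (at s)"
    by (auto intro!: derivative_eq_intros)
  from has_derivative_compose[OF this rpf_has_derivative[OF assms]]
  show ?thesis
    by (simp add: has_field_derivative_def dd_scale_dir[OF assms] mult_commute_abs)
qed

lemma rpf_affine:
  assumes "real_polynomial_function f" "bounded_linear A"
  shows "real_polynomial_function (\<lambda>z. f (c + A z))"
proof -
  have "polynomial_function (\<lambda>z. c + A z)"
    by (intro polynomial_function_add polynomial_function_const polynomial_function_bounded_linear assms)
  from real_polynomial_function_compose[OF this assms(1)] show ?thesis by (simp add: o_def)
qed

lemma dd_affine:
  assumes "real_polynomial_function f" "bounded_linear A"
  shows "dd v (\<lambda>z. f (c + A z)) = (\<lambda>z. dd (A v) f (c + A z))"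
proof (rule ext, rule dd_eqI)
  fix z
  have "((\<lambda>z. c + A z) has_derivative A) (at z)"
    using bounded_linear_imp_has_derivative[OF assms(2)] by (auto intro!: derivative_eq_intros)
  from has_derivative_compose[OF this rpf_has_derivative[OF assms(1)]]
  show "((\<lambda>z. f (c + A z)) has_derivative (\<lambda>v. dd (A v) f (c + A z))) (at z)" .
qed

text \<open>Along the line through \<open>z\<close>, a positive second derivative would make the
  first derivative positive just after 0, and the mean value theorem would push \<open>f\<close>
  above its maximum.\<close>

lemma rpf_local_max:
  assumes f: "real_polynomial_function f"
    and max: "\<forall>\<^sub>F z' in nhds z. f z' \<le> f z"
  shows "dd v f z = 0" "dd v (dd v f) z \<le> 0"
proof -
  define g where "g = (\<lambda>s. f (z + s *\<^sub>R v))"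
  define g' where "g' = (\<lambda>s. dd v f (z + s *\<^sub>R v))"
  have lim: "filterlim (\<lambda>s. z + s *\<^sub>R v) (nhds z) (nhds 0)"
    by (rule tendsto_eq_intros refl filterlim_ident | simp)+
  from eventually_compose_filterlim[OF max this]
  obtain d where d: "d > 0" "\<And>s. \<bar>s\<bar> < d \<Longrightarrow> g s \<le> g 0"
    unfolding eventually_nhds_metric g_def by auto
  have g: "(g has_real_derivative g' s) (at s)" for s
    unfolding g_def g'_def by (rule rpf_line_deriv[OF f])
  have g'_d: "(g' has_real_derivative dd v (dd v f) z) (at 0)"
    using rpf_line_deriv[OF rpf_dd[OF f], where z=z and v=v and s=0] by (simp add: g'_def)
  have "g' 0 = 0"
    by (rule DERIV_local_max[OF g d(1)]) (use d(2) in auto)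
  then show "dd v f z = 0" by (simp add: g'_def)
  show "dd v (dd v f) z \<le> 0"
  proof (rule ccontr)
    assume "\<not> ?thesis"
    then obtain e where e: "e > 0" "\<And>h. 0 < h \<Longrightarrow> h < e \<Longrightarrow> g' 0 < g' (0 + h)"
      using DERIV_pos_inc_right[OF g'_d] by force
    define h where "h = min d e / 2"
    have h: "0 < h" "h < d" "h < e" using d e by (auto simp: h_def)
    obtain s where s: "0 < s" "s < h" "g h - g 0 = (h - 0) * g' s"
      using MVT2[OF h(1), of g g'] g by auto
    have "g' s > 0" using e(2)[of s] s h \<open>g' 0 = 0\<close> by auto
    then have "g h > g 0" using s h by (simp add: algebra_simps)
    with d(2)[of h] h show False by auto
  qed
qed

lemma rpf_local_min:
  assumes f: "real_polynomial_function f"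
    and min: "\<forall>\<^sub>F z' in nhds z. f z \<le> f z'"
  shows "dd v f z = 0" "dd v (dd v f) z \<ge> 0"
  using rpf_local_max[OF real_polynomial_function_minus[OF f], of z v] min
  by (simp_all add: dd_minus f rpf_dd)

text \<open>On the line from \<open>z0\<close> through \<open>z\<close> the polynomial has one
  variable and infinitely many zeros near parameter 0; parameter 1 is \<open>z\<close>.\<close>

lemma rpf_zero_on_open:
  assumes f: "real_polynomial_function f" and S: "open S" "z0 \<in> S" "\<And>z. z \<in> S \<Longrightarrow> f z = 0"
  shows "f z = 0"
proof -
  define g where "g = (\<lambda>s::real. f (z0 + s *\<^sub>R (z - z0)))"
  have "real_polynomial_function g" unfolding g_def
    by (rule rpf_affine[OF f]) (rule bounded_linear_scaleR_left)
  then obtain a n where g: "g = (\<lambda>x. \<Sum>i\<le>n. a i * x ^ i)"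
    unfolding real_polynomial_function_iff_sum by blast
  have lim: "filterlim (\<lambda>s. z0 + s *\<^sub>R (z - z0)) (nhds z0) (nhds 0)"
    by (rule tendsto_eq_intros refl filterlim_ident | simp)+
  have "\<forall>\<^sub>F z in nhds z0. f z = 0" using S eventually_nhds by blast
  from eventually_compose_filterlim[OF this lim]
  obtain d where d: "d > 0" "\<And>s. \<bar>s\<bar> < d \<Longrightarrow> g s = 0"
    unfolding eventually_nhds_metric g_def by auto
  have "infinite {x. g x = 0}"
  proof
    assume "finite {x. g x = 0}"
    moreover have "{0<..<d} \<subseteq> {x. g x = 0}" using d by auto
    ultimately show False using d(1) infinite_Ioo finite_subset by blast
  qed
  then have "\<forall>i\<le>n. a i = 0"
    unfolding g using polyfun_finite_roots[of a n] by blast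
  then have "g 1 = 0" unfolding g by simp
  then show ?thesis by (simp add: g_def)
qed

section \<open>Caloric polynomials with prescribed values on a paraboloid\<close>

definition heat :: "('a::euclidean_space \<times> real \<Rightarrow> real) \<Rightarrow> 'a \<times> real \<Rightarrow> real" where
  "heat f z = dd (0, 1) f z - (\<Sum>b\<in>Basis. dd (b, 0) (dd (b, 0) f) z)"

lemma heat_add:
  assumes "real_polynomial_function f" "real_polynomial_function g"
  shows "heat (\<lambda>z. f z + g z) z = heat f z + heat g z"
  by (simp add: heat_def dd_add assms rpf_dd sum.distrib)

lemma heat_diff:
  assumes "real_polynomial_function f" "real_polynomial_function g"
  shows "heat (\<lambda>z. f z - g z) z = heat f z - heat g z"
  by (simp add: heat_def dd_diff assms rpf_dd sum_subtractf)

lemma heat_minus: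
  assumes "real_polynomial_function f"
  shows "heat (\<lambda>z. - f z) z = - heat f z"
  by (simp add: heat_def dd_minus assms rpf_dd sum_negf)

lemma heat_cmult:
  assumes "real_polynomial_function f"
  shows "heat (\<lambda>z. c * f z) z = c * heat f z"
  by (simp add: heat_def dd_cmult assms rpf_dd sum_distrib_left right_diff_distrib)

lemma rpf_heat:
  "real_polynomial_function f \<Longrightarrow> real_polynomial_function (heat f)"
  unfolding heat_def[abs_def]
  by (intro real_polynomial_function_diff real_polynomial_function_sum rpf_dd) auto

lemma dd_time_fun:
  assumes "\<And>t. (r has_real_derivative r' t) (at t)"
  shows "dd (v, s) (\<lambda>z. r (snd z)) = (\<lambda>z. s * r' (snd z))"
proof (rule ext)
  fix z :: "'a \<times> real"
  have "((\<lambda>z. r (snd z)) has_derivative (\<lambda>h. r' (snd z) * snd h)) (at z)"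
    by (rule has_derivative_compose[of snd snd z UNIV r "\<lambda>h. r' (snd z) * h"])
       (use assms[of "snd z"] in \<open>auto simp: has_field_derivative_def intro!: derivative_eq_intros\<close>)
  from dd_eqI[OF this, of "(v, s)"]
  show "dd (v, s) (\<lambda>z. r (snd z)) z = s * r' (snd z)" by simp
qed

lemma heat_time_fun:
  assumes "\<And>t. (r has_real_derivative r' t) (at t)"
  shows "heat (\<lambda>z. r (snd z)) z = r' (snd z)"
  by (simp add: heat_def dd_time_fun[OF assms])

text \<open>Opens forward in time from the vertex \<open>(0, t1)\<close>. The bottom is the vertex
  alone, so the lateral surface |x|^2 = t - t1 is the whole parabolic boundary.\<close>

definition paraboloid :: "real \<Rightarrow> real \<Rightarrow> ('a::euclidean_space \<times> real) set" where
  "paraboloid t1 T = {z. fst z \<bullet> fst z \<le> snd z - t1 \<and> snd z \<le> T}"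

lemma compact_paraboloid: "compact (paraboloid t1 T :: ('a::euclidean_space \<times> real) set)"
proof -
  have "closed (paraboloid t1 T :: ('a \<times> real) set)"
    unfolding paraboloid_def by (intro closed_Collect_conj closed_Collect_le continuous_intros)
  moreover have "bounded (paraboloid t1 T :: ('a \<times> real) set)"
  proof (rule bounded_subset)
    show "bounded (cball (0::'a) (sqrt (T - t1)) \<times> {t1..T})"
      by (intro bounded_Times bounded_cball) simp
    show "paraboloid t1 T \<subseteq> cball (0::'a) (sqrt (T - t1)) \<times> {t1..T}"
    proof
      fix z :: "'a \<times> real" assume z: "z \<in> paraboloid t1 T"
      have "t1 \<le> snd z"
        using z inner_ge_zero[of "fst z"] unfolding paraboloid_def mem_Collect_eq by linarith
      with z have "t1 \<le> snd z" "snd z \<le> T" "norm (fst z) \<le> sqrt (T - t1)"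
        unfolding paraboloid_def by (auto simp: norm_eq_sqrt_inner intro!: real_sqrt_le_mono)
      then show "z \<in> cball (0::'a) (sqrt (T - t1)) \<times> {t1..T}"
        by (cases z) auto
    qed
  qed
  ultimately show ?thesis by (simp add: compact_eq_bounded_closed)
qed

text \<open>The time polynomial \<open>\<rho>\<close> is tiny at the given point and exceeds \<open>W\<close> at the top, so the top of
  the paraboloid never carries the maximum of \<open>W - \<rho>\<close>.\<close>

lemma paraboloid_max_principle:
  fixes W :: "'a::euclidean_space \<times> real \<Rightarrow> real"
  assumes cont: "continuous_on (paraboloid t1 T) W"
    and lateral: "\<And>z. fst z \<bullet> fst z = snd z - t1 \<Longrightarrow> snd z \<le> T \<Longrightarrow> W z \<le> 0"
    and nomax: "\<And>\<rho> z. real_polynomial_function \<rho> \<Longrightarrow> heat \<rho> z > 0 \<Longrightarrow>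
        fst z \<bullet> fst z < snd z - t1 \<Longrightarrow> snd z < T \<Longrightarrow>
        \<forall>\<^sub>F z' in nhds z. W z' - \<rho> z' \<le> W z - \<rho> z \<Longrightarrow> False"
    and z: "z \<in> paraboloid t1 T" "snd z < T"
  shows "W z \<le> 0"
proof (rule ccontr)
  assume "\<not> W z \<le> 0"
  then have pos: "W z > 0" by simp
  have t1z: "t1 \<le> snd z"
    using z(1) inner_ge_zero[of "fst z"] unfolding paraboloid_def mem_Collect_eq by linarith
  have T: "t1 < T" using t1z z(2) by simp
  obtain K where K: "\<And>y. y \<in> paraboloid t1 T \<Longrightarrow> W y \<le> K"
  proof -
    have ne: "paraboloid t1 T \<noteq> ({} :: ('a \<times> real) set)" using z by blast
    obtain x where "\<forall>y\<in>paraboloid t1 T. W y \<le> W x"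
      using continuous_attains_sup[OF compact_paraboloid ne cont] by auto
    then show ?thesis by (intro that[of "W x"]) simp
  qed
  have K0: "K > 0" using K[OF z(1)] pos by simp
  define k where "k = K + 1"
  \<comment> \<open>The height of \<open>z\<close> in the paraboloid, scaled to [0, 1). A high power
    \<open>m\<close> makes \<open>k * x ^ m\<close> less than half of \<open>W z\<close>, while at
    the top the power is 1.\<close>
  define x where "x = (snd z - t1) / (T - t1)"
  have x: "0 \<le> x" "x < 1" using t1z z(2) T by (auto simp: x_def field_simps)
  have "(\<lambda>m. k * x ^ m) \<longlonglongrightarrow> k * 0"
    by (intro tendsto_intros LIMSEQ_power_zero) (use x in auto)
  then have "\<forall>\<^sub>F m in sequentially. k * x ^ m < W z / 2"
    by (rule order_tendstoD(2)) (use pos in simp)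
  then obtain m where m: "k * x ^ m < W z / 2"
    by (auto simp: eventually_sequentially)
  \<comment> \<open>The linear term uses at most another quarter of \<open>W z\<close>; its slope
    keeps \<open>heat \<rho>\<close> strictly positive for every \<open>m\<close>.\<close>
  define \<nu> where "\<nu> = W z / 4 * inverse (T - t1)"
  have \<nu>: "\<nu> > 0" using pos T by (auto simp: \<nu>_def)
  have \<nu>z: "\<nu> * (snd z - t1) \<le> W z / 4"
  proof -
    have "\<nu> * (snd z - t1) \<le> \<nu> * (T - t1)" using z(2) \<nu> by (intro mult_left_mono) auto
    also have "\<dots> = W z / 4" using T by (simp add: \<nu>_def mult.assoc)
    finally show ?thesis .
  qed
  define r where "r = (\<lambda>t. \<nu> * (t - t1) + k * ((t - t1) / (T - t1)) ^ m)"
  define r' where "r' = (\<lambda>t. \<nu> + k * (real m * ((t - t1) / (T - t1)) ^ (m - 1) * (1 / (T - t1))))"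
  have r: "(r has_real_derivative r' t) (at t)" for t
    unfolding r_def r'_def using T by (auto intro!: derivative_eq_intros)
  have r'_pos: "r' t > 0" if "t > t1" for t
    unfolding r'_def using that T \<nu> K0
    by (intro add_pos_nonneg mult_nonneg_nonneg zero_le_power) (auto simp: k_def)
  have r_nonneg: "r t \<ge> 0" if "t \<ge> t1" for t
    unfolding r_def using that T \<nu> K0
    by (intro add_nonneg_nonneg mult_nonneg_nonneg zero_le_power) (auto simp: k_def)
  define \<rho> where "\<rho> = (\<lambda>z::'a \<times> real. r (snd z))"
  have rpf_\<rho>: "real_polynomial_function \<rho>"
    unfolding \<rho>_def r_def divide_inverse
    by (intro real_polynomial_function.intros real_polynomial_function_power
          real_polynomial_function_diff bounded_linear_snd)
  have "continuous_on (paraboloid t1 T) (\<lambda>z. W z - \<rho> z)"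
    by (intro continuous_intros cont rpf_continuous_on rpf_\<rho>)
  moreover have "paraboloid t1 T \<noteq> ({} :: ('a \<times> real) set)" using z by blast
  ultimately have "\<exists>y\<in>paraboloid t1 T. \<forall>z\<in>paraboloid t1 T. W z - \<rho> z \<le> W y - \<rho> y"
    by (intro continuous_attains_sup compact_paraboloid)
  then obtain y where y: "y \<in> paraboloid t1 T"
      "\<And>z. z \<in> paraboloid t1 T \<Longrightarrow> W z - \<rho> z \<le> W y - \<rho> y"
    by auto
  have "W z - \<rho> z > 0"
    using m \<nu>z pos by (simp add: \<rho>_def r_def x_def)
  with y(2)[OF z(1)] have ypos: "W y - \<rho> y > 0" by simp
  have y_t1: "snd y \<ge> t1"
    using y(1) inner_ge_zero[of "fst y"] unfolding paraboloid_def mem_Collect_eq by linarith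
  have "snd y \<noteq> T"
  proof
    assume "snd y = T"
    then have "\<rho> y \<ge> k" using T \<nu> by (simp add: \<rho>_def r_def)
    with K[OF y(1)] ypos show False by (simp add: k_def)
  qed
  moreover have "fst y \<bullet> fst y \<noteq> snd y - t1"
    using lateral[of y] ypos r_nonneg[OF y_t1] y(1) by (auto simp: \<rho>_def paraboloid_def)
  ultimately have yi: "fst y \<bullet> fst y < snd y - t1" "snd y < T"
    using y(1) by (auto simp: paraboloid_def)
  have "snd y > t1"
    using yi(1) inner_ge_zero[of "fst y"] by linarith
  then have "heat \<rho> y > 0"
    unfolding \<rho>_def heat_time_fun[OF r] by (rule r'_pos)
  moreover have "\<forall>\<^sub>F z' in nhds y. W z' - \<rho> z' \<le> W y - \<rho> y"
  proof -
    have "open {z :: 'a \<times> real. fst z \<bullet> fst z < snd z - t1 \<and> snd z < T}"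
      by (intro open_Collect_conj open_Collect_less continuous_intros)
    then have "\<forall>\<^sub>F z' in nhds y. z' \<in> {z. fst z \<bullet> fst z < snd z - t1 \<and> snd z < T}"
      using yi eventually_nhds_in_open by blast
    then show ?thesis
      by eventually_elim (auto intro!: y(2) simp: paraboloid_def)
  qed
  ultimately show False
    using nomax[OF rpf_\<rho> _ yi] by blast
qed

text \<open>At an interior maximum of F - \<rho> its heat operator is nonnegative, but it equals
  minus that of \<rho>, which is negative. This is applied to G and to -G.\<close>

lemma caloric_zero_on_paraboloid:
  fixes G :: "'a::euclidean_space \<times> real \<Rightarrow> real"
  assumes G: "real_polynomial_function G" "\<And>z. heat G z = 0"
    and lateral: "\<And>z. fst z \<bullet> fst z = snd z - t1 \<Longrightarrow> G z = 0"
    and z: "fst z \<bullet> fst z \<le> snd z - t1"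
  shows "G z = 0"
proof -
  have le: "F z \<le> 0" if F: "real_polynomial_function F" "\<And>z. heat F z = 0"
    "\<And>z. fst z \<bullet> fst z = snd z - t1 \<Longrightarrow> F z = 0" for F
  \<comment> \<open>The top lies one unit above \<open>z\<close>, because the maximum principle
    covers only points strictly below the top.\<close>
  proof (rule paraboloid_max_principle[of t1 "snd z + 1"])
    show "continuous_on (paraboloid t1 (snd z + 1)) F" by (rule rpf_continuous_on[OF F(1)])
    fix \<rho> and y :: "'a \<times> real"
    assume \<rho>: "real_polynomial_function \<rho>" "heat \<rho> y > 0"
      and max: "\<forall>\<^sub>F z' in nhds y. F z' - \<rho> z' \<le> F y - \<rho> y"
    note P = real_polynomial_function_diff[OF F(1) \<rho>(1)]
    have "heat (\<lambda>z. F z - \<rho> z) y \<ge> 0"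
      unfolding heat_def using rpf_local_max[OF P max] by (simp add: sum_nonpos)
    with \<rho>(2) F(2)[of y] show False by (simp add: heat_diff F(1) \<rho>(1))
  qed (use F(3) z in \<open>auto simp: paraboloid_def\<close>)
  have "G z \<le> 0" by (rule le) (use G lateral in auto)
  moreover have "- G z \<le> 0"
    by (rule le) (use G lateral in \<open>auto simp: heat_minus\<close>)
  ultimately show ?thesis by simp
qed

text \<open>Parabolic degree: a space coordinate counts 1 and time counts 2, so that the heat
  operator lowers the degree by 2. With an integer \<open>k\<close>, and only 0 of negative degree,
  derivatives subtract from \<open>k\<close> without case distinctions.\<close>

inductive pdeg :: "int \<Rightarrow> ('a::euclidean_space \<times> real \<Rightarrow> real) \<Rightarrow> bool" where
  pdeg_zero: "pdeg k (\<lambda>z. 0)"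
| pdeg_const: "0 \<le> k \<Longrightarrow> pdeg k (\<lambda>z. c)"
| pdeg_add: "pdeg k f \<Longrightarrow> pdeg k g \<Longrightarrow> pdeg k (\<lambda>z. f z + g z)"
| pdeg_space: "pdeg k f \<Longrightarrow> b \<in> Basis \<Longrightarrow> pdeg (k + 1) (\<lambda>z. (fst z \<bullet> b) * f z)"
| pdeg_time: "pdeg k f \<Longrightarrow> pdeg (k + 2) (\<lambda>z. snd z * f z)"
| pdeg_mono: "pdeg k f \<Longrightarrow> k \<le> l \<Longrightarrow> pdeg l f"

lemma rpf_fst_inner: "real_polynomial_function (\<lambda>z. fst z \<bullet> b)"
  by (intro real_polynomial_function.intros(1) bounded_linear_inner_left_comp bounded_linear_fst)

lemma rpf_snd: "real_polynomial_function (\<lambda>z. snd z)"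
  by (intro real_polynomial_function.intros(1) bounded_linear_snd)

lemma dd_fst_inner: "dd v (\<lambda>z. fst z \<bullet> b) = (\<lambda>z. fst v \<bullet> b)"
  by (intro dd_linear bounded_linear_inner_left_comp bounded_linear_fst)

lemma dd_snd: "dd v (\<lambda>z. snd z) = (\<lambda>z. snd v)"
  by (intro dd_linear bounded_linear_snd)

lemma pdeg_rpf: "pdeg k f \<Longrightarrow> real_polynomial_function f"
  by (induction rule: pdeg.induct)
     (auto intro: real_polynomial_function.intros(2-4) rpf_fst_inner rpf_snd)

lemma pdeg_cmult: "pdeg k f \<Longrightarrow> pdeg k (\<lambda>z. c * f z)"
proof (induction rule: pdeg.induct)
  case (pdeg_space k f b)
  from pdeg.pdeg_space[OF pdeg_space.IH pdeg_space.hyps(2)] show ?case by (simp add: mult.left_commute)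
next
  case (pdeg_time k f)
  from pdeg.pdeg_time[OF pdeg_time.IH] show ?case by (simp add: mult.left_commute)
qed (auto intro: pdeg.intros simp: distrib_left)

lemma pdeg_diff: "pdeg k f \<Longrightarrow> pdeg k g \<Longrightarrow> pdeg k (\<lambda>z. f z - g z)"
  using pdeg_add[OF _ pdeg_cmult[of k g "-1"]] by fastforce

lemma pdeg_sum:
  "(\<And>i. i \<in> I \<Longrightarrow> pdeg k (f i)) \<Longrightarrow> pdeg k (\<lambda>z. \<Sum>i\<in>I. f i z)"
  by (induction I rule: infinite_finite_induct) (auto intro: pdeg.intros)

lemma pdeg_mult: "pdeg k f \<Longrightarrow> pdeg l g \<Longrightarrow> pdeg (k + l) (\<lambda>z. f z * g z)"
proof (induction rule: pdeg.induct)
  case (pdeg_const k c)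
  then show ?case using pdeg_mono[OF pdeg_cmult[OF pdeg_const(2), of c], of "k + l"] by simp
next
  case (pdeg_space k f b)
  from pdeg.pdeg_space[OF pdeg_space.IH[OF pdeg_space.prems] pdeg_space.hyps(2)]
  show ?case by (simp add: algebra_simps)
next
  case (pdeg_time k f)
  from pdeg.pdeg_time[OF pdeg_time.IH[OF pdeg_time.prems]]
  show ?case by (simp add: algebra_simps)
next
  case (pdeg_mono k f m)
  show ?case
    by (rule pdeg.pdeg_mono[OF pdeg_mono.IH[OF pdeg_mono.prems]]) (use pdeg_mono.hyps in simp)
qed (auto intro: pdeg.intros simp: distrib_right)

lemma rpf_imp_pdeg:
  fixes f :: "'a::euclidean_space \<times> real \<Rightarrow> real"
  shows "real_polynomial_function f \<Longrightarrow> \<exists>k\<ge>0. pdeg k f"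
proof (induction rule: real_polynomial_function.induct)
  case (linear f)
  then interpret f: bounded_linear f .
  have eq: "f z = (\<Sum>b\<in>Basis. (fst z \<bullet> b) * f (b, 0)) + snd z * f (0, 1)" for z
  proof -
    have "z = (\<Sum>b\<in>Basis. (fst z \<bullet> b) *\<^sub>R (b, 0)) + snd z *\<^sub>R (0, 1)"
      by (cases z) (simp add: prod_eq_iff fst_sum snd_sum euclidean_representation)
    then have "f z = f ((\<Sum>b\<in>Basis. (fst z \<bullet> b) *\<^sub>R (b, 0)) + snd z *\<^sub>R (0, 1))" by simp
    then show ?thesis by (simp only: f.add f.sum f.scaleR real_scaleR_def)
  qed
  \<comment> \<open>Degree 2 instead of 1, to allow for the time coordinate.\<close>
  have "pdeg 2 (\<lambda>z. (fst z \<bullet> b) * f (b, 0))" if "b \<in> Basis" for b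
    using pdeg_mono[OF pdeg_space[OF pdeg_const[of 0 "f (b, 0)"] that], of 2] by simp
  moreover have "pdeg 2 (\<lambda>z::'a \<times> real. snd z * f (0, 1))"
    using pdeg_time[OF pdeg_const[of 0 "f (0, 1)"]] by simp
  ultimately have "pdeg 2 (\<lambda>z. (\<Sum>b\<in>Basis. (fst z \<bullet> b) * f (b, 0)) + snd z * f (0, 1))"
    by (intro pdeg_add pdeg_sum) auto
  then have "pdeg 2 f" by (simp flip: eq)
  then show ?case by (intro exI[of _ 2]) auto
next
  case (const c)
  then show ?case using pdeg_const[of 0 c] by blast
next
  case (add f g)
  then obtain k l where "k \<ge> 0" "pdeg k f" "l \<ge> 0" "pdeg l g" by blast
  then have "pdeg (max k l) (\<lambda>z. f z + g z)" "max k l \<ge> 0"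
    by (auto intro!: pdeg_add elim: pdeg_mono)
  then show ?case by blast
next
  case (mult f g)
  then obtain k l where "k \<ge> 0" "pdeg k f" "l \<ge> 0" "pdeg l g" by blast
  then have "pdeg (k + l) (\<lambda>z. f z * g z)" "k + l \<ge> 0"
    by (auto intro!: pdeg_mult)
  then show ?case by blast
qed

lemma pdeg_dd_space: "pdeg k f \<Longrightarrow> pdeg (k - 1) (dd (v, 0) f)"
proof (induction rule: pdeg.induct)
  case (pdeg_add k f g)
  then show ?case by (simp add: dd_add pdeg_rpf pdeg.pdeg_add)
next
  case (pdeg_space k f b)
  have "pdeg k (\<lambda>z. (fst z \<bullet> b) * dd (v, 0) f z + (v \<bullet> b) * f z)"
    using pdeg.pdeg_space[OF pdeg_space.IH pdeg_space.hyps(2)] pdeg_cmult[OF pdeg_space.hyps(1)]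
    by (intro pdeg.pdeg_add) auto
  then show ?case
    by (simp add: dd_mult[OF rpf_fst_inner] pdeg_rpf[OF pdeg_space.hyps(1)] dd_fst_inner)
next
  case (pdeg_time k f)
  have "pdeg (k - 1 + 2) (\<lambda>z. snd z * dd (v, 0) f z)"
    by (rule pdeg.pdeg_time[OF pdeg_time.IH])
  then show ?case
    by (simp add: dd_mult[OF rpf_snd] pdeg_rpf[OF pdeg_time.hyps(1)] dd_snd algebra_simps)
next
  case (pdeg_mono k f l)
  then show ?case using pdeg.pdeg_mono[of "k - 1" _ "l - 1"] by simp
qed (auto intro: pdeg.intros)

lemma pdeg_dd_time: "pdeg k f \<Longrightarrow> pdeg (k - 2) (dd (0, 1) f)"
proof (induction rule: pdeg.induct)
  case (pdeg_add k f g)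
  then show ?case by (simp add: dd_add pdeg_rpf pdeg.pdeg_add)
next
  case (pdeg_space k f b)
  have "pdeg (k + 1 - 2) (\<lambda>z. (fst z \<bullet> b) * dd (0, 1) f z)"
    using pdeg.pdeg_space[OF pdeg_space.IH pdeg_space.hyps(2)] by simp
  then show ?case
    by (simp add: dd_mult[OF rpf_fst_inner] pdeg_rpf[OF pdeg_space.hyps(1)] dd_fst_inner)
next
  case (pdeg_time k f)
  have "pdeg k (\<lambda>z. snd z * dd (0, 1) f z + f z)"
    using pdeg.pdeg_time[OF pdeg_time.IH] pdeg_time.hyps(1)
    by (intro pdeg.pdeg_add) auto
  then show ?case
    by (simp add: dd_mult[OF rpf_snd] pdeg_rpf[OF pdeg_time.hyps(1)] dd_snd)
next
  case (pdeg_mono k f l)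
  then show ?case using pdeg.pdeg_mono[of "k - 2" _ "l - 2"] by simp
qed (auto intro: pdeg.intros)

lemma pdeg_heat: "pdeg k f \<Longrightarrow> pdeg (k - 2) (heat f)"
  unfolding heat_def[abs_def]
  using pdeg_dd_space[of "k - 1"] pdeg_dd_space[of k]
  by (intro pdeg_diff pdeg_dd_time pdeg_sum) fastforce+

text \<open>An injective linear endomorphism in finite dimension is onto. Since \<open>T\<close> is
  linear only on \<open>W\<close>, it is replaced by the linear extension \<open>g\<close> of its
  values on a basis of \<open>W\<close>.\<close>

lemma (in vector_space) subspace_inj_imp_surj:
  assumes W: "subspace W" and B: "finite B" "W \<subseteq> span B"
    and T: "\<And>f. f \<in> W \<Longrightarrow> T f \<in> W"
    and T_add: "\<And>f g. f \<in> W \<Longrightarrow> g \<in> W \<Longrightarrow> T (f + g) = T f + T g"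
    and T_scale: "\<And>c f. f \<in> W \<Longrightarrow> T (scale c f) = scale c (T f)"
    and inj: "\<And>f. f \<in> W \<Longrightarrow> T f = 0 \<Longrightarrow> f = 0"
    and S: "S \<in> W"
  shows "\<exists>f\<in>W. T f = S"
proof -
  interpret vp: vector_space_pair scale scale ..
  obtain C where C: "C \<subseteq> W" "independent C" "W \<subseteq> span C"
    using maximal_independent_subset[of W] by blast
  have spanC: "span C = W"
    using C span_minimal[OF C(1) W] by blast
  have finC: "finite C"
    using independent_span_bound[OF B(1) C(2)] C(1) B(2) by blast
  obtain g where g: "Vector_Spaces.linear scale scale g" "\<And>x. x \<in> C \<Longrightarrow> g x = T x"
    using vp.linear_independent_extend[OF C(2), of T] by blast
  interpret g: Vector_Spaces.linear scale scale g by (rule g)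
  have gT: "g f = T f" if "f \<in> W" for f
  proof -
    have "f \<in> span C" using that spanC by simp
    then have "f \<in> W \<and> g f = T f"
    proof (rule span_induct)
      have "T 0 = 0"
        using T_scale[OF S, of 0] by simp
      then show "subspace {f. f \<in> W \<and> g f = T f}"
        using W by (auto simp: subspace_def g.add g.scale T_add T_scale)
    qed (use C(1) g(2) in auto)
    then show ?thesis by simp
  qed
  have "inj_on g (span C)"
  proof (rule inj_onI)
    fix x y assume xy: "x \<in> span C" "y \<in> span C" "g x = g y"
    then have "x - y \<in> W" using spanC W subspace_diff by blast
    moreover have "T (x - y) = 0" using gT[OF calculation] xy by (simp add: g.diff)
    ultimately show "x = y" using inj[of "x - y"] by simp
  qed
  then have ind: "independent (g ` C)" and card: "card (g ` C) = card C"
    using g.independent_inj_on_image[OF C(2)] span_superset[of C]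
    by (auto intro!: card_image intro: inj_on_subset)
  \<comment> \<open>Otherwise \<open>S\<close> and the images of the basis would be too many
    independent vectors in \<open>span C\<close>.\<close>
  have "S \<in> span (g ` C)"
  proof (rule ccontr)
    assume nS: "S \<notin> span (g ` C)"
    then have "independent (insert S (g ` C))" using ind by (rule independent_insertI)
    moreover have "insert S (g ` C) \<subseteq> span C"
      using S C(1) T gT spanC by auto
    ultimately have "card (insert S (g ` C)) \<le> card C"
      using independent_span_bound[OF finC] by blast
    moreover have "S \<notin> g ` C" using nS span_superset by blast
    ultimately show False using card finC by simp
  qed
  then have "S \<in> g ` span C" using g.span_image by blast
  then show ?thesis using gT spanC by auto
qed

text \<open>Products of at most \<open>k\<close> coordinates. A coordinate has degree at least 1, so
  all monomials of parabolic degree up to \<open>k\<close> occur, and some of higher degree; what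
  matters is a finite spanning set.\<close>

fun monomials :: "nat \<Rightarrow> ('a::euclidean_space \<times> real \<Rightarrow> real) set" where
  "monomials 0 = {\<lambda>z. 1}"
| "monomials (Suc k) = monomials k \<union> (\<Union>b\<in>Basis. (\<lambda>f z. (fst z \<bullet> b) * f z) ` monomials k)
     \<union> (\<lambda>f z. snd z * f z) ` monomials k"

lemma finite_monomials: "finite (monomials k)"
  by (induction k) auto

interpretation fun_space: vector_space "\<lambda>(c::real) (f::'z \<Rightarrow> real) z. c * f z"
  by unfold_locales (auto simp: fun_eq_iff algebra_simps)

text \<open>Makes the polynomials of bounded degree a finite-dimensional space. The negative case is
  carried along because multiplication by a coordinate may lead from a negative degree to a
  nonnegative one.\<close>

lemma pdeg_span_monomials:
  "pdeg k f \<Longrightarrow> (k < 0 \<longrightarrow> f = (\<lambda>z. 0)) \<and> (0 \<le> k \<longrightarrow> f \<in> fun_space.span (monomials (nat k)))"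
proof -
  have mono: "monomials k \<subseteq> (monomials l :: ('a \<times> real \<Rightarrow> real) set)" if "k \<le> l" for k l
    using that by (induction rule: dec_induct) auto
  have zero: "(\<lambda>z. 0) \<in> fun_space.span B" for B :: "('a \<times> real \<Rightarrow> real) set"
    using fun_space.span_zero[of B] by (simp add: zero_fun_def)
  have mult: "(\<lambda>z. p z * f z) \<in> fun_space.span (monomials (Suc k))"
    if p: "\<And>g. g \<in> monomials k \<Longrightarrow> (\<lambda>z. p z * g z) \<in> monomials (Suc k)"
      and f: "f \<in> fun_space.span (monomials k)" for p f :: "'a \<times> real \<Rightarrow> real" and k
  proof -
    let ?S = "fun_space.span (monomials (Suc k)) :: ('a \<times> real \<Rightarrow> real) set"
    have "fun_space.subspace {f. (\<lambda>z. p z * f z) \<in> ?S}"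
    proof (rule fun_space.subspaceI, unfold mem_Collect_eq)
      show "(\<lambda>z. p z * 0 z) \<in> ?S" using zero by simp
      show "(\<lambda>z. p z * (f + g) z) \<in> ?S"
        if "(\<lambda>z. p z * f z) \<in> ?S" "(\<lambda>z. p z * g z) \<in> ?S" for f g
        using fun_space.span_add[OF that] by (simp only: plus_fun_def distrib_left)
      show "(\<lambda>z. p z * (c * f z)) \<in> ?S" if "(\<lambda>z. p z * f z) \<in> ?S" for c f
        using fun_space.span_scale[OF that, of c] by (simp only: mult.left_commute)
    qed
    moreover have "monomials k \<subseteq> {f. (\<lambda>z. p z * f z) \<in> ?S}"
      using p fun_space.span_base by blast
    ultimately show ?thesis using fun_space.span_minimal f by blast
  qed
  assume "pdeg k f"
  then show "(k < 0 \<longrightarrow> f = (\<lambda>z. 0)) \<and> (0 \<le> k \<longrightarrow> f \<in> fun_space.span (monomials (nat k)))"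
  proof (induction rule: pdeg.induct)
    case (pdeg_const k c)
    have "(\<lambda>z. 1) \<in> (monomials (nat k) :: ('a \<times> real \<Rightarrow> real) set)"
      using mono[of 0 "nat k"] by simp
    from fun_space.span_scale[OF fun_space.span_base[OF this], of c]
    show ?case using pdeg_const by simp
  next
    case (pdeg_add k f g)
    then show ?case
      using fun_space.span_add[of f "monomials (nat k)" g] by (auto simp: plus_fun_def)
  next
    case (pdeg_space k f b)
    show ?case
    proof (cases "k < 0")
      case True
      then show ?thesis using pdeg_space.IH zero by auto
    next
      case False
      have "(\<lambda>z. (fst z \<bullet> b) * f z) \<in> fun_space.span (monomials (Suc (nat k)))"
        by (rule mult) (use pdeg_space False in auto)
      then show ?thesis using False by (simp add: nat_add_distrib)
    qed
  next
    case (pdeg_time k f)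
    show ?case
    proof (cases "k < 0")
      case True
      then show ?thesis using pdeg_time.IH zero by auto
    next
      case False
      have "(\<lambda>z. snd z * f z) \<in> fun_space.span (monomials (Suc (nat k)))"
        by (rule mult) (use pdeg_time False in auto)
      moreover have "Suc (nat k) \<le> nat (k + 2)" using False by simp
      note fun_space.span_mono[OF mono[OF this]]
      ultimately have "(\<lambda>z. snd z * f z) \<in> fun_space.span (monomials (nat (k + 2)))"
        by (rule subsetD[rotated])
      then show ?thesis using False by simp
    qed
  next
    case (pdeg_mono k f l)
    show ?case
    proof (cases "k < 0")
      case True
      then show ?thesis using pdeg_mono.IH zero by auto
    next
      case False
      then have "f \<in> fun_space.span (monomials (nat k))" using pdeg_mono.IH by simp
      moreover have "nat k \<le> nat l" using pdeg_mono.hyps by simp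
      note fun_space.span_mono[OF mono[OF this]]
      ultimately have "f \<in> fun_space.span (monomials (nat l))"
        by (rule subsetD[rotated])
      then show ?thesis using False pdeg_mono.hyps by simp
    qed
  qed (auto simp: zero)
qed

text \<open>\<open>R \<mapsto> heat (q R)\<close>, with \<open>q\<close> the defining function of the paraboloid, is an injective endomorphism
  of the polynomials of bounded parabolic degree, hence onto; \<open>P - q R\<close> is the required extension.\<close>

lemma caloric_extension:
  fixes P :: "'a::euclidean_space \<times> real \<Rightarrow> real"
  assumes P: "real_polynomial_function P"
  obtains h where "real_polynomial_function h" "\<And>z. heat h z = 0"
    "\<And>z. fst z \<bullet> fst z = snd z - t1 \<Longrightarrow> h z = P z"
proof -
  define q where "q = (\<lambda>z::'a \<times> real. fst z \<bullet> fst z - snd z + t1)"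
  have q: "pdeg 2 q"
  proof -
    have "pdeg 2 (\<lambda>z::'a \<times> real. (fst z \<bullet> b) * (fst z \<bullet> b))" if "b \<in> Basis" for b
      using pdeg_space[OF pdeg_space[OF pdeg_const[of 0 1] that] that] by simp
    then have "pdeg 2 (\<lambda>z::'a \<times> real. \<Sum>b\<in>Basis. (fst z \<bullet> b) * (fst z \<bullet> b))"
      by (intro pdeg_sum) auto
    then have "pdeg 2 (\<lambda>z::'a \<times> real. fst z \<bullet> fst z)"
      by (subst euclidean_inner) simp
    moreover have "pdeg 2 (\<lambda>z::'a \<times> real. snd z)"
      using pdeg_time[OF pdeg_const[of 0 1]] by simp
    ultimately show ?thesis
      unfolding q_def by (intro pdeg_add pdeg_diff pdeg_const) auto
  qed
  note rpf_q = pdeg_rpf[OF q]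
  obtain k where k: "k \<ge> 0" "pdeg k P" using rpf_imp_pdeg[OF P] by blast
  have "\<exists>R\<in>Collect (pdeg k). heat (\<lambda>z. q z * R z) = heat P"
  proof (rule fun_space.subspace_inj_imp_surj[where B = "monomials (nat k)"])
    show "fun_space.subspace (Collect (pdeg k :: ('a \<times> real \<Rightarrow> real) \<Rightarrow> bool))"
      by (rule fun_space.subspaceI)
         (auto simp: zero_fun_def plus_fun_def intro: pdeg_zero pdeg_add pdeg_cmult)
    show "finite (monomials (nat k))" by (rule finite_monomials)
    show "Collect (pdeg k) \<subseteq> fun_space.span (monomials (nat k))"
      using pdeg_span_monomials k(1) by fastforce
    \<comment> \<open>Multiplication by \<open>q\<close> raises the degree by 2 and
      \<open>heat\<close> lowers it by 2.\<close>
    show "heat (\<lambda>z. q z * R z) \<in> Collect (pdeg k)" if "R \<in> Collect (pdeg k)" for R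
      using pdeg_heat[OF pdeg_mult[OF q], of k R] that by simp
    show "heat P \<in> Collect (pdeg k)"
      using pdeg_mono[OF pdeg_heat[OF k(2)], of k] by simp
    show "heat (\<lambda>z. q z * (f + g) z) = heat (\<lambda>z. q z * f z) + heat (\<lambda>z. q z * g z)"
      if "f \<in> Collect (pdeg k)" "g \<in> Collect (pdeg k)" for f g
    proof -
      have "real_polynomial_function (\<lambda>z. q z * f z)" "real_polynomial_function (\<lambda>z. q z * g z)"
        using that pdeg_rpf rpf_q by (auto intro!: real_polynomial_function.intros(4))
      then show ?thesis by (simp add: fun_eq_iff distrib_left heat_add)
    qed
    show "heat (\<lambda>z. q z * (c * f z)) = (\<lambda>z. c * heat (\<lambda>z. q z * f z) z)"
      if "f \<in> Collect (pdeg k)" for c f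
    proof -
      have "real_polynomial_function (\<lambda>z. q z * f z)"
        using that pdeg_rpf rpf_q by (auto intro!: real_polynomial_function.intros(4))
      then show ?thesis by (simp add: fun_eq_iff mult.left_commute heat_cmult)
    qed
    \<comment> \<open>\<open>q f\<close> is caloric and vanishes on the lateral surface, hence in
      the whole paraboloid; inside, \<open>q\<close> is negative, so \<open>f\<close> vanishes on an
      open set and therefore everywhere.\<close>
    show "f = 0" if "f \<in> Collect (pdeg k)" and h0: "heat (\<lambda>z. q z * f z) = 0" for f
    proof -
      have rf: "real_polynomial_function f" using that pdeg_rpf by auto
      have G: "q z * f z = 0" if "fst z \<bullet> fst z \<le> snd z - t1" for z
      proof (rule caloric_zero_on_paraboloid[of "\<lambda>z. q z * f z"])
        show "real_polynomial_function (\<lambda>z. q z * f z)"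
          by (intro real_polynomial_function.intros(4) rpf_q rf)
        show "fst z \<bullet> fst z \<le> snd z - t1" by fact
      qed (use h0 in \<open>auto simp: q_def fun_eq_iff\<close>)
      have "f z = 0" for z
      proof (rule rpf_zero_on_open[OF rf, of "{z. fst z \<bullet> fst z < snd z - t1}" "(0, t1 + 1)"])
        show "open {z::'a \<times> real. fst z \<bullet> fst z < snd z - t1}"
          by (intro open_Collect_less continuous_intros)
        show "f y = 0" if "y \<in> {z. fst z \<bullet> fst z < snd z - t1}" for y
          using G[of y] that by (auto simp: q_def)
      qed simp
      then show ?thesis by (simp add: fun_eq_iff)
    qed
  qed
  then obtain R where R: "pdeg k R" "heat (\<lambda>z. q z * R z) = heat P" by blast
  have rqR: "real_polynomial_function (\<lambda>z. q z * R z)"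
    by (intro real_polynomial_function.intros(4) rpf_q pdeg_rpf[OF R(1)])
  show ?thesis
  proof (rule that[of "\<lambda>z. P z - q z * R z"])
    show "real_polynomial_function (\<lambda>z. P z - q z * R z)"
      by (intro real_polynomial_function_diff P rqR)
    show "heat (\<lambda>z. P z - q z * R z) z = 0" for z
      by (simp add: heat_diff P rqR R(2))
  qed (simp add: q_def)
qed

section \<open>Sums of viscosity subsolutions of the heat equation\<close>

lemma rpf_fst_norm:
  "real_polynomial_function (\<lambda>z::'a::euclidean_space \<times> 'b::real_normed_vector. fst z \<bullet> fst z)"
proof -
  have "real_polynomial_function (\<lambda>z::'a \<times> 'b.
      \<Sum>b\<in>Basis. (fst z \<bullet> b) * (fst z \<bullet> b))"
    by (intro real_polynomial_function_sum real_polynomial_function.intros(4) rpf_fst_inner) auto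
  then show ?thesis by (subst euclidean_inner) simp
qed

lemma dd_fst_norm:
  fixes v :: "'a::real_inner \<times> 'b::real_normed_vector"
  shows "dd v (\<lambda>z. fst z \<bullet> fst z) = (\<lambda>z. 2 * (fst z \<bullet> fst v))"
proof (rule ext)
  fix z :: "'a \<times> 'b"
  have "((\<lambda>z::'a \<times> 'b. fst z \<bullet> fst z) has_derivative (\<lambda>h. fst z \<bullet> fst h + fst h \<bullet> fst z)) (at z)"
    by (auto intro!: derivative_eq_intros)
  from dd_eqI[OF this, of v] show "dd v (\<lambda>z. fst z \<bullet> fst z) z = 2 * (fst z \<bullet> fst v)"
    by (simp add: inner_commute)
qed

lemma heat_fst_norm:
  "heat (\<lambda>z. fst z \<bullet> fst z) (z :: 'a::euclidean_space \<times> real) = - 2 * real DIM('a)"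
  by (simp add: heat_def dd_fst_norm dd_cmult[OF rpf_fst_inner] dd_fst_inner sum_distrib_left[symmetric])

lemma rpf_snd_power: "real_polynomial_function (\<lambda>z. (snd z - c) ^ k)"
  by (intro real_polynomial_function_power real_polynomial_function_diff rpf_snd
      real_polynomial_function.intros(2))

lemma heat_linear_time: "heat (\<lambda>z. c * snd z) z = c"
  by (rule heat_time_fun[of "\<lambda>t. c * t" "\<lambda>t. c"]) (auto intro!: derivative_eq_intros)

lemma heat_square_time: "heat (\<lambda>z. (snd z - c)\<^sup>2) z = 2 * (snd z - c)"
  by (rule heat_time_fun[of "\<lambda>t. (t - c)\<^sup>2" "\<lambda>t. 2 * (t - c)"]) (auto intro!: derivative_eq_intros)

text \<open>\<open>U1\<close> lies below the caloric polynomial with (almost) its own lateral values, and \<open>U2\<close> below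
  \<open>\<theta>\<close> minus that polynomial; adding the two bounds at the centre contradicts the gap on the lateral
  boundary. No second derivatives of \<open>U1\<close> and \<open>U2\<close> are needed.\<close>

lemma heat_subsolution_sum:
  fixes U1 U2 \<theta> :: "'a::euclidean_space \<times> real \<Rightarrow> real"
  assumes cont: "continuous_on UNIV U1" "continuous_on UNIV U2"
    and sub1: "\<forall>\<^sub>F z in nhds (0, \<tau>). \<forall>\<psi>. real_polynomial_function \<psi> \<longrightarrow>
        (\<forall>\<^sub>F z' in nhds z. U1 z' - \<psi> z' \<le> U1 z - \<psi> z) \<longrightarrow> heat \<psi> z \<le> g1"
    and sub2: "\<forall>\<^sub>F z in nhds (0, \<tau>). \<forall>\<psi>. real_polynomial_function \<psi> \<longrightarrow>
        (\<forall>\<^sub>F z' in nhds z. U2 z' - \<psi> z' \<le> U2 z - \<psi> z) \<longrightarrow> heat \<psi> z \<le> g2"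
    and \<theta>: "real_polynomial_function \<theta>"
    and max: "\<forall>\<^sub>F z in nhds (0, \<tau>). U1 z + U2 z - \<theta> z \<le> U1 (0, \<tau>) + U2 (0, \<tau>) - \<theta> (0, \<tau>)"
  shows "heat \<theta> (0, \<tau>) \<le> g1 + g2"
proof (rule ccontr)
  let ?z0 = "(0, \<tau>) :: 'a \<times> real"
  assume contra: "\<not> ?thesis"
  define e where "e = heat \<theta> ?z0 - (g1 + g2)"
  have e: "e > 0" using contra by (simp add: e_def)
  \<comment> \<open>The term \<open>\<kappa> * p\<close> makes the maximum strict. It lowers the
    heat operator of \<theta> at the centre by 2 \<kappa> DIM = e/2, which leaves half of the excess
    \<open>e\<close>.\<close>
  define \<kappa> where "\<kappa> = e / (4 * DIM('a))"
  have \<kappa>: "\<kappa> > 0" using e by (simp add: \<kappa>_def)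
  define p where "p = (\<lambda>z::'a \<times> real. fst z \<bullet> fst z + (snd z - \<tau>)\<^sup>2)"
  have p: "real_polynomial_function p"
    unfolding p_def by (intro real_polynomial_function.intros(3) rpf_fst_norm rpf_snd_power)
  define \<theta>' where "\<theta>' = (\<lambda>z. \<theta> z + \<kappa> * p z)"
  have \<theta>': "real_polynomial_function \<theta>'"
    unfolding \<theta>'_def by (intro real_polynomial_function.intros(3) \<theta> rpf_cmult p)
  have "heat \<theta>' ?z0 = heat \<theta> ?z0 + \<kappa> * (- 2 * DIM('a))"
    unfolding \<theta>'_def heat_add[OF \<theta> rpf_cmult[OF p]] heat_cmult[OF p]
    unfolding p_def heat_add[OF rpf_fst_norm rpf_snd_power] heat_fst_norm heat_square_time by simp
  also have "\<dots> = g1 + g2 + e / 2" by (simp add: e_def \<kappa>_def field_simps)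
  finally have "heat \<theta>' ?z0 > g1 + g2" using e by simp
  moreover have "(heat \<theta>' \<longlongrightarrow> heat \<theta>' ?z0) (nhds ?z0)"
    using rpf_continuous_on[OF rpf_heat[OF \<theta>'], of UNIV]
    by (simp add: continuous_on_eq_continuous_at continuous_at tendsto_at_iff_tendsto_nhds)
  ultimately have "\<forall>\<^sub>F z in nhds ?z0. heat \<theta>' z > g1 + g2"
    by (rule order_tendstoD(1)[rotated])
  with sub1 sub2 max have "\<forall>\<^sub>F z in nhds ?z0.
      (\<forall>\<psi>. real_polynomial_function \<psi> \<longrightarrow>
        (\<forall>\<^sub>F z' in nhds z. U1 z' - \<psi> z' \<le> U1 z - \<psi> z) \<longrightarrow> heat \<psi> z \<le> g1) \<and>
      (\<forall>\<psi>. real_polynomial_function \<psi> \<longrightarrow>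
        (\<forall>\<^sub>F z' in nhds z. U2 z' - \<psi> z' \<le> U2 z - \<psi> z) \<longrightarrow> heat \<psi> z \<le> g2) \<and>
      U1 z + U2 z - \<theta> z \<le> U1 ?z0 + U2 ?z0 - \<theta> ?z0 \<and> heat \<theta>' z > g1 + g2"
    by eventually_elim blast
  then obtain r where r: "r > 0" and near: "\<And>z. dist z ?z0 < r \<Longrightarrow>
      (\<forall>\<psi>. real_polynomial_function \<psi> \<longrightarrow>
        (\<forall>\<^sub>F z' in nhds z. U1 z' - \<psi> z' \<le> U1 z - \<psi> z) \<longrightarrow> heat \<psi> z \<le> g1) \<and>
      (\<forall>\<psi>. real_polynomial_function \<psi> \<longrightarrow>
        (\<forall>\<^sub>F z' in nhds z. U2 z' - \<psi> z' \<le> U2 z - \<psi> z) \<longrightarrow> heat \<psi> z \<le> g2) \<and>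
      U1 z + U2 z - \<theta> z \<le> U1 ?z0 + U2 ?z0 - \<theta> ?z0 \<and> heat \<theta>' z > g1 + g2"
    unfolding eventually_nhds_metric by blast
  note near1 = near[THEN conjunct1, rule_format]
  note near2 = near[THEN conjunct2, THEN conjunct1, rule_format]
  note near3 = near[THEN conjunct2, THEN conjunct2, THEN conjunct1]
  note near4 = near[THEN conjunct2, THEN conjunct2, THEN conjunct2]
  \<comment> \<open>On the paraboloid between the times \<tau> - \<sigma> and \<tau> + \<sigma>,
    |x|^2 \<le> 2 \<sigma> and (t - \<tau>)^2 \<le> \<sigma>^2 \<le> \<sigma>, so its points are
    nearer to the centre than \<open>r\<close>.\<close>
  define \<sigma> where "\<sigma> = min 1 (r\<^sup>2 / 4)"
  have \<sigma>: "\<sigma> > 0" "\<sigma> \<le> 1" "4 * \<sigma> \<le> r\<^sup>2" using r by (auto simp: \<sigma>_def min_def)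
  define D where "D = (paraboloid (\<tau> - \<sigma>) (\<tau> + \<sigma>) :: ('a \<times> real) set)"
  have D_ball: "dist z ?z0 < r" if "z \<in> D" for z
  proof -
    have z: "fst z \<bullet> fst z \<le> snd z - (\<tau> - \<sigma>)" "snd z \<le> \<tau> + \<sigma>"
      using that by (auto simp: D_def paraboloid_def)
    then have "\<bar>snd z - \<tau>\<bar> \<le> \<sigma>" using inner_ge_zero[of "fst z"] by linarith
    then have "(snd z - \<tau>)\<^sup>2 \<le> \<sigma>\<^sup>2" using abs_le_square_iff[of "snd z - \<tau>" \<sigma>] \<sigma> by simp
    also have "\<sigma>\<^sup>2 \<le> \<sigma>" using \<sigma> by (simp add: power2_eq_square mult_left_le)
    finally have "fst z \<bullet> fst z + (snd z - \<tau>)\<^sup>2 < r\<^sup>2" using z \<sigma> by linarith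
    then have "sqrt (fst z \<bullet> fst z + (snd z - \<tau>)\<^sup>2) < r"
      by (intro real_less_lsqrt less_imp_le[OF r])
    then show ?thesis
      by (cases z) (simp add: norm_Pair dist_norm power2_norm_eq_inner power2_abs)
  qed
  \<comment> \<open>Lower bound of \<open>p\<close> on the lateral surface: up to time \<tau> -
    \<sigma>/2 the time square is at least \<sigma>^2/4, later |x|^2 exceeds \<sigma>/2.\<close>
  define c where "c = min (\<sigma> / 2) (\<sigma>\<^sup>2 / 4)"
  have c: "c > 0" using \<sigma> by (simp add: c_def)
  have gap: "p z \<ge> c" if "fst z \<bullet> fst z = snd z - (\<tau> - \<sigma>)" for z
  proof (cases "snd z - \<tau> \<le> - \<sigma> / 2")
    case True
    then have "(\<sigma> / 2)\<^sup>2 \<le> (snd z - \<tau>)\<^sup>2"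
      using abs_le_square_iff[of "\<sigma> / 2" "snd z - \<tau>"] \<sigma> by simp
    then have "\<sigma>\<^sup>2 / 4 \<le> (snd z - \<tau>)\<^sup>2" by (simp add: power_divide)
    moreover have "c \<le> \<sigma>\<^sup>2 / 4" by (simp add: c_def)
    ultimately show ?thesis unfolding p_def using inner_ge_zero[of "fst z"] by linarith
  next
    case False
    moreover have "c \<le> \<sigma> / 2" by (simp add: c_def)
    ultimately show ?thesis unfolding p_def using that zero_le_power2[of "snd z - \<tau>"] by linarith
  qed
  define m where "m = U1 ?z0 + U2 ?z0 - \<theta> ?z0"
  \<comment> \<open>The lateral gap is 4 \<eta>. Approximating \<open>U1\<close> costs 2 \<eta>, and
    the remaining 2 \<eta> give the contradiction.\<close>
  define \<eta> where "\<eta> = \<kappa> * c / 4"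
  have \<eta>: "\<eta> > 0" "\<kappa> * c = 4 * \<eta>" using \<kappa> c by (auto simp: \<eta>_def)
  have lateral: "U1 z + U2 z - \<theta>' z \<le> m - 4 * \<eta>"
    if "fst z \<bullet> fst z = snd z - (\<tau> - \<sigma>)" "snd z \<le> \<tau> + \<sigma>" for z
  proof -
    have "z \<in> D" using that by (simp add: D_def paraboloid_def)
    from near3[OF D_ball[OF this]] have "U1 z + U2 z - \<theta> z \<le> m" by (simp add: m_def)
    moreover have "\<kappa> * p z \<ge> 4 * \<eta>"
      unfolding \<eta>(2)[symmetric] using gap[OF that(1)] \<kappa> by simp
    ultimately show ?thesis by (simp add: \<theta>'_def)
  qed
  \<comment> \<open>The shift by \<eta> makes the approximation one-sided: \<open>P\<close> lies
    above U1 - g1 t, by less than 2 \<eta>.\<close>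
  have "continuous_on D (\<lambda>z. U1 z - g1 * snd z + \<eta>)"
    by (intro continuous_intros continuous_on_subset[OF cont(1)]) auto
  then obtain P where P: "real_polynomial_function P"
      "\<And>z. z \<in> D \<Longrightarrow> \<bar>U1 z - g1 * snd z + \<eta> - P z\<bar> < \<eta>"
    using Stone_Weierstrass_real_polynomial_function[of D "\<lambda>z. U1 z - g1 * snd z + \<eta>" \<eta>]
      compact_paraboloid \<eta>(1) unfolding D_def by metis
  obtain h where h: "real_polynomial_function h" "\<And>z. heat h z = 0"
    "\<And>z. fst z \<bullet> fst z = snd z - (\<tau> - \<sigma>) \<Longrightarrow> h z = P z"
    using caloric_extension[OF P(1), of "\<tau> - \<sigma>"] by metis
  have g1t: "real_polynomial_function (\<lambda>z::'a \<times> real. g1 * snd z)"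
    by (intro rpf_cmult rpf_snd)
  have interior_D: "z \<in> D" if "fst z \<bullet> fst z < snd z - (\<tau> - \<sigma>)" "snd z < \<tau> + \<sigma>" for z
    using that by (simp add: D_def paraboloid_def)
  have z0: "?z0 \<in> paraboloid (\<tau> - \<sigma>) (\<tau> + \<sigma>)" "snd ?z0 < \<tau> + \<sigma>"
    using \<sigma> by (auto simp: paraboloid_def)
  have "U1 ?z0 - (g1 * snd ?z0 + h ?z0) \<le> 0"
  proof (rule paraboloid_max_principle[OF _ _ _ z0])
    show "continuous_on (paraboloid (\<tau> - \<sigma>) (\<tau> + \<sigma>)) (\<lambda>z. U1 z - (g1 * snd z + h z))"
      by (intro continuous_intros continuous_on_subset[OF cont(1)] rpf_continuous_on h(1)) auto
    show "U1 z - (g1 * snd z + h z) \<le> 0"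
      if "fst z \<bullet> fst z = snd z - (\<tau> - \<sigma>)" "snd z \<le> \<tau> + \<sigma>" for z
    proof -
      have "z \<in> D" using that by (simp add: D_def paraboloid_def)
      from P(2)[OF this] h(3)[OF that(1)] show ?thesis by simp
    qed
    show False if "real_polynomial_function \<rho>" "heat \<rho> z > 0"
      "fst z \<bullet> fst z < snd z - (\<tau> - \<sigma>)" "snd z < \<tau> + \<sigma>"
      "\<forall>\<^sub>F z' in nhds z. U1 z' - (g1 * snd z' + h z') - \<rho> z' \<le> U1 z - (g1 * snd z + h z) - \<rho> z" for \<rho> z
    proof -
      let ?\<psi> = "\<lambda>z. (g1 * snd z + h z) + \<rho> z"
      have "heat ?\<psi> z = g1 + heat \<rho> z"
        by (simp add: heat_add g1t h that(1) real_polynomial_function.intros(3) heat_linear_time)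
      moreover have "heat ?\<psi> z \<le> g1"
      proof (rule near1[OF D_ball[OF interior_D[OF that(3,4)]]])
        show "real_polynomial_function ?\<psi>"
          by (intro real_polynomial_function.intros(3) g1t h(1) that(1))
        show "\<forall>\<^sub>F z' in nhds z. U1 z' - ?\<psi> z' \<le> U1 z - ?\<psi> z"
          using that(5) by eventually_elim simp
      qed
      ultimately show False using that(2) by simp
    qed
  qed
  \<comment> \<open>The comparison function for \<open>U2\<close> has heat operator
    \<open>heat \<theta>' - g1\<close>, which exceeds \<open>g2\<close> on the paraboloid; a
    touching would violate the inequality for \<open>U2\<close>.\<close>
  moreover have "U2 ?z0 - (\<theta>' ?z0 - (g1 * snd ?z0 + h ?z0) + (m - 2 * \<eta>)) \<le> 0"
  proof (rule paraboloid_max_principle[OF _ _ _ z0])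
    show "continuous_on (paraboloid (\<tau> - \<sigma>) (\<tau> + \<sigma>))
        (\<lambda>z. U2 z - (\<theta>' z - (g1 * snd z + h z) + (m - 2 * \<eta>)))"
      by (intro continuous_intros continuous_on_subset[OF cont(2)] rpf_continuous_on h(1) \<theta>') auto
    show "U2 z - (\<theta>' z - (g1 * snd z + h z) + (m - 2 * \<eta>)) \<le> 0"
      if "fst z \<bullet> fst z = snd z - (\<tau> - \<sigma>)" "snd z \<le> \<tau> + \<sigma>" for z
    proof -
      have "z \<in> D" using that by (simp add: D_def paraboloid_def)
      from P(2)[OF this] h(3)[OF that(1)] lateral[OF that] show ?thesis by linarith
    qed
    show False if "real_polynomial_function \<rho>" "heat \<rho> z > 0"
      "fst z \<bullet> fst z < snd z - (\<tau> - \<sigma>)" "snd z < \<tau> + \<sigma>"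
      "\<forall>\<^sub>F z' in nhds z. U2 z' - (\<theta>' z' - (g1 * snd z' + h z') + (m - 2 * \<eta>)) - \<rho> z'
        \<le> U2 z - (\<theta>' z - (g1 * snd z + h z) + (m - 2 * \<eta>)) - \<rho> z" for \<rho> z
    proof -
      let ?\<psi> = "\<lambda>z. (\<theta>' z - (g1 * snd z + h z)) + \<rho> z"
      have zr: "dist z ?z0 < r" by (rule D_ball[OF interior_D[OF that(3,4)]])
      have "heat ?\<psi> z = heat \<theta>' z - g1 + heat \<rho> z"
        by (simp add: heat_add heat_diff g1t h \<theta>' that(1) real_polynomial_function.intros(3)
              real_polynomial_function_diff heat_linear_time)
      moreover have "heat ?\<psi> z \<le> g2"
      proof (rule near2[OF zr])
        show "real_polynomial_function ?\<psi>"
          by (intro real_polynomial_function.intros(3) real_polynomial_function_diff \<theta>' g1t h(1) that(1))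
        show "\<forall>\<^sub>F z' in nhds z. U2 z' - ?\<psi> z' \<le> U2 z - ?\<psi> z"
          using that(5) by eventually_elim simp
      qed
      ultimately show False using that(2) near4[OF zr] by simp
    qed
  qed
  moreover have "\<theta>' ?z0 = \<theta> ?z0" by (simp add: \<theta>'_def p_def)
  ultimately show False using \<eta>(1) unfolding m_def by simp
qed

section \<open>Sup-convolutions\<close>

definition supconv :: "real \<Rightarrow> 'b::real_inner set \<Rightarrow> ('b \<Rightarrow> real) \<Rightarrow> 'b \<Rightarrow> real" where
  "supconv N K u z = (SUP y\<in>K. u y - N * (dist z y)\<^sup>2)"

context
  fixes N :: real and K :: "'b::real_inner set" and u :: "'b \<Rightarrow> real"
  assumes K: "compact K" "K \<noteq> {}" and u: "continuous_on K u" and N: "N > 0"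
begin

lemma supconv_attained: "\<exists>y\<in>K. supconv N K u z = u y - N * (dist z y)\<^sup>2"
proof -
  have "\<exists>y\<in>K. \<forall>x\<in>K. u x - N * (dist z x)\<^sup>2 \<le> u y - N * (dist z y)\<^sup>2"
    by (intro continuous_attains_sup K continuous_intros u)
  then obtain y where y: "y \<in> K" "\<And>x. x \<in> K \<Longrightarrow> u x - N * (dist z x)\<^sup>2 \<le> u y - N * (dist z y)\<^sup>2"
    by auto
  have "supconv N K u z = u y - N * (dist z y)\<^sup>2"
    unfolding supconv_def by (rule cSup_eq_maximum) (use y in auto)
  with y(1) show ?thesis by blast
qed

lemma supconv_ge: "y \<in> K \<Longrightarrow> u y - N * (dist z y)\<^sup>2 \<le> supconv N K u z"
proof -
  assume y: "y \<in> K"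
  have "compact ((\<lambda>y. u y - N * (dist z y)\<^sup>2) ` K)"
    by (intro compact_continuous_image K continuous_intros u)
  then have "bdd_above ((\<lambda>y. u y - N * (dist z y)\<^sup>2) ` K)"
    by (intro bounded_imp_bdd_above compact_imp_bounded)
  then show ?thesis unfolding supconv_def by (rule cSUP_upper[OF y])
qed

text \<open>A maximiser for \<open>z\<close> competes at \<open>z'\<close>, and the difference of
  the two squared distances is at most \<open>dist z z'\<close> times a locally uniform bound, since
  \<open>K\<close> is bounded.\<close>

lemma continuous_supconv: "continuous_on UNIV (supconv N K u)"
proof -
  obtain R where R: "\<And>y. y \<in> K \<Longrightarrow> norm y \<le> R"
    using compact_imp_bounded[OF K(1)] by (auto simp: bounded_iff)
  have R0: "R \<ge> 0" using R K(2) norm_ge_zero order_trans by blast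
  have le: "supconv N K u z \<le> supconv N K u z' + N * (norm z + norm z' + 2 * R) * dist z z'" for z z'
  proof -
    obtain y where y: "y \<in> K" "supconv N K u z = u y - N * (dist z y)\<^sup>2"
      using supconv_attained by blast
    have "(dist z' y)\<^sup>2 - (dist z y)\<^sup>2 = (dist z' y - dist z y) * (dist z' y + dist z y)"
      by (simp add: power2_eq_square algebra_simps)
    also have "\<dots> \<le> dist z z' * (norm z + norm z' + 2 * R)"
    proof (rule mult_mono)
      show "dist z' y - dist z y \<le> dist z z'"
        using dist_triangle[of z' y z] by (simp add: dist_commute)
      show "dist z' y + dist z y \<le> norm z + norm z' + 2 * R"
        using R[OF y(1)] norm_triangle_ineq4[of z y] norm_triangle_ineq4[of z' y]
        by (simp add: dist_norm)
    qed auto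
    finally have "N * ((dist z' y)\<^sup>2 - (dist z y)\<^sup>2) \<le> N * (dist z z' * (norm z + norm z' + 2 * R))"
      using N by (intro mult_left_mono) auto
    then show ?thesis using y(2) supconv_ge[OF y(1), of z'] by (simp add: algebra_simps)
  qed
  have "(supconv N K u \<longlongrightarrow> supconv N K u z0) (at z0)" for z0
  proof -
    have "((\<lambda>z. N * (norm z + norm z0 + 2 * R) * dist z z0) \<longlongrightarrow>
        N * (norm z0 + norm z0 + 2 * R) * dist z0 z0) (at z0)"
      by (intro tendsto_intros)
    then have lim: "((\<lambda>z. N * (norm z + norm z0 + 2 * R) * dist z z0) \<longlongrightarrow> 0) (at z0)" by simp
    show ?thesis
    proof (rule Lim_transform_bound[THEN LIM_zero_cancel, OF _ lim])
      show "\<forall>\<^sub>F z in at z0. norm (supconv N K u z - supconv N K u z0)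
          \<le> norm (N * (norm z + norm z0 + 2 * R) * dist z z0)"
      proof (rule always_eventually, rule allI)
        fix z
        have "0 \<le> N * (norm z + norm z0 + 2 * R) * dist z z0" using N R0 by simp
        then show "norm (supconv N K u z - supconv N K u z0)
          \<le> norm (N * (norm z + norm z0 + 2 * R) * dist z z0)"
          using le[of z z0] le[of z0 z] by (simp add: dist_commute add.commute abs_if)
      qed
    qed
  qed
  then show ?thesis by (simp add: continuous_on_def)
qed

end

text \<open>At \<open>z0\<close> the supremum over \<open>K - G\<close> is strictly smaller than
  that over \<open>K\<close>. Both are continuous in the centre, so this persists nearby and
  excludes maximisers outside \<open>G\<close>.\<close>

lemma supconv_argmax_nearby:
  fixes K :: "'b::real_inner set"
  assumes K: "compact K" and u: "continuous_on K u" and N: "N > 0"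
    and G: "open G" "\<And>y. y \<in> K \<Longrightarrow> u y - N * (dist z0 y)\<^sup>2 = supconv N K u z0 \<Longrightarrow> y \<in> G"
  shows "\<forall>\<^sub>F z in nhds z0. \<forall>y\<in>K. u y - N * (dist z y)\<^sup>2 = supconv N K u z \<longrightarrow> y \<in> G"
proof (cases "K - G = {}")
  case True
  then show ?thesis by (intro always_eventually) auto
next
  case ne: False
  have K': "compact (K - G)" using K G(1) by (rule compact_diff)
  have u': "continuous_on (K - G) u" using u by (rule continuous_on_subset) auto
  have K_ne: "K \<noteq> {}" using ne by auto
  have lt: "supconv N (K - G) u z0 < supconv N K u z0"
  proof -
    obtain y where y: "y \<in> K - G" "supconv N (K - G) u z0 = u y - N * (dist z0 y)\<^sup>2"
      using supconv_attained[OF K' ne u' N] by blast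
    then show ?thesis using G(2)[of y] supconv_ge[OF K K_ne u N, of y z0] by fastforce
  qed
  have "((\<lambda>z. supconv N K u z - supconv N (K - G) u z) \<longlongrightarrow>
      supconv N K u z0 - supconv N (K - G) u z0) (nhds z0)"
    using continuous_supconv[OF K K_ne u N] continuous_supconv[OF K' ne u' N]
    by (intro tendsto_diff) (simp_all add: continuous_on_eq_continuous_at continuous_at tendsto_at_iff_tendsto_nhds)
  from order_tendstoD(1)[OF this, of 0] lt
  have "\<forall>\<^sub>F z in nhds z0. 0 < supconv N K u z - supconv N (K - G) u z" by simp
  then show ?thesis
  proof eventually_elim
    case (elim z)
    show ?case
    proof (intro ballI impI)
      fix y assume y: "y \<in> K" "u y - N * (dist z y)\<^sup>2 = supconv N K u z"
      show "y \<in> G"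
      proof (rule ccontr)
        assume "y \<notin> G"
        then have "u y - N * (dist z y)\<^sup>2 \<le> supconv N (K - G) u z"
          using y by (intro supconv_ge[OF K' ne u' N]) auto
        then show False using y elim by simp
      qed
    qed
  qed
qed

section \<open>Square roots of the diffusion matrix\<close>

definition reflect :: "'a::real_inner \<Rightarrow> 'a \<Rightarrow> 'a" where
  "reflect \<eta> w = w - (2 * (\<eta> \<bullet> w)) *\<^sub>R \<eta>"

text \<open>With \<open>\<eta> = 0\<close> the reflection is the identity and \<open>diff_root\<close> is the positive square root of
  \<open>\<bar>\<xi>\<bar>\<^sup>\<gamma> (I + (p - 2) \<xi> \<xi>\<^sup>T / \<bar>\<xi>\<bar>\<^sup>2)\<close>; a unit vector \<open>\<eta>\<close> composes it with the reflection at
  \<open>\<eta>\<close>, which changes the root but not the matrix.\<close>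

definition diff_root :: "real \<Rightarrow> real \<Rightarrow> 'a::real_inner \<Rightarrow> 'a \<Rightarrow> 'a \<Rightarrow> 'a" where
  "diff_root \<gamma> p \<xi> \<eta> w = norm \<xi> powr (\<gamma> / 2) *\<^sub>R
     (reflect \<eta> w + ((sqrt (p - 1) - 1) * (\<xi> \<bullet> reflect \<eta> w) / (\<xi> \<bullet> \<xi>)) *\<^sub>R \<xi>)"

definition diff_root_inv :: "real \<Rightarrow> real \<Rightarrow> 'a::real_inner \<Rightarrow> 'a \<Rightarrow> 'a \<Rightarrow> 'a" where
  "diff_root_inv \<gamma> p \<xi> \<eta> v = norm \<xi> powr (- \<gamma> / 2) *\<^sub>R
     reflect \<eta> (v + ((1 / sqrt (p - 1) - 1) * (\<xi> \<bullet> v) / (\<xi> \<bullet> \<xi>)) *\<^sub>R \<xi>)"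

lemma linear_reflect: "linear (reflect \<eta>)"
  by (rule linearI) (simp_all add: reflect_def algebra_simps inner_add_right scaleR_add_left)

lemma linear_diff_root: "linear (diff_root \<gamma> p \<xi> \<eta>)"
  by (rule linearI)
     (simp_all add: diff_root_def linear_add[OF linear_reflect] linear_scale[OF linear_reflect]
        algebra_simps inner_add_right scaleR_add_left add_divide_distrib diff_divide_distrib)

lemma linear_diff_root_inv: "linear (diff_root_inv \<gamma> p \<xi> \<eta>)"
proof -
  define s where "s = (\<lambda>v. v + ((1 / sqrt (p - 1) - 1) * (\<xi> \<bullet> v) / (\<xi> \<bullet> \<xi>)) *\<^sub>R \<xi>)"
  have s: "linear s"
    by (rule linearI)
       (simp_all add: s_def algebra_simps inner_add_right scaleR_add_left add_divide_distrib diff_divide_distrib)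
  have eq: "diff_root_inv \<gamma> p \<xi> \<eta> = (\<lambda>v. norm \<xi> powr (- \<gamma> / 2) *\<^sub>R reflect \<eta> (s v))"
    by (simp add: diff_root_inv_def s_def fun_eq_iff)
  show ?thesis
    unfolding eq
    by (rule linearI)
       (simp_all add: linear_add[OF s] linear_scale[OF s] linear_add[OF linear_reflect]
          linear_scale[OF linear_reflect] scaleR_right_distrib)
qed

lemma reflect_reflect: "\<eta> = 0 \<or> norm \<eta> = 1 \<Longrightarrow> reflect \<eta> (reflect \<eta> w) = w"
  by (auto simp: reflect_def algebra_simps inner_diff_right scaleR_left_distrib[symmetric] dot_square_norm)

lemma diff_root_inverse:
  assumes "p > 1" "\<xi> \<noteq> 0" "\<eta> = 0 \<or> norm \<eta> = 1"
  shows "diff_root \<gamma> p \<xi> \<eta> (diff_root_inv \<gamma> p \<xi> \<eta> v) = v"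
    and "diff_root_inv \<gamma> p \<xi> \<eta> (diff_root \<gamma> p \<xi> \<eta> v) = v"
proof -
  define k where "k = sqrt (p - 1)"
  have k: "k > 0" using assms(1) by (simp add: k_def)
  have k1: "1 / k * k = 1" and k2: "k * (1 / k) = 1" using k by simp_all
  have \<xi>: "\<xi> \<bullet> \<xi> \<noteq> 0" using assms(2) by simp
  have pw: "norm \<xi> powr (\<gamma> / 2) * norm \<xi> powr (- \<gamma> / 2) = 1"
    using assms(2) by (simp add: powr_add[symmetric])
  \<comment> \<open>Stretching the \<xi>-direction by \<open>a\<close> and then by \<open>b\<close>
    with a b = 1 is the identity; used with sqrt (p - 1) and its reciprocal, in either
    order.\<close>
  have stretch: "(v + ((a - 1) * (\<xi> \<bullet> v) / (\<xi> \<bullet> \<xi>)) *\<^sub>R \<xi>)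
      + ((b - 1) * (\<xi> \<bullet> (v + ((a - 1) * (\<xi> \<bullet> v) / (\<xi> \<bullet> \<xi>)) *\<^sub>R \<xi>)) / (\<xi> \<bullet> \<xi>)) *\<^sub>R \<xi> = v"
    if "a * b = 1" for a b and v :: 'a
  proof -
    have "(a - 1) * (\<xi> \<bullet> v) / (\<xi> \<bullet> \<xi>)
      + (b - 1) * (\<xi> \<bullet> (v + ((a - 1) * (\<xi> \<bullet> v) / (\<xi> \<bullet> \<xi>)) *\<^sub>R \<xi>)) / (\<xi> \<bullet> \<xi>)
      = ((a - 1) + (b - 1) * a) * (\<xi> \<bullet> v) / (\<xi> \<bullet> \<xi>)"
      using \<xi> by (simp add: inner_add_right field_simps)
    also have "(a - 1) + (b - 1) * a = 0" using that by (simp add: algebra_simps)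
    finally show ?thesis by (simp add: add.assoc scaleR_left_distrib[symmetric])
  qed
  show "diff_root \<gamma> p \<xi> \<eta> (diff_root_inv \<gamma> p \<xi> \<eta> v) = v"
  proof -
    have "diff_root \<gamma> p \<xi> \<eta> (diff_root_inv \<gamma> p \<xi> \<eta> v) = norm \<xi> powr (- \<gamma> / 2) *\<^sub>R
        diff_root \<gamma> p \<xi> \<eta> (reflect \<eta> (v + ((1 / k - 1) * (\<xi> \<bullet> v) / (\<xi> \<bullet> \<xi>)) *\<^sub>R \<xi>))"
      unfolding diff_root_inv_def linear_scale[OF linear_diff_root] k_def ..
    also have "\<dots> = (norm \<xi> powr (\<gamma> / 2) * norm \<xi> powr (- \<gamma> / 2)) *\<^sub>R v"
      unfolding diff_root_def reflect_reflect[OF assms(3)] k_def[symmetric]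
        stretch[of "1 / k" k v, OF k1] scaleR_scaleR by (simp add: mult.commute)
    finally show ?thesis using pw by simp
  qed
  show "diff_root_inv \<gamma> p \<xi> \<eta> (diff_root \<gamma> p \<xi> \<eta> v) = v"
  proof -
    have "diff_root_inv \<gamma> p \<xi> \<eta> (diff_root \<gamma> p \<xi> \<eta> v) = norm \<xi> powr (\<gamma> / 2) *\<^sub>R
        diff_root_inv \<gamma> p \<xi> \<eta> (reflect \<eta> v + ((k - 1) * (\<xi> \<bullet> reflect \<eta> v) / (\<xi> \<bullet> \<xi>)) *\<^sub>R \<xi>)"
      unfolding diff_root_def linear_scale[OF linear_diff_root_inv] k_def ..
    also have "\<dots> = (norm \<xi> powr (\<gamma> / 2) * norm \<xi> powr (- \<gamma> / 2)) *\<^sub>R reflect \<eta> (reflect \<eta> v)"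
      unfolding diff_root_inv_def k_def[symmetric]
        stretch[of k "1 / k" "reflect \<eta> v", OF k2] scaleR_scaleR by (simp add: mult.commute)
    finally show ?thesis using pw by (simp add: reflect_reflect[OF assms(3)])
  qed
qed

lemma tendsto_diff_root:
  "\<xi> \<noteq> 0 \<Longrightarrow> ((\<lambda>\<zeta>. diff_root \<gamma> p \<zeta> \<eta> w) \<longlongrightarrow> diff_root \<gamma> p \<xi> \<eta> w) (nhds \<xi>)"
  unfolding diff_root_def by (rule tendsto_intros filterlim_ident | simp)+

lemma sum_basis_bilinear:
  fixes X :: "'a::euclidean_space \<Rightarrow> 'a \<Rightarrow> real"
  assumes "bilinear X"
  shows "(\<Sum>b\<in>Basis. (v \<bullet> b) * X b w) = X v w" "(\<Sum>b\<in>Basis. (v \<bullet> b) * X w b) = X w v"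
proof -
  have l: "linear (\<lambda>x. X x w)" "linear (X w)" using assms by (auto simp: bilinear_def)
  have "X v w = X (\<Sum>b\<in>Basis. (v \<bullet> b) *\<^sub>R b) w" by (simp add: euclidean_representation)
  then show "(\<Sum>b\<in>Basis. (v \<bullet> b) * X b w) = X v w"
    using linear_sum[OF l(1), of "\<lambda>b. (v \<bullet> b) *\<^sub>R b" Basis] linear_scale[OF l(1)] by simp
  have "X w v = X w (\<Sum>b\<in>Basis. (v \<bullet> b) *\<^sub>R b)" by (simp add: euclidean_representation)
  then show "(\<Sum>b\<in>Basis. (v \<bullet> b) * X w b) = X w v"
    using linear_sum[OF l(2), of "\<lambda>b. (v \<bullet> b) *\<^sub>R b" Basis] linear_scale[OF l(2)] by simp
qed

text \<open>The square of I + c e e^T is I + (2 c + c^2 |e|^2) e e^T. A reflection at a unit vector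
  is the case c = -2, where the correction is 0; c = sqrt (p - 1) - 1 with |e| = 1 gives the factor
  p - 2.\<close>

lemma trace_rank_one_update:
  fixes X :: "'a::euclidean_space \<Rightarrow> 'a \<Rightarrow> real"
  assumes X: "bilinear X"
  shows "(\<Sum>b\<in>Basis. X (b + (c * (e \<bullet> b)) *\<^sub>R e) (b + (c * (e \<bullet> b)) *\<^sub>R e))
    = (\<Sum>b\<in>Basis. X b b) + (2 * c + c\<^sup>2 * (e \<bullet> e)) * X e e"
proof -
  have "X (b + (c * (e \<bullet> b)) *\<^sub>R e) (b + (c * (e \<bullet> b)) *\<^sub>R e)
      = X b b + (c * ((e \<bullet> b) * X b e) + c * ((e \<bullet> b) * X e b))
        + c\<^sup>2 * X e e * ((e \<bullet> b) * (e \<bullet> b))" for b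
    by (simp add: bilinear_ladd[OF X] bilinear_radd[OF X] bilinear_lmul[OF X] bilinear_rmul[OF X]
          algebra_simps power2_eq_square)
  then have "(\<Sum>b\<in>Basis. X (b + (c * (e \<bullet> b)) *\<^sub>R e) (b + (c * (e \<bullet> b)) *\<^sub>R e))
      = (\<Sum>b\<in>Basis. X b b) + (c * (\<Sum>b\<in>Basis. (e \<bullet> b) * X b e) + c * (\<Sum>b\<in>Basis. (e \<bullet> b) * X e b))
        + c\<^sup>2 * X e e * (\<Sum>b\<in>Basis. (e \<bullet> b) * (e \<bullet> b))"
    by (simp only: sum.distrib sum_distrib_left)
  also have "\<dots> = (\<Sum>b\<in>Basis. X b b) + (2 * c + c\<^sup>2 * (e \<bullet> e)) * X e e"
    unfolding sum_basis_bilinear[OF X] euclidean_inner[symmetric] by (simp add: algebra_simps)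
  finally show ?thesis .
qed

lemma trace_diff_root:
  fixes X :: "'a::euclidean_space \<Rightarrow> 'a \<Rightarrow> real"
  assumes X: "bilinear X" and p: "p > 1" and \<xi>: "\<xi> \<noteq> 0" and \<eta>: "\<eta> = 0 \<or> norm \<eta> = 1"
  shows "(\<Sum>b\<in>Basis. X (diff_root \<gamma> p \<xi> \<eta> b) (diff_root \<gamma> p \<xi> \<eta> b)) =
    norm \<xi> powr \<gamma> * ((\<Sum>b\<in>Basis. X b b) + (p - 2) * X (\<xi> /\<^sub>R norm \<xi>) (\<xi> /\<^sub>R norm \<xi>))"
proof -
  define e where "e = \<xi> /\<^sub>R norm \<xi>"
  have e: "e \<bullet> e = 1" using \<xi> by (simp add: e_def dot_square_norm power2_eq_square)
  define c where "c = sqrt (p - 1) - 1"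
  have c: "2 * c + c\<^sup>2 = p - 2"
    using p by (simp add: c_def power2_diff)
  have root: "diff_root \<gamma> p \<xi> \<eta> b = norm \<xi> powr (\<gamma> / 2) *\<^sub>R (reflect \<eta> b + (c * (e \<bullet> reflect \<eta> b)) *\<^sub>R e)" for b
    using \<xi> by (simp add: diff_root_def e_def c_def dot_square_norm power2_eq_square field_simps)
  have pw: "norm \<xi> powr (\<gamma> / 2) * norm \<xi> powr (\<gamma> / 2) = norm \<xi> powr \<gamma>"
    by (simp add: powr_add[symmetric])
  define X' where "X' = (\<lambda>v w. X (v + (c * (e \<bullet> v)) *\<^sub>R e) (w + (c * (e \<bullet> w)) *\<^sub>R e))"
  have X': "bilinear X'"
    unfolding bilinear_def X'_def
    by (intro conjI allI linearI)
       (simp_all add: bilinear_ladd[OF X] bilinear_radd[OF X] bilinear_lmul[OF X] bilinear_rmul[OF X]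
          algebra_simps inner_add_right)
  have refl: "(\<Sum>b\<in>Basis. X' (reflect \<eta> b) (reflect \<eta> b)) = (\<Sum>b\<in>Basis. X' b b)"
    using trace_rank_one_update[OF X', of "-2" \<eta>] \<eta> by (auto simp: reflect_def dot_square_norm)
  have "(\<Sum>b\<in>Basis. X (diff_root \<gamma> p \<xi> \<eta> b) (diff_root \<gamma> p \<xi> \<eta> b))
      = norm \<xi> powr \<gamma> * (\<Sum>b\<in>Basis. X' (reflect \<eta> b) (reflect \<eta> b))"
    by (simp add: root X'_def bilinear_lmul[OF X] bilinear_rmul[OF X] sum_distrib_left pw[symmetric] mult.assoc)
  also have "(\<Sum>b\<in>Basis. X' (reflect \<eta> b) (reflect \<eta> b)) = (\<Sum>b\<in>Basis. X b b) + (p - 2) * X e e"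
    unfolding refl using trace_rank_one_update[OF X, of c e] by (simp add: X'_def e c)
  finally show ?thesis unfolding e_def .
qed

text \<open>A nonnegative form is controlled by its trace, so a small change of the square root changes
  the traced form by a small multiple of the trace.\<close>

lemma psd_bound:
  fixes Y :: "'a::euclidean_space \<Rightarrow> 'a \<Rightarrow> real"
  assumes Y: "bilinear Y" and sym: "\<And>v w. Y v w = Y w v" and psd: "\<And>v. Y v v \<ge> 0"
  shows "\<bar>Y v w\<bar> \<le> (real DIM('a))\<^sup>2 * norm v * norm w * (\<Sum>b\<in>Basis. Y b b)"
proof -
  let ?t = "\<Sum>b\<in>Basis. Y b b"
  have t: "Y b b \<le> ?t" if "b \<in> Basis" for b
    using that psd by (intro member_le_sum) auto
  have entry: "\<bar>Y i j\<bar> \<le> ?t" if "i \<in> Basis" "j \<in> Basis" for i j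
  proof -
    \<comment> \<open>Nonnegativity on i + j and i - j bounds the off-diagonal entries by the
      diagonal ones.\<close>
    have "Y (i + j) (i + j) = Y i i + 2 * Y i j + Y j j" "Y (i - j) (i - j) = Y i i - 2 * Y i j + Y j j"
      by (simp_all add: bilinear_ladd[OF Y] bilinear_radd[OF Y] bilinear_lsub[OF Y] bilinear_rsub[OF Y] sym[of j i])
    with psd[of "i + j"] psd[of "i - j"] t[OF that(1)] t[OF that(2)] show ?thesis by linarith
  qed
  have "Y v w = (\<Sum>i\<in>Basis. \<Sum>j\<in>Basis. (v \<bullet> i) * ((w \<bullet> j) * Y i j))"
    by (simp add: sum_basis_bilinear[OF Y] sum_distrib_left[symmetric])
  also have "\<bar>\<dots>\<bar> \<le> (\<Sum>i\<in>(Basis::'a set). \<Sum>j\<in>(Basis::'a set). norm v * (norm w * ?t))"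
  proof (rule order_trans[OF sum_abs], rule sum_mono, rule order_trans[OF sum_abs], rule sum_mono)
    fix i j :: 'a assume ij: "i \<in> Basis" "j \<in> Basis"
    have "\<bar>v \<bullet> i\<bar> * (\<bar>w \<bullet> j\<bar> * \<bar>Y i j\<bar>) \<le> norm v * (norm w * ?t)"
      by (intro mult_mono Basis_le_norm entry ij) auto
    then show "\<bar>(v \<bullet> i) * ((w \<bullet> j) * Y i j)\<bar> \<le> norm v * (norm w * ?t)" by (simp add: abs_mult)
  qed
  also have "\<dots> = (real DIM('a))\<^sup>2 * norm v * norm w * ?t" by (simp add: power2_eq_square)
  finally show ?thesis .
qed

lemma trace_perturbation:
  fixes T :: "'c \<Rightarrow> 'a::euclidean_space \<Rightarrow> 'a"
  assumes T: "\<And>b. b \<in> Basis \<Longrightarrow> ((\<lambda>x. T x b) \<longlongrightarrow> b) F" and \<epsilon>: "\<epsilon> > 0"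
  shows "\<forall>\<^sub>F x in F. \<forall>Y :: 'a \<Rightarrow> 'a \<Rightarrow> real. bilinear Y \<longrightarrow> (\<forall>v w. Y v w = Y w v) \<longrightarrow> (\<forall>v. Y v v \<ge> 0) \<longrightarrow>
    (\<Sum>b\<in>Basis. Y (T x b) (T x b)) \<le> (1 + \<epsilon>) * (\<Sum>b\<in>Basis. Y b b)"
proof -
  define n where "n = real DIM('a)"
  have n: "n \<ge> 1" unfolding n_def using DIM_positive[where 'a='a] by linarith
  \<comment> \<open>With a = T x b - b, expanding \<open>Y (b + a) (b + a)\<close> gives an error of
    at most this sum times the trace of \<open>Y\<close>; the sum tends to 0.\<close>
  have "((\<lambda>x. \<Sum>b\<in>Basis. n\<^sup>2 * (2 * norm (T x b - b) + norm (T x b - b) * norm (T x b - b)))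
      \<longlongrightarrow> (\<Sum>b\<in>(Basis::'a set). n\<^sup>2 * (2 * norm (b - b) + norm (b - b) * norm (b - b)))) F"
    by (intro tendsto_intros T)
  then have "\<forall>\<^sub>F x in F. (\<Sum>b\<in>Basis. n\<^sup>2 * (2 * norm (T x b - b) + norm (T x b - b) * norm (T x b - b))) < \<epsilon>"
    by (rule order_tendstoD(2)) (use \<epsilon> in simp)
  then show ?thesis
  proof eventually_elim
    case (elim x)
    show ?case
    proof (intro allI impI)
      fix Y :: "'a \<Rightarrow> 'a \<Rightarrow> real"
      assume Y: "bilinear Y" and sym: "\<forall>v w. Y v w = Y w v" and psd: "\<forall>v. Y v v \<ge> 0"
      let ?t = "\<Sum>b\<in>Basis. Y b b"
      have t: "?t \<ge> 0" using psd by (intro sum_nonneg) auto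
      have bd: "Y v w \<le> n\<^sup>2 * norm v * norm w * ?t" for v w
        using psd_bound[OF Y, of v w] sym psd unfolding n_def by (auto simp: abs_le_iff)
      have "Y (T x b) (T x b) \<le> Y b b + n\<^sup>2 * (2 * norm (T x b - b) + norm (T x b - b) * norm (T x b - b)) * ?t"
        if b: "b \<in> Basis" for b
      proof -
        define a where "a = T x b - b"
        have "Y (T x b) (T x b) = Y (b + a) (b + a)" by (simp add: a_def)
        also have "\<dots> = Y b b + 2 * Y b a + Y a a"
          using sym by (simp add: bilinear_ladd[OF Y] bilinear_radd[OF Y])
        also have "\<dots> \<le> Y b b + 2 * (n\<^sup>2 * norm b * norm a * ?t) + n\<^sup>2 * norm a * norm a * ?t"
          using bd[of b a] bd[of a a] by linarith
        finally show ?thesis using b by (simp add: a_def[symmetric] algebra_simps)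
      qed
      then have "(\<Sum>b\<in>Basis. Y (T x b) (T x b)) \<le> (\<Sum>b\<in>Basis. Y b b +
          n\<^sup>2 * (2 * norm (T x b - b) + norm (T x b - b) * norm (T x b - b)) * ?t)"
        by (rule sum_mono)
      also have "\<dots> = ?t + (\<Sum>b\<in>Basis. n\<^sup>2 * (2 * norm (T x b - b) + norm (T x b - b) * norm (T x b - b))) * ?t"
        by (simp add: sum.distrib sum_distrib_right)
      also have "\<dots> \<le> ?t + \<epsilon> * ?t"
        using elim t by (intro add_left_mono mult_right_mono) auto
      finally show "(\<Sum>b\<in>Basis. Y (T x b) (T x b)) \<le> (1 + \<epsilon>) * ?t" by (simp add: algebra_simps)
    qed
  qed
qed

section \<open>Freezing the coefficients of a sup-convolution\<close>

text \<open>Common form of the inequalities for \<open>u\<close> and for \<open>- u\<close>, which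
  is why the right-hand side is a constant bound. Touching is relative to \<Omega>, hence one-sided
  in time at the top.\<close>

definition touch_subsol ::
    "real \<Rightarrow> real \<Rightarrow> real \<Rightarrow> ('a::euclidean_space \<times> real) set \<Rightarrow> ('a \<times> real \<Rightarrow> real) \<Rightarrow> bool" where
  "touch_subsol \<gamma> p F \<Omega> u \<longleftrightarrow> (\<forall>z\<in>\<Omega>. \<forall>\<phi> \<xi>. real_polynomial_function \<phi> \<longrightarrow>
     (\<forall>\<^sub>F y in at z within \<Omega>. u y - \<phi> y \<le> u z - \<phi> z) \<longrightarrow>
     (\<forall>v. dd (v, 0) \<phi> z = \<xi> \<bullet> v) \<longrightarrow> \<xi> \<noteq> 0 \<longrightarrow>
     dd (0, 1) \<phi> z - norm \<xi> powr \<gamma> * ((\<Sum>b\<in>Basis. dd (b, 0) (dd (b, 0) \<phi>) z)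
       + (p - 2) * dd (\<xi> /\<^sub>R norm \<xi>, 0) (dd (\<xi> /\<^sub>R norm \<xi>, 0) \<phi>) z) \<le> F)"

lemma bilinear_hessian:
  assumes \<psi>: "real_polynomial_function \<psi>"
  shows "bilinear (\<lambda>v w. dd (v, 0) (dd (w, 0) \<psi>) \<zeta>)"
proof -
  have add: "(v + w, 0) = (v, 0) + (w, 0 :: 'b)" and scale: "(c *\<^sub>R v, 0) = c *\<^sub>R (v, 0 :: 'b)"
    for v w :: 'a and c by simp_all
  show ?thesis
    unfolding bilinear_def
    by (intro conjI allI linearI)
       (simp_all only: add scale dd_add_dir[OF \<psi>] dd_scale_dir[OF \<psi>] dd_add_dir[OF rpf_dd[OF \<psi>]]
          dd_scale_dir[OF rpf_dd[OF \<psi>]] dd_add[OF rpf_dd[OF \<psi>] rpf_dd[OF \<psi>]] dd_cmult[OF rpf_dd[OF \<psi>]]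
          real_scaleR_def)
qed

lemma rpf_norm_sq: "real_polynomial_function (\<lambda>z::'b::euclidean_space. z \<bullet> z)"
proof -
  have "real_polynomial_function (\<lambda>z::'b. \<Sum>b\<in>Basis. (z \<bullet> b) * (z \<bullet> b))"
    by (intro real_polynomial_function_sum real_polynomial_function.intros(1,4) bounded_linear_inner_left) auto
  then show ?thesis by (subst euclidean_inner) simp
qed

lemma dd_norm_sq: "dd v (\<lambda>z::'b::euclidean_space. z \<bullet> z) = (\<lambda>z. 2 * (z \<bullet> v))"
proof (rule ext)
  fix z :: 'b
  have "((\<lambda>z. z \<bullet> z) has_derivative (\<lambda>h. z \<bullet> h + h \<bullet> z)) (at z)"
    by (auto intro!: derivative_eq_intros)
  from dd_eqI[OF this, of v] show "dd v (\<lambda>z. z \<bullet> z) z = 2 * (z \<bullet> v)"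
    by (simp add: inner_commute)
qed

lemma bounded_linear_space_time:
  fixes f :: "'a::euclidean_space \<Rightarrow> 'a"
  assumes "linear f"
  shows "bounded_linear (\<lambda>z::'a \<times> real. (f (fst z), snd z))"
  using assms unfolding linear_conv_bounded_linear
  by (intro bounded_linear_Pair bounded_linear_snd bounded_linear_compose[OF _ bounded_linear_fst])

text \<open>A test function touching the sup-convolution from above has Hessian at least \<open>-2N\<close>, and its
  gradient is determined by the maximiser. Near a point where that gradient is unique the leading
  coefficients are almost constant, and the lower Hessian bound turns the viscosity inequality into
  one with constant coefficients, i.e. the heat equation in suitable coordinates.\<close>

lemma frozen_subsolution:
  fixes u :: "'a::euclidean_space \<times> real \<Rightarrow> real"
  assumes p: "p > 1" and sub: "touch_subsol \<gamma> p F \<Omega> u"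
    and K: "compact K" "K \<noteq> {}" "K \<subseteq> \<Omega>" and u: "continuous_on K u" and N: "N > 0"
    and \<xi>1: "\<xi>1 \<noteq> 0" and \<eta>: "\<eta> = 0 \<or> norm \<eta> = 1"
    and G: "open G" "G \<inter> \<Omega> \<subseteq> K"
    and arg: "\<And>y. y \<in> K \<Longrightarrow> u y - N * (dist (xh, th) y)\<^sup>2 = supconv N K u (xh, th) \<Longrightarrow>
        y \<in> G \<and> (2 * N) *\<^sub>R (fst y - xh) = \<xi>1"
    and err: "err > 0"
  defines "S \<equiv> diff_root \<gamma> p \<xi>1 \<eta>"
  defines "U \<equiv> (\<lambda>\<zeta>. supconv N K u (xh + S (fst \<zeta>), snd \<zeta>))"
  shows "\<forall>\<^sub>F \<zeta> in nhds (0, th). \<forall>\<psi>. real_polynomial_function \<psi> \<longrightarrow>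
      (\<forall>\<^sub>F \<zeta>' in nhds \<zeta>. U \<zeta>' - \<psi> \<zeta>' \<le> U \<zeta> - \<psi> \<zeta>) \<longrightarrow> heat \<psi> \<zeta> \<le> F + err"
proof -
  define Si where "Si = diff_root_inv \<gamma> p \<xi>1 \<eta>"
  have S_Si: "S (Si v) = v" and Si_S: "Si (S v) = v" for v
    unfolding S_def Si_def using diff_root_inverse[OF p \<xi>1 \<eta>] by auto
  have lin_S: "linear S" and lin_Si: "linear Si"
    unfolding S_def Si_def by (rule linear_diff_root linear_diff_root_inv)+
  have S_tendsto: "(S \<longlongrightarrow> S x) (nhds x)" for x
    using linear_continuous_at[of S x] lin_S
    by (simp add: linear_conv_bounded_linear continuous_at tendsto_at_iff_tendsto_nhds)
  have Si_tendsto: "(Si \<longlongrightarrow> Si x) (nhds x)" for x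
    using linear_continuous_at[of Si x] lin_Si
    by (simp add: linear_conv_bounded_linear continuous_at tendsto_at_iff_tendsto_nhds)
  obtain R where R: "\<And>y. y \<in> K \<Longrightarrow> norm y \<le> R"
    using compact_imp_bounded[OF K(1)] by (auto simp: bounded_iff)
  \<comment> \<open>These prepare a bound \<open>C\<close> for the trace of the shifted Hessian
    \<open>Y\<close>: the time derivative of a touching \<psi> is at most 2 N B, and if
    \<open>heat \<psi> \<zeta>\<close> exceeds \<open>F + err\<close>, this bounds the space trace
    from above.\<close>
  define B where "B = \<bar>th\<bar> + 1 + R"
  define s0 where "s0 = (\<Sum>b\<in>Basis. (norm (S b))\<^sup>2)"
  define C where "C = 2 * N * B + \<bar>F\<bar> + 2 * N * s0 + 1"
  have s0: "s0 \<ge> 0" unfolding s0_def by (intro sum_nonneg) auto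
  have B: "B > 0"
  proof -
    have "R \<ge> 0" using R K(2) norm_ge_zero order_trans by blast
    then show ?thesis by (simp add: B_def)
  qed
  have C: "C > 0" using N B s0 by (simp add: C_def add_nonneg_pos)
  \<comment> \<open>One half of \<open>err\<close> pays for replacing the root at \<xi> by that at
    \<xi>1, the other for the change in the trace of the Hessian shift.\<close>
  define \<epsilon> where "\<epsilon> = err / (2 * C)"
  have \<epsilon>: "\<epsilon> > 0" "\<epsilon> * C = err / 2" using err C by (auto simp: \<epsilon>_def)
  have "\<forall>\<^sub>F \<xi> in nhds \<xi>1. \<forall>Y :: 'a \<Rightarrow> 'a \<Rightarrow> real. bilinear Y \<longrightarrow> (\<forall>v w. Y v w = Y w v) \<longrightarrow>
      (\<forall>v. Y v v \<ge> 0) \<longrightarrow> (\<Sum>b\<in>Basis. Y (Si (diff_root \<gamma> p \<xi> \<eta> b)) (Si (diff_root \<gamma> p \<xi> \<eta> b)))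
        \<le> (1 + \<epsilon>) * (\<Sum>b\<in>Basis. Y b b)"
  proof (rule trace_perturbation[OF _ \<epsilon>(1)])
    fix b :: 'a
    have "((\<lambda>\<xi>. Si (diff_root \<gamma> p \<xi> \<eta> b)) \<longlongrightarrow> Si (S b)) (nhds \<xi>1)"
      unfolding S_def by (rule filterlim_compose[OF Si_tendsto tendsto_diff_root[OF \<xi>1]])
    then show "((\<lambda>\<xi>. Si (diff_root \<gamma> p \<xi> \<eta> b)) \<longlongrightarrow> b) (nhds \<xi>1)" by (simp add: Si_S)
  qed
  moreover have "\<forall>\<^sub>F \<xi> in nhds \<xi>1. 2 * N * (s0 - (\<Sum>b\<in>Basis. (norm (diff_root \<gamma> p \<xi> \<eta> b))\<^sup>2)) < err / 2"
  proof (rule order_tendstoD(2))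
    show "((\<lambda>\<xi>. 2 * N * (s0 - (\<Sum>b\<in>Basis. (norm (diff_root \<gamma> p \<xi> \<eta> b))\<^sup>2))) \<longlongrightarrow>
        2 * N * (s0 - (\<Sum>b\<in>Basis. (norm (diff_root \<gamma> p \<xi>1 \<eta> b))\<^sup>2))) (nhds \<xi>1)"
      by (intro tendsto_intros tendsto_diff_root \<xi>1)
    show "2 * N * (s0 - (\<Sum>b\<in>Basis. (norm (diff_root \<gamma> p \<xi>1 \<eta> b))\<^sup>2)) < err / 2"
      using err by (simp add: s0_def S_def)
  qed
  moreover have "\<forall>\<^sub>F \<xi> in nhds \<xi>1. \<xi> \<noteq> 0"
    using \<xi>1 by (rule tendsto_imp_eventually_ne[OF filterlim_ident])
  ultimately have "\<forall>\<^sub>F \<xi> in nhds \<xi>1. \<xi> \<noteq> 0 \<and>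
      2 * N * (s0 - (\<Sum>b\<in>Basis. (norm (diff_root \<gamma> p \<xi> \<eta> b))\<^sup>2)) < err / 2 \<and>
      (\<forall>Y :: 'a \<Rightarrow> 'a \<Rightarrow> real. bilinear Y \<longrightarrow> (\<forall>v w. Y v w = Y w v) \<longrightarrow>
      (\<forall>v. Y v v \<ge> 0) \<longrightarrow> (\<Sum>b\<in>Basis. Y (Si (diff_root \<gamma> p \<xi> \<eta> b)) (Si (diff_root \<gamma> p \<xi> \<eta> b)))
        \<le> (1 + \<epsilon>) * (\<Sum>b\<in>Basis. Y b b))"
    by eventually_elim blast
  then obtain \<delta> where \<delta>: "\<delta> > 0" and near: "\<And>\<xi>. dist \<xi> \<xi>1 < \<delta> \<Longrightarrow> \<xi> \<noteq> 0 \<and>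
      2 * N * (s0 - (\<Sum>b\<in>Basis. (norm (diff_root \<gamma> p \<xi> \<eta> b))\<^sup>2)) < err / 2 \<and>
      (\<forall>Y :: 'a \<Rightarrow> 'a \<Rightarrow> real. bilinear Y \<longrightarrow> (\<forall>v w. Y v w = Y w v) \<longrightarrow>
      (\<forall>v. Y v v \<ge> 0) \<longrightarrow> (\<Sum>b\<in>Basis. Y (Si (diff_root \<gamma> p \<xi> \<eta> b)) (Si (diff_root \<gamma> p \<xi> \<eta> b)))
        \<le> (1 + \<epsilon>) * (\<Sum>b\<in>Basis. Y b b))"
    unfolding eventually_nhds_metric by blast
  \<comment> \<open>The gradient at a touching point is 2 N (y - Z). Half of \<delta> is for the
    distance of 2 N (y - xh) from \<xi>1, the other half for the displacement of Z from xh.\<close>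
  define G' where "G' = G \<inter> {y. dist ((2 * N) *\<^sub>R (fst y - xh)) \<xi>1 < \<delta> / 2}"
  have "open G'"
    unfolding G'_def by (intro open_Int G open_Collect_less continuous_intros)
  then have "\<forall>\<^sub>F z in nhds (xh, th). \<forall>y\<in>K. u y - N * (dist z y)\<^sup>2 = supconv N K u z \<longrightarrow> y \<in> G'"
    by (rule supconv_argmax_nearby[OF K(1) u N]) (use arg \<delta> in \<open>auto simp: G'_def\<close>)
  moreover have lim: "filterlim (\<lambda>\<zeta>. (xh + S (fst \<zeta>), snd \<zeta>)) (nhds (xh, th)) (nhds (0, th))"
  proof -
    have "((\<lambda>\<zeta>. S (fst \<zeta>)) \<longlongrightarrow> S (fst (0::'a, th))) (nhds (0, th))"
      by (rule filterlim_compose[OF S_tendsto]) (intro tendsto_intros filterlim_ident)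
    then have "((\<lambda>\<zeta>. (xh + S (fst \<zeta>), snd \<zeta>)) \<longlongrightarrow> (xh + S (fst (0::'a, th)), snd (0::'a, th))) (nhds (0, th))"
      by (intro tendsto_intros filterlim_ident)
    then show ?thesis by (simp add: linear_0[OF lin_S])
  qed
  ultimately have "\<forall>\<^sub>F \<zeta> in nhds (0, th). \<forall>y\<in>K. u y - N * (dist (xh + S (fst \<zeta>), snd \<zeta>) y)\<^sup>2 = U \<zeta> \<longrightarrow> y \<in> G'"
    unfolding U_def by (rule eventually_compose_filterlim)
  moreover have "\<forall>\<^sub>F \<zeta> in nhds (0, th). norm ((2 * N) *\<^sub>R S (fst \<zeta>)) < \<delta> / 2"
  proof (rule order_tendstoD(2))
    have "((\<lambda>\<zeta>. S (fst \<zeta>)) \<longlongrightarrow> S (fst (0::'a, th))) (nhds (0, th))"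
      by (rule filterlim_compose[OF S_tendsto]) (intro tendsto_intros filterlim_ident)
    then show "((\<lambda>\<zeta>. norm ((2 * N) *\<^sub>R S (fst \<zeta>))) \<longlongrightarrow> norm ((2 * N) *\<^sub>R S (fst (0::'a, th)))) (nhds (0, th))"
      by (intro tendsto_intros)
    show "norm ((2 * N) *\<^sub>R S (fst (0::'a, th))) < \<delta> / 2" using \<delta> by (simp add: linear_0[OF lin_S])
  qed
  moreover have "\<forall>\<^sub>F \<zeta> in nhds (0::'a, th). \<bar>snd \<zeta>\<bar> < \<bar>th\<bar> + 1"
  proof (rule order_tendstoD(2))
    show "((\<lambda>\<zeta>. \<bar>snd \<zeta>\<bar>) \<longlongrightarrow> \<bar>snd (0::'a, th)\<bar>) (nhds (0::'a, th))"
      by (intro tendsto_rabs tendsto_snd[OF filterlim_ident])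
  qed simp
  ultimately show ?thesis
  proof eventually_elim
    case (elim \<zeta>)
    show ?case
    proof (intro allI impI, rule ccontr)
      fix \<psi>
      assume \<psi>: "real_polynomial_function \<psi>"
        and max: "\<forall>\<^sub>F \<zeta>' in nhds \<zeta>. U \<zeta>' - \<psi> \<zeta>' \<le> U \<zeta> - \<psi> \<zeta>"
        and contra: "\<not> heat \<psi> \<zeta> \<le> F + err"
      define Z where "Z = (xh + S (fst \<zeta>), snd \<zeta>)"
      obtain y where y: "y \<in> K" "U \<zeta> = u y - N * (dist Z y)\<^sup>2"
        using supconv_attained[OF K(1,2) u N, of Z] unfolding U_def Z_def by auto
      have yG: "y \<in> G" "dist ((2 * N) *\<^sub>R (fst y - xh)) \<xi>1 < \<delta> / 2"
        using elim(1) y unfolding Z_def G'_def by auto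
      define \<xi> where "\<xi> = (2 * N) *\<^sub>R (fst y - fst Z)"
      have "\<xi> - \<xi>1 = ((2 * N) *\<^sub>R (fst y - xh) - \<xi>1) - (2 * N) *\<^sub>R S (fst \<zeta>)"
        by (simp add: \<xi>_def Z_def algebra_simps)
      then have "dist \<xi> \<xi>1 \<le> norm ((2 * N) *\<^sub>R (fst y - xh) - \<xi>1) + norm ((2 * N) *\<^sub>R S (fst \<zeta>))"
        unfolding dist_norm by (metis norm_triangle_ineq4)
      then have "dist \<xi> \<xi>1 < \<delta>" using yG(2) elim(2) unfolding dist_norm by linarith
      note \<xi>_near = near[OF this]

      define A where "A = (\<lambda>z::'a \<times> real. (Si (fst z), snd z))"
      have A: "bounded_linear A" unfolding A_def by (rule bounded_linear_space_time[OF lin_Si])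
      define A' where "A' = (\<lambda>z::'a \<times> real. (S (fst z), snd z))"
      have A': "bounded_linear A'" unfolding A'_def by (rule bounded_linear_space_time[OF lin_S])
      \<comment> \<open>\<psi> transplanted to \<open>y\<close>: when the centre of the
        sup-convolution moves along with the point of \<open>K\<close>, the penalty stays constant,
        so \<phi> touches \<open>u\<close> at \<open>y\<close>.\<close>
      define \<phi> where "\<phi> = (\<lambda>z. \<psi> ((\<zeta> - A y) + A z))"
      have \<phi>: "real_polynomial_function \<phi>" unfolding \<phi>_def by (rule rpf_affine[OF \<psi> A])
      have dd_\<phi>: "dd v \<phi> = (\<lambda>z. dd (A v) \<psi> ((\<zeta> - A y) + A z))" for v
        unfolding \<phi>_def by (rule dd_affine[OF \<psi> A])
      have dd2_\<phi>: "dd w (dd v \<phi>) y = dd (A w) (dd (A v) \<psi>) \<zeta>" for v w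
        unfolding dd_\<phi> by (simp add: dd_affine[OF rpf_dd[OF \<psi>] A])

      have "\<forall>\<^sub>F z in nhds y. U ((\<zeta> - A y) + A z) - \<psi> ((\<zeta> - A y) + A z) \<le> U \<zeta> - \<psi> \<zeta>"
      proof (rule eventually_compose_filterlim[OF max])
        have "(A \<longlongrightarrow> A y) (nhds y)"
          using linear_continuous_at[OF A, of y] by (simp add: continuous_at tendsto_at_iff_tendsto_nhds)
        then have "((\<lambda>z. (\<zeta> - A y) + A z) \<longlongrightarrow> (\<zeta> - A y) + A y) (nhds y)" by (intro tendsto_intros)
        then show "filterlim (\<lambda>z. (\<zeta> - A y) + A z) (nhds \<zeta>) (nhds y)" by simp
      qed
      moreover have "\<forall>\<^sub>F z in nhds y. z \<in> G" using G(1) yG(1) by (rule eventually_nhds_in_open)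
      ultimately have touch: "\<forall>\<^sub>F z in at y within \<Omega>. u z - \<phi> z \<le> u y - \<phi> y"
        unfolding eventually_at_filter
      proof eventually_elim
        case (elim z)
        show ?case
        proof (intro impI)
          assume "z \<in> \<Omega>"
          then have zK: "z \<in> K" using elim G(2) by auto
          have "U ((\<zeta> - A y) + A z) = supconv N K u (Z + z - y)"
            unfolding U_def Z_def A_def
            by (cases y, cases z) (simp add: linear_add[OF lin_S] linear_diff[OF lin_S] S_Si algebra_simps)
          moreover have "u z - N * (dist (Z + z - y) z)\<^sup>2 \<le> supconv N K u (Z + z - y)"
            by (rule supconv_ge[OF K(1,2) u N zK])
          moreover have "dist (Z + z - y) z = dist Z y" by (simp add: dist_norm algebra_simps)
          moreover have "\<phi> y = \<psi> \<zeta>" by (simp add: \<phi>_def)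
          ultimately show "u z - \<phi> z \<le> u y - \<phi> y"
            using elim(1) y(2) unfolding \<phi>_def by simp
        qed
      qed

      let ?c = "(xh, 0) - y"
      \<comment> \<open>Here \<open>y\<close> stays fixed and the centre moves, so \<psi> plus the
        penalty has a local minimum at \<zeta>. The first-order condition yields the gradient \<xi>,
        the second-order one the lower bound of the Hessian.\<close>
      define M where "M = (\<lambda>\<zeta>'. \<psi> \<zeta>' + N * ((?c + A' \<zeta>') \<bullet> (?c + A' \<zeta>')))"
      have qA': "real_polynomial_function (\<lambda>\<zeta>'. (?c + A' \<zeta>') \<bullet> (?c + A' \<zeta>'))"
        by (rule rpf_affine[OF rpf_norm_sq A'])
      have M: "real_polynomial_function M"
        unfolding M_def by (intro real_polynomial_function.intros(3) \<psi> rpf_cmult qA')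
      have cA': "?c + A' \<zeta>' = (xh + S (fst \<zeta>'), snd \<zeta>') - y" for \<zeta>'
        by (simp add: A'_def prod_eq_iff)
      have "\<forall>\<^sub>F \<zeta>' in nhds \<zeta>. M \<zeta> \<le> M \<zeta>'"
        using max
      proof eventually_elim
        case (elim \<zeta>')
        have "u y - N * (dist (xh + S (fst \<zeta>'), snd \<zeta>') y)\<^sup>2 \<le> U \<zeta>'"
          unfolding U_def by (rule supconv_ge[OF K(1,2) u N y(1)])
        then show ?case
          using elim y(2) unfolding M_def cA' Z_def by (simp add: dist_norm power2_norm_eq_inner)
      qed
      note min = rpf_local_min[OF M this]
      have lin_q: "real_polynomial_function (\<lambda>z. 2 * (z \<bullet> w))" for w :: "'a \<times> real"
        by (intro rpf_cmult real_polynomial_function.intros(1) bounded_linear_inner_left)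
      have dd_q: "dd v (\<lambda>z. 2 * (z \<bullet> w)) = (\<lambda>z. 2 * (v \<bullet> w))" for v w :: "'a \<times> real"
        by (subst dd_cmult)
           (auto intro!: real_polynomial_function.intros(1) bounded_linear_inner_left
              simp: dd_linear[OF bounded_linear_inner_left])
      have dd_M: "dd v M = (\<lambda>\<zeta>'. dd v \<psi> \<zeta>' + N * (2 * ((?c + A' \<zeta>') \<bullet> A' v)))" for v
        unfolding M_def
        by (simp only: dd_add[OF \<psi> rpf_cmult[OF qA']] dd_cmult[OF qA'] dd_affine[OF rpf_norm_sq A'] dd_norm_sq)
      have dd2_M: "dd v (dd v M) \<zeta> = dd v (dd v \<psi>) \<zeta> + N * (2 * (A' v \<bullet> A' v))" for v
        unfolding dd_M
        by (simp only: dd_add[OF rpf_dd[OF \<psi>] rpf_cmult[OF rpf_affine[OF lin_q A']]]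
             dd_cmult[OF rpf_affine[OF lin_q A']] dd_affine[OF lin_q A'] dd_q)
      have first: "dd v \<psi> \<zeta> = - (2 * N * ((Z - y) \<bullet> A' v))" for v
        using min(1)[of v] unfolding dd_M cA' Z_def by (simp add: algebra_simps)
      have second: "dd v (dd v \<psi>) \<zeta> + 2 * N * (A' v \<bullet> A' v) \<ge> 0" for v
        using min(2)[of v] unfolding dd2_M by (simp add: algebra_simps)

      define H where "H = (\<lambda>v w. dd (v, 0) (dd (w, 0) \<psi>) \<zeta>)"
      have H: "bilinear H" unfolding H_def by (rule bilinear_hessian[OF \<psi>])
      \<comment> \<open>Shifting the Hessian by its lower bound gives a nonnegative form, to which
        the perturbation estimate for traces applies.\<close>
      define Y where "Y = (\<lambda>v w. H v w + 2 * N * (S v \<bullet> S w))"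
      have Y: "bilinear Y"
        unfolding bilinear_def Y_def
        by (intro conjI allI linearI)
           (simp_all add: bilinear_ladd[OF H] bilinear_radd[OF H] bilinear_lmul[OF H] bilinear_rmul[OF H]
              linear_add[OF lin_S] linear_scale[OF lin_S] algebra_simps inner_add_right inner_add_left)
      have Y_sym: "\<forall>v w. Y v w = Y w v"
        unfolding Y_def H_def using dd_commute[OF \<psi>] by (auto simp: inner_commute)
      have Y_psd: "\<forall>v. Y v v \<ge> 0"
        unfolding Y_def H_def using second[of "(v, 0)" for v] by (simp add: A'_def)
      define X where "X = (\<lambda>v w. dd (v, 0) (dd (w, 0) \<phi>) y)"
      have X_H: "X v w = H (Si v) (Si w)" for v w
        unfolding X_def H_def dd2_\<phi> by (simp add: A_def)
      have X: "bilinear X" unfolding X_def by (rule bilinear_hessian[OF \<phi>])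
      have grad: "\<forall>v. dd (v, 0) \<phi> y = \<xi> \<bullet> v"
        unfolding dd_\<phi> by (simp add: first A_def A'_def S_Si \<xi>_def inner_prod_def algebra_simps)
      have time: "dd (0, 1) \<phi> y = dd (0, 1) \<psi> \<zeta>"
        unfolding dd_\<phi> by (simp add: A_def linear_0[OF lin_Si])
      have visc: "dd (0, 1) \<psi> \<zeta> - (\<Sum>b\<in>Basis. X (diff_root \<gamma> p \<xi> \<eta> b) (diff_root \<gamma> p \<xi> \<eta> b)) \<le> F"
      proof -
        have "y \<in> \<Omega>" using y(1) K(3) by auto
        with sub \<phi> touch grad \<xi>_near
        have "dd (0, 1) \<phi> y - norm \<xi> powr \<gamma> * ((\<Sum>b\<in>Basis. dd (b, 0) (dd (b, 0) \<phi>) y)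
           + (p - 2) * dd (\<xi> /\<^sub>R norm \<xi>, 0) (dd (\<xi> /\<^sub>R norm \<xi>, 0) \<phi>) y) \<le> F"
          unfolding touch_subsol_def by blast
        then show ?thesis
          using trace_diff_root[OF X p _ \<eta>, of \<xi> \<gamma>] \<xi>_near unfolding time X_def by simp
      qed
      let ?t = "\<Sum>b\<in>Basis. Y b b"
      have t: "?t = (\<Sum>b\<in>Basis. H b b) + 2 * N * s0"
        unfolding Y_def s0_def by (simp add: sum.distrib sum_distrib_left power2_norm_eq_inner)
      have "(\<Sum>b\<in>Basis. X (diff_root \<gamma> p \<xi> \<eta> b) (diff_root \<gamma> p \<xi> \<eta> b))
          = (\<Sum>b\<in>Basis. Y (Si (diff_root \<gamma> p \<xi> \<eta> b)) (Si (diff_root \<gamma> p \<xi> \<eta> b)))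
            - 2 * N * (\<Sum>b\<in>Basis. (norm (diff_root \<gamma> p \<xi> \<eta> b))\<^sup>2)"
        unfolding Y_def X_H S_Si by (simp add: sum.distrib sum_distrib_left power2_norm_eq_inner)
      also have "\<dots> \<le> (1 + \<epsilon>) * ?t - 2 * N * (\<Sum>b\<in>Basis. (norm (diff_root \<gamma> p \<xi> \<eta> b))\<^sup>2)"
        using \<xi>_near Y Y_sym Y_psd by auto
      also have "\<dots> = (\<Sum>b\<in>Basis. H b b) + \<epsilon> * ?t
          + 2 * N * (s0 - (\<Sum>b\<in>Basis. (norm (diff_root \<gamma> p \<xi> \<eta> b))\<^sup>2))"
        unfolding t by (simp add: algebra_simps)
      also have "\<dots> < (\<Sum>b\<in>Basis. H b b) + \<epsilon> * ?t + err / 2"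
        using \<xi>_near by simp
      finally have upper: "dd (0, 1) \<psi> \<zeta> < F + (\<Sum>b\<in>Basis. H b b) + \<epsilon> * ?t + err / 2"
        using visc by linarith
      have heat: "heat \<psi> \<zeta> = dd (0, 1) \<psi> \<zeta> - (\<Sum>b\<in>Basis. H b b)"
        by (simp add: heat_def H_def)
      have "dd (0, 1) \<psi> \<zeta> = 2 * N * (snd y - snd \<zeta>)"
        unfolding first by (simp add: A'_def Z_def linear_0[OF lin_S] inner_prod_def algebra_simps)
      also have "\<dots> \<le> 2 * N * B"
      proof (rule mult_left_mono)
        have "\<bar>snd y\<bar> \<le> norm y" using norm_snd_le[of "snd y" "fst y"] by simp
        then show "snd y - snd \<zeta> \<le> B" using R[OF y(1)] elim(3) by (simp add: B_def)
      qed (use N in simp)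
      finally have "?t \<le> C"
        using contra err unfolding heat t C_def by linarith
      then have "\<epsilon> * ?t \<le> err / 2"
        using mult_left_mono[of ?t C \<epsilon>] \<epsilon> by simp
      with upper contra show False unfolding heat by linarith
    qed
  qed
qed

section \<open>Polynomial test functions\<close>

lemma sum_Basis_cart:
  "(\<Sum>b\<in>Basis. h (b :: real^'n)) = (\<Sum>i\<in>UNIV. h (axis i 1))"
proof -
  have "(Basis :: (real^'n) set) = (\<lambda>i. axis i 1) ` UNIV" by (auto simp: Basis_vec_def)
  moreover have "inj (\<lambda>i. axis i (1::real) :: real^'n)" by (auto simp: inj_def axis_eq_axis)
  ultimately show ?thesis by (metis (no_types, lifting) sum.reindex_cong)
qed

lemma C2_on_rpf:
  fixes \<phi> :: "'a::euclidean_space \<Rightarrow> real"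
  assumes \<phi>: "real_polynomial_function \<phi>"
  shows "C2_on S \<phi>"
proof -
  have expand: "dd v f z = (\<Sum>b\<in>Basis. dd b f z * (v \<bullet> b))"
    if "real_polynomial_function f" for f :: "'a \<Rightarrow> real" and v z
  proof -
    have "dd v f z = dd (\<Sum>b\<in>Basis. (v \<bullet> b) *\<^sub>R b) f z" by (simp only: euclidean_representation)
    also have "\<dots> = (\<Sum>b\<in>Basis. dd b f z * (v \<bullet> b))"
      by (simp only: dd_sum_dir[OF that] dd_scale_dir[OF that] mult.commute)
    finally show ?thesis .
  qed
  define l where "l = (\<lambda>b::'a. blinfun_inner_left b)"
  define \<phi>' where "\<phi>' = (\<lambda>z. \<Sum>b\<in>Basis. dd b \<phi> z *\<^sub>R l b)"
  define \<phi>'' where "\<phi>'' = (\<lambda>z. \<Sum>b\<in>Basis. \<Sum>c\<in>Basis. dd c (dd b \<phi>) z *\<^sub>R (blinfun_scaleR_left (l b) o\<^sub>L l c))"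
  have apply1: "blinfun_apply (\<phi>' z) v = dd v \<phi> z" for z v
    unfolding expand[OF \<phi>, of v] \<phi>'_def
    by (simp add: blinfun.sum_left blinfun.scaleR_left l_def)
  have apply2: "blinfun_apply (\<phi>'' z) v = (\<Sum>b\<in>Basis. dd v (dd b \<phi>) z *\<^sub>R l b)" for z v
  proof -
    have "blinfun_apply (\<phi>'' z) v = (\<Sum>b\<in>Basis. \<Sum>c\<in>Basis. (dd c (dd b \<phi>) z * (v \<bullet> c)) *\<^sub>R l b)"
      unfolding \<phi>''_def l_def by (simp add: blinfun.sum_left blinfun.scaleR_left)
    also have "\<dots> = (\<Sum>b\<in>Basis. (\<Sum>c\<in>Basis. dd c (dd b \<phi>) z * (v \<bullet> c)) *\<^sub>R l b)"
      by (simp only: scaleR_sum_left)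
    also have "\<dots> = (\<Sum>b\<in>Basis. dd v (dd b \<phi>) z *\<^sub>R l b)"
      by (simp only: expand[OF rpf_dd[OF \<phi>], of v, symmetric])
    finally show ?thesis .
  qed
  have apply1': "blinfun_apply (\<phi>' z) = (\<lambda>v. dd v \<phi> z)"
    and apply2': "blinfun_apply (\<phi>'' z) = (\<lambda>v. \<Sum>b\<in>Basis. dd v (dd b \<phi>) z *\<^sub>R l b)" for z
    by (rule ext, rule apply1 apply2)+
  have "(\<phi> has_derivative blinfun_apply (\<phi>' z)) (at z within S)" for z
    unfolding apply1' by (rule has_derivative_at_withinI[OF rpf_has_derivative[OF \<phi>]])
  moreover have "(\<phi>' has_derivative blinfun_apply (\<phi>'' z)) (at z within S)" for z
    unfolding apply2' \<phi>'_def
    by (intro has_derivative_sum has_derivative_scaleR_left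
        has_derivative_at_withinI[OF rpf_has_derivative[OF rpf_dd[OF \<phi>]]])
  moreover have "continuous_on S \<phi>''"
    unfolding \<phi>''_def by (intro continuous_intros rpf_continuous_on rpf_dd \<phi>)
  ultimately show ?thesis unfolding C2_on_def by blast
qed

lemma partial_x_rpf:
  assumes \<phi>: "real_polynomial_function (\<phi> :: (real^'n) \<times> real \<Rightarrow> real)"
  shows "partial_x i \<phi> = dd (axis i 1, 0) \<phi>"
proof (rule ext)
  fix z
  have "(\<lambda>s. \<phi> (fst z + s *\<^sub>R axis i 1, snd z)) = (\<lambda>s. \<phi> (z + s *\<^sub>R (axis i 1, 0)))"
    by (cases z) simp
  then show "partial_x i \<phi> z = dd (axis i 1, 0) \<phi> z"
    unfolding partial_x_def
    using DERIV_imp_deriv[OF rpf_line_deriv[OF \<phi>, where z=z and v="(axis i 1, 0)" and s=0]]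
    by (simp add: zero_prod_def[symmetric])
qed

lemma grad_x_rpf:
  assumes \<phi>: "real_polynomial_function (\<phi> :: (real^'n) \<times> real \<Rightarrow> real)"
    and \<xi>: "\<And>v. dd (v, 0) \<phi> z = \<xi> \<bullet> v"
  shows "grad_x \<phi> z = \<xi>"
  by (simp add: vec_eq_iff grad_x_def partial_x_rpf[OF \<phi>] \<xi> inner_axis)

lemma normalized_p_laplacian_rpf:
  assumes \<phi>: "real_polynomial_function (\<phi> :: (real^'n) \<times> real \<Rightarrow> real)"
    and \<xi>: "\<And>v. dd (v, 0) \<phi> z = \<xi> \<bullet> v"
  shows "normalized_p_laplacian p \<phi> z = (\<Sum>b\<in>Basis. dd (b, 0) (dd (b, 0) \<phi>) z)
       + (p - 2) * dd (\<xi> /\<^sub>R norm \<xi>, 0) (dd (\<xi> /\<^sub>R norm \<xi>, 0) \<phi>) z"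
proof -
  define e where "e = \<xi> /\<^sub>R norm \<xi>"
  define H where "H = (\<lambda>v w. dd (v, 0) (dd (w, 0) \<phi>) z)"
  have H: "bilinear H" unfolding H_def by (rule bilinear_hessian[OF \<phi>])
  have part: "partial_x i (partial_x j \<phi>) z = H (axis i 1) (axis j 1)" for i j
    by (simp add: H_def partial_x_rpf[OF \<phi>] partial_x_rpf[OF rpf_dd[OF \<phi>]])
  have "(hess_x \<phi> z *v e) \<bullet> e = (\<Sum>i\<in>UNIV. (\<Sum>j\<in>UNIV. H (axis i 1) (axis j 1) * (e $ j)) * (e $ i))"
    by (simp add: inner_vec_def matrix_vector_mult_def hess_x_def part)
  also have "\<dots> = (\<Sum>i\<in>UNIV. (e \<bullet> axis i 1) * (\<Sum>j\<in>UNIV. (e \<bullet> axis j 1) * H (axis i 1) (axis j 1)))"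
    by (simp add: inner_axis mult.commute)
  also have "\<dots> = (\<Sum>b\<in>Basis. (e \<bullet> b) * (\<Sum>c\<in>Basis. (e \<bullet> c) * H b c))"
    by (simp add: sum_Basis_cart)
  also have "\<dots> = H e e"
    by (simp add: sum_basis_bilinear[OF H])
  finally have "(hess_x \<phi> z *v e) \<bullet> e = H e e" .
  then show ?thesis
    unfolding normalized_p_laplacian_def laplacian_x_def grad_x_rpf[OF \<phi> \<xi>] e_def[symmetric] part
    by (simp add: Let_def H_def sum_Basis_cart)
qed

text \<open>At the top the time derivative is one-sided. It agrees with the two-sided derivative of
  the polynomial because \<open>snd z\<close> is a limit point of the time interval.\<close>

lemma dt_rpf:
  assumes \<phi>: "real_polynomial_function (\<phi> :: (real^'n) \<times> real \<Rightarrow> real)" and z: "z \<in> Q 1"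
  shows "dt \<phi> z = dd (0, 1) \<phi> z"
proof -
  have t: "-1 < snd z" "snd z \<le> 0" using z by (auto simp: Q_def)
  have "((\<lambda>s. \<phi> ((fst z, 0) + s *\<^sub>R (0, 1))) has_real_derivative dd (0, 1) \<phi> ((fst z, 0) + snd z *\<^sub>R (0, 1)))
      (at (snd z) within {-1<..0})"
    using rpf_line_deriv[OF \<phi>] by (rule has_field_derivative_at_within)
  then have "((\<lambda>s. \<phi> (fst z, s)) has_vector_derivative dd (0, 1) \<phi> z) (at (snd z) within {-1<..0})"
    by (simp add: has_real_derivative_iff_has_vector_derivative)
  moreover have "at (snd z) within {-1<..0} \<noteq> bot"
    using t by (simp add: trivial_limit_within)
  ultimately show ?thesis unfolding dt_def by (intro vector_derivative_within) auto
qed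

lemma subsolution_imp_touch_subsol:
  assumes "viscosity_subsolution \<gamma> p f u" and f: "\<And>z. z \<in> Q 1 \<Longrightarrow> f z \<le> F"
  shows "touch_subsol \<gamma> p F (Q 1) u"
  unfolding touch_subsol_def
proof (intro ballI allI impI)
  fix z \<phi> \<xi>
  assume z: "z \<in> Q 1" and \<phi>: "real_polynomial_function \<phi>"
    and max: "\<forall>\<^sub>F y in at z within Q 1. u y - \<phi> y \<le> u z - \<phi> z"
    and \<xi>: "\<forall>v. dd (v, 0) \<phi> z = \<xi> \<bullet> v" "\<xi> \<noteq> 0"
  have "dt \<phi> z - norm (grad_x \<phi> z) powr \<gamma> * normalized_p_laplacian p \<phi> z \<le> f z"
  proof -
    obtain x0 t0 where xt: "z = (x0, t0)" by (cases z)
    have "grad_x \<phi> (x0, t0) \<noteq> 0" using grad_x_rpf[OF \<phi>, of z \<xi>] \<xi> by (simp add: xt)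
    with assms(1) z max C2_on_rpf[OF \<phi>, of "Q 1"] show ?thesis
      unfolding viscosity_subsolution_def xt by blast
  qed
  with f[OF z] show "dd (0, 1) \<phi> z - norm \<xi> powr \<gamma> * ((\<Sum>b\<in>Basis. dd (b, 0) (dd (b, 0) \<phi>) z)
       + (p - 2) * dd (\<xi> /\<^sub>R norm \<xi>, 0) (dd (\<xi> /\<^sub>R norm \<xi>, 0) \<phi>) z) \<le> F"
    by (simp add: dt_rpf[OF \<phi> z] grad_x_rpf[OF \<phi>] normalized_p_laplacian_rpf[OF \<phi>] \<xi>)
qed

text \<open>The operator is odd: replacing \<phi> by -\<phi> reverses the Hessian and the gradient,
  and the direction of the gradient enters quadratically.\<close>

lemma supersolution_imp_touch_subsol:
  assumes "viscosity_supersolution \<gamma> p f u" and f: "\<And>z. z \<in> Q 1 \<Longrightarrow> - f z \<le> F"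
  shows "touch_subsol \<gamma> p F (Q 1) (\<lambda>z. - u z)"
  unfolding touch_subsol_def
proof (intro ballI allI impI)
  fix z \<phi> \<xi>
  assume z: "z \<in> Q 1" and \<phi>: "real_polynomial_function \<phi>"
    and max: "\<forall>\<^sub>F y in at z within Q 1. - u y - \<phi> y \<le> - u z - \<phi> z"
    and \<xi>: "\<forall>v. dd (v, 0) \<phi> z = \<xi> \<bullet> v" "\<xi> \<noteq> 0"
  note m\<phi> = real_polynomial_function_minus[OF \<phi>]
  have m\<xi>: "dd (v, 0) (\<lambda>z. - \<phi> z) z = (- \<xi>) \<bullet> v" for v
    using \<xi>(1) by (simp add: dd_minus[OF \<phi>])
  have "\<forall>\<^sub>F y in at z within Q 1. u y - - \<phi> y \<ge> u z - - \<phi> z"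
    using max by eventually_elim simp
  then have "dt (\<lambda>z. - \<phi> z) z - norm (grad_x (\<lambda>z. - \<phi> z) z) powr \<gamma> * normalized_p_laplacian p (\<lambda>z. - \<phi> z) z \<ge> f z"
  proof -
    obtain x0 t0 where xt: "z = (x0, t0)" by (cases z)
    assume min: "\<forall>\<^sub>F y in at z within Q 1. u y - - \<phi> y \<ge> u z - - \<phi> z"
    have "grad_x (\<lambda>z. - \<phi> z) (x0, t0) \<noteq> 0" using grad_x_rpf[OF m\<phi> m\<xi>] \<xi>(2) by (simp add: xt)
    with assms(1) z min C2_on_rpf[OF m\<phi>, of "Q 1"] show ?thesis
      unfolding viscosity_supersolution_def xt by blast
  qed
  moreover have neg: "dd (- e, 0) (dd (- e, 0) (\<lambda>z. - \<phi> z)) z = - dd (e, 0) (dd (e, 0) \<phi>) z" for e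
  proof -
    have "(- e, 0) = (- 1) *\<^sub>R (e, 0 :: real)" by simp
    then show ?thesis
      by (simp only: dd_minus[OF \<phi>] dd_minus[OF rpf_dd[OF \<phi>]] dd_scale_dir[OF \<phi>]
          dd_scale_dir[OF rpf_dd[OF \<phi>]] dd_cmult[OF rpf_dd[OF \<phi>]] dd_minus[OF rpf_cmult[OF rpf_dd[OF \<phi>]]])
  qed
  ultimately have "- dd (0, 1) \<phi> z + norm \<xi> powr \<gamma> * ((\<Sum>b\<in>Basis. dd (b, 0) (dd (b, 0) \<phi>) z)
       + (p - 2) * dd (\<xi> /\<^sub>R norm \<xi>, 0) (dd (\<xi> /\<^sub>R norm \<xi>, 0) \<phi>) z) \<ge> f z"
    using neg[of "\<xi> /\<^sub>R norm \<xi>"]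
    by (simp add: dt_rpf[OF m\<phi> z] grad_x_rpf[OF m\<phi> m\<xi>] normalized_p_laplacian_rpf[OF m\<phi> m\<xi>]
        dd_minus[OF \<phi>] dd_minus[OF rpf_dd[OF \<phi>]] sum_negf algebra_simps)
  with f[OF z] show "dd (0, 1) \<phi> z - norm \<xi> powr \<gamma> * ((\<Sum>b\<in>Basis. dd (b, 0) (dd (b, 0) \<phi>) z)
       + (p - 2) * dd (\<xi> /\<^sub>R norm \<xi>, 0) (dd (\<xi> /\<^sub>R norm \<xi>, 0) \<phi>) z) \<le> F"
    by simp
qed

section \<open>Essential and pointwise bounds\<close>

lemma Q_borel: "Q r \<in> sets lebesgue"
  unfolding Q_def by (intro sets_completionI_sets) (simp add: borel_Times)

lemma in_Linf_bounded:
  assumes "continuous_on (Q 1) u" "bounded (u ` Q 1)"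
  shows "in_Linf (Q 1) u"
proof -
  have m: "u \<in> borel_measurable (lebesgue_on (Q 1))"
    using assms(1) Q_borel by (rule continuous_imp_measurable_on_sets_lebesgue)
  obtain B where B: "\<And>z. z \<in> Q 1 \<Longrightarrow> \<bar>u z\<bar> \<le> B"
    using assms(2) by (auto simp: bounded_iff)
  have "esssup (lebesgue_on (Q 1)) (\<lambda>z. ereal \<bar>u z\<bar>) \<le> ereal B"
  proof (rule esssup_I)
    show "(\<lambda>z. ereal \<bar>u z\<bar>) \<in> borel_measurable (lebesgue_on (Q 1))" using m by measurable
    show "AE z in lebesgue_on (Q 1). ereal \<bar>u z\<bar> \<le> ereal B"
      by (rule AE_I2) (use B in auto)
  qed
  then show ?thesis using m unfolding in_Linf_def by auto
qed

text \<open>By continuity a violation at \<open>z\<close> persists near \<open>z\<close>, hence on a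
  set of positive measure.\<close>

lemma abs_le_Linf_norm:
  assumes g: "continuous_on (Q 1) g" "in_Linf (Q 1) g" and z: "z \<in> Q 1"
  shows "\<bar>g z\<bar> \<le> Linf_norm (Q 1) (g :: (real^'n) \<times> real \<Rightarrow> real)"
proof (rule ccontr)
  assume contra: "\<not> ?thesis"
  define e where "e = esssup (lebesgue_on (Q 1)) (\<lambda>z. ereal \<bar>g z\<bar>)"
  have e: "e < \<infinity>" using g(2) by (simp add: in_Linf_def e_def)
  have gz: "\<bar>g z\<bar> > real_of_ereal e" using contra by (simp add: Linf_norm_def e_def)
  have "((\<lambda>y. \<bar>g y\<bar>) \<longlongrightarrow> \<bar>g z\<bar>) (at z within Q 1)"
    using g(1) z by (intro tendsto_rabs) (simp add: continuous_on_def)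
  from order_tendstoD(1)[OF this gz]
  obtain d where d: "d > 0" "\<And>y. y \<in> Q 1 \<Longrightarrow> y \<noteq> z \<Longrightarrow> dist y z < d \<Longrightarrow> real_of_ereal e < \<bar>g y\<bar>"
    unfolding eventually_at by blast
  \<comment> \<open>Restricting to negative times makes \<open>V\<close> open even when
    \<open>z\<close> lies at the top; a point slightly earlier than \<open>z\<close> shows that
    \<open>V\<close> is not empty.\<close>
  define V where "V = ball z d \<inter> (ball 0 1 \<times> {-1<..<0})"
  have V: "y \<in> Q 1" "ereal \<bar>g y\<bar> > e" if "y \<in> V" for y
  proof -
    show y: "y \<in> Q 1" using that by (auto simp: V_def Q_def)
    have "real_of_ereal e < \<bar>g y\<bar>"
      using d(2)[OF y] that gz by (cases "y = z") (auto simp: V_def dist_commute)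
    then show "ereal \<bar>g y\<bar> > e" using e by (cases e) auto
  qed
  have "open V" unfolding V_def by (intro open_Int open_Times) auto
  moreover have "V \<noteq> {}"
  proof -
    have t: "-1 < snd z" "snd z \<le> 0" "norm (fst z) < 1" using z by (auto simp: Q_def)
    define s where "s = min (d / 2) ((1 + snd z) / 2)"
    have "s \<le> d / 2" "s \<le> (1 + snd z) / 2" "0 < s"
      unfolding s_def by (rule min.cobounded1, rule min.cobounded2) (use d t in simp)
    moreover have "s < (1 + snd z) / 2 + (1 + snd z) / 2" "s < d / 2 + d / 2"
      using calculation by simp_all
    ultimately have s: "0 < s" "s < d" "s < 1 + snd z" by (simp_all only: field_sum_of_halves)
    have "(fst z, snd z - s) \<in> V"
      using s t by (cases z) (auto simp: V_def dist_Pair_Pair dist_real_def)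
    then show ?thesis by blast
  qed
  ultimately have "\<not> negligible V" by (rule open_not_negligible)
  moreover have "negligible V"
  proof -
    have "AE y in lebesgue_on (Q 1). ereal \<bar>g y\<bar> \<le> e" unfolding e_def by (rule esssup_AE)
    then have "AE y in lebesgue. y \<in> Q 1 \<longrightarrow> ereal \<bar>g y\<bar> \<le> e"
      using Q_borel by (subst (asm) AE_restrict_space_iff) auto
    then obtain N where N: "N \<in> null_sets lebesgue"
        "{y \<in> space lebesgue. \<not> (y \<in> Q 1 \<longrightarrow> ereal \<bar>g y\<bar> \<le> e)} \<subseteq> N"
      unfolding eventually_ae_filter by blast
    have "V \<subseteq> N" using N(2) V by fastforce
    then show ?thesis using N(1) negligible_iff_null_sets negligible_subset by blast
  qed
  ultimately show False by blast
qed

section \<open>The coupling\<close>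

text \<open>Separates the size of the gradient from its direction, so that compactness is needed
  only for gradients near the unit sphere.\<close>

lemma diff_root_scale:
  assumes "l > 0"
  shows "diff_root \<gamma> p (l *\<^sub>R \<xi>) \<eta> w = l powr (\<gamma> / 2) *\<^sub>R diff_root \<gamma> p \<xi> \<eta> w"
proof -
  have "c * (l * x) / (l * (l * y)) * l = c * x / y" for c x y :: real
    using assms by simp
  then have "(c * ((l *\<^sub>R \<xi>) \<bullet> v) / ((l *\<^sub>R \<xi>) \<bullet> (l *\<^sub>R \<xi>))) *\<^sub>R (l *\<^sub>R \<xi>)
      = (c * (\<xi> \<bullet> v) / (\<xi> \<bullet> \<xi>)) *\<^sub>R \<xi>" for c v
    by (simp only: inner_scaleR_left inner_scaleR_right scaleR_scaleR)
  then show ?thesis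
    using assms by (simp only: diff_root_def norm_scaleR) (simp add: powr_mult)
qed

lemma diff_root_minus: "diff_root \<gamma> p (- \<xi>) \<eta> w = diff_root \<gamma> p \<xi> \<eta> w"
  by (simp add: diff_root_def)

text \<open>For \<open>a = b = 0\<close> the difference of the two roots is \<open>2 \<surd>(p - 1) \<eta> \<eta>\<^sup>T\<close>, so the first bound
  holds with the factor 4; it survives small perturbations of \<open>\<eta>\<close> by compactness.\<close>

definition coupling_bound ::
    "'a::euclidean_space itself \<Rightarrow> real \<Rightarrow> real \<Rightarrow> real \<Rightarrow> real \<Rightarrow> real \<Rightarrow> bool" where
  "coupling_bound _ \<gamma> p \<beta> \<delta> C \<longleftrightarrow> (\<forall>\<eta> a b :: 'a. norm \<eta> = 1 \<longrightarrow> norm a \<le> \<delta> \<longrightarrow> norm b \<le> \<delta> \<longrightarrow>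
      (\<Sum>i\<in>Basis. (norm (diff_root \<gamma> p (\<eta> + a) 0 i - diff_root \<gamma> p (\<eta> + b) \<eta> i))\<^sup>2)
       - (2 - \<beta>) * (\<Sum>i\<in>Basis. (\<eta> \<bullet> (diff_root \<gamma> p (\<eta> + a) 0 i - diff_root \<gamma> p (\<eta> + b) \<eta> i))\<^sup>2)
       \<le> - 3 * ((1 - \<beta>) * (p - 1)) \<and>
      (\<Sum>i\<in>Basis. (\<eta> \<bullet> (diff_root \<gamma> p (\<eta> + a) 0 i - diff_root \<gamma> p (\<eta> + b) \<eta> i))\<^sup>2) \<le> C \<and>
      (\<Sum>i\<in>Basis. (norm (diff_root \<gamma> p (\<eta> + a) 0 i))\<^sup>2 + (norm (diff_root \<gamma> p (\<eta> + b) \<eta> i))\<^sup>2) \<le> C)"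

lemma coupling_bound_exists:
  assumes p: "1 < p" and \<beta>: "0 < \<beta>" "\<beta> < 1"
  obtains \<delta> C where "0 < \<delta>" "\<delta> < 1" "0 \<le> C" "coupling_bound TYPE('a::euclidean_space) \<gamma> p \<beta> \<delta> C"
proof -
  \<comment> \<open>Radius 1/2 keeps \<eta> + a and \<eta> + b away from 0, where the roots need not
    be continuous.\<close>
  define W where "W = sphere (0::'a) 1 \<times> cball (0::'a) (1/2) \<times> cball (0::'a) (1/2)"
  have W: "compact W" unfolding W_def by (intro compact_Times) auto
  define S1 where "S1 = (\<lambda>w::'a \<times> 'a \<times> 'a. diff_root \<gamma> p (fst w + fst (snd w)) 0)"
  define S2 where "S2 = (\<lambda>w::'a \<times> 'a \<times> 'a. diff_root \<gamma> p (fst w + snd (snd w)) (fst w))"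
  have nz: "fst w + fst (snd w) \<noteq> 0" "fst w + snd (snd w) \<noteq> 0" if "w \<in> W" for w
    using that norm_diff_ineq[of "fst w" "fst (snd w)"] norm_diff_ineq[of "fst w" "snd (snd w)"]
    by (auto simp: W_def)
  have S1: "continuous_on W (\<lambda>w. S1 w v)" for v
    unfolding S1_def diff_root_def reflect_def by (intro continuous_intros) (use nz in auto)
  have S2: "continuous_on W (\<lambda>w. S2 w v)" for v
    unfolding S2_def diff_root_def reflect_def by (intro continuous_intros) (use nz in auto)
  define q where "q = (\<lambda>w. (\<Sum>i\<in>Basis. (norm (S1 w i - S2 w i))\<^sup>2)
      - (2 - \<beta>) * (\<Sum>i\<in>Basis. (fst w \<bullet> (S1 w i - S2 w i))\<^sup>2))"
  define r where "r = (\<lambda>w. (\<Sum>i\<in>Basis. (fst w \<bullet> (S1 w i - S2 w i))\<^sup>2)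
      + (\<Sum>i\<in>Basis. (norm (S1 w i))\<^sup>2 + (norm (S2 w i))\<^sup>2))"
  have "continuous_on W q" unfolding q_def by (intro continuous_intros S1 S2)
  then have "uniformly_continuous_on W q" using W by (rule compact_uniformly_continuous)
  moreover have "(1 - \<beta>) * (p - 1) > 0" using p \<beta> by simp
  ultimately obtain d where d: "d > 0"
    "\<And>w w'. w \<in> W \<Longrightarrow> w' \<in> W \<Longrightarrow> dist w' w < d \<Longrightarrow> dist (q w') (q w) < (1 - \<beta>) * (p - 1)"
    unfolding uniformly_continuous_on_def by meson
  have "continuous_on W r" unfolding r_def by (intro continuous_intros S1 S2)
  then have "bounded (r ` W)" using W by (intro compact_imp_bounded compact_continuous_image)
  then obtain C where C: "\<And>w. w \<in> W \<Longrightarrow> \<bar>r w\<bar> \<le> C" by (auto simp: bounded_iff)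
  \<comment> \<open>The pair (a, b) then has norm at most 2 d / 3 < d. Moving it away from (0, 0)
    changes \<open>q\<close> by less than (1 - \<beta>) (p - 1), which leaves three of the four such
    units found at (0, 0).\<close>
  define \<delta> where "\<delta> = min (1/2) (d / 3)"
  have "coupling_bound TYPE('a) \<gamma> p \<beta> \<delta> (max C 0)"
    unfolding coupling_bound_def
  proof (intro allI impI)
    fix \<eta> a b :: 'a
    assume \<eta>: "norm \<eta> = 1" and a: "norm a \<le> \<delta>" and b: "norm b \<le> \<delta>"
    let ?w = "(\<eta>, a, b)" and ?v = "(\<eta>, 0, 0) :: 'a \<times> 'a \<times> 'a"
    have w: "?w \<in> W" "?v \<in> W" using \<eta> a b by (auto simp: W_def \<delta>_def)
    have \<eta>\<eta>: "\<eta> \<bullet> \<eta> = 1" using \<eta> by (simp add: dot_square_norm)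
    have diff: "S1 ?v i - S2 ?v i = (2 * sqrt (p - 1) * (\<eta> \<bullet> i)) *\<^sub>R \<eta>" for i
    proof -
      have lin: "i + c1 *\<^sub>R \<eta> - (i - c2 *\<^sub>R \<eta> + c3 *\<^sub>R \<eta>) = (c1 + c2 - c3) *\<^sub>R \<eta>" for c1 c2 c3
        by (simp add: scaleR_left_distrib scaleR_left_diff_distrib)
      have "S1 ?v i = i + ((sqrt (p - 1) - 1) * (\<eta> \<bullet> i)) *\<^sub>R \<eta>"
        using \<eta> \<eta>\<eta> by (simp add: S1_def diff_root_def reflect_def)
      moreover have "S2 ?v i = i - (2 * (\<eta> \<bullet> i)) *\<^sub>R \<eta> + ((sqrt (p - 1) - 1) * - (\<eta> \<bullet> i)) *\<^sub>R \<eta>"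
        using \<eta> \<eta>\<eta> by (simp add: S2_def diff_root_def reflect_def inner_diff_right)
      ultimately have "S1 ?v i - S2 ?v i = (((sqrt (p - 1) - 1) * (\<eta> \<bullet> i)) + 2 * (\<eta> \<bullet> i)
          - (sqrt (p - 1) - 1) * - (\<eta> \<bullet> i)) *\<^sub>R \<eta>"
        by (simp only: lin)
      also have "((sqrt (p - 1) - 1) * (\<eta> \<bullet> i)) + 2 * (\<eta> \<bullet> i) - (sqrt (p - 1) - 1) * - (\<eta> \<bullet> i)
          = 2 * sqrt (p - 1) * (\<eta> \<bullet> i)"
        by (simp add: algebra_simps)
      finally show ?thesis .
    qed
    have one: "(\<Sum>i\<in>Basis. (\<eta> \<bullet> i)\<^sup>2) = 1"
      using \<eta>\<eta> euclidean_inner[of \<eta> \<eta>] by (simp add: power2_eq_square)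
    have "q ?v = (\<Sum>i\<in>Basis. 4 * (p - 1) * (\<eta> \<bullet> i)\<^sup>2) - (2 - \<beta>) * (\<Sum>i\<in>Basis. 4 * (p - 1) * (\<eta> \<bullet> i)\<^sup>2)"
      unfolding q_def diff using \<eta> \<eta>\<eta> p by (simp add: power_mult_distrib)
    also have "\<dots> = - 4 * ((1 - \<beta>) * (p - 1))"
      unfolding sum_distrib_left[symmetric] one by (simp add: algebra_simps)
    finally have q0: "q ?v = - 4 * ((1 - \<beta>) * (p - 1))" .
    have "dist ?w ?v = norm (0::'a, a, b)" by (simp only: dist_norm diff_Pair diff_self diff_zero)
    also have "\<dots> \<le> norm a + norm b"
      using norm_Pair_le[of "0::'a" "(a, b)"] norm_Pair_le[of a b] by simp
    also have "\<dots> < d" using a b d(1) by (simp add: \<delta>_def)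
    finally have "dist (q ?w) (q ?v) < (1 - \<beta>) * (p - 1)" using d(2) w by blast
    then have q: "q ?w \<le> - 3 * ((1 - \<beta>) * (p - 1))" using q0 by (simp add: dist_real_def abs_less_iff)
    have nonneg: "0 \<le> (\<Sum>i\<in>Basis. (\<eta> \<bullet> (S1 ?w i - S2 ?w i))\<^sup>2)"
      "0 \<le> (\<Sum>i\<in>Basis. (norm (S1 ?w i))\<^sup>2 + (norm (S2 ?w i))\<^sup>2)"
      by (auto intro!: sum_nonneg add_nonneg_nonneg)
    have "r ?w \<le> C" using C[OF w(1)] by simp
    with nonneg have "(\<Sum>i\<in>Basis. (\<eta> \<bullet> (S1 ?w i - S2 ?w i))\<^sup>2) \<le> max C 0"
      "(\<Sum>i\<in>Basis. (norm (S1 ?w i))\<^sup>2 + (norm (S2 ?w i))\<^sup>2) \<le> max C 0"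
      unfolding r_def fst_conv by linarith+
    with q show "(\<Sum>i\<in>Basis. (norm (diff_root \<gamma> p (\<eta> + a) 0 i - diff_root \<gamma> p (\<eta> + b) \<eta> i))\<^sup>2)
       - (2 - \<beta>) * (\<Sum>i\<in>Basis. (\<eta> \<bullet> (diff_root \<gamma> p (\<eta> + a) 0 i - diff_root \<gamma> p (\<eta> + b) \<eta> i))\<^sup>2)
       \<le> - 3 * ((1 - \<beta>) * (p - 1)) \<and>
      (\<Sum>i\<in>Basis. (\<eta> \<bullet> (diff_root \<gamma> p (\<eta> + a) 0 i - diff_root \<gamma> p (\<eta> + b) \<eta> i))\<^sup>2) \<le> max C 0 \<and>
      (\<Sum>i\<in>Basis. (norm (diff_root \<gamma> p (\<eta> + a) 0 i))\<^sup>2 + (norm (diff_root \<gamma> p (\<eta> + b) \<eta> i))\<^sup>2) \<le> max C 0"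
      unfolding q_def S1_def S2_def by simp
  qed
  moreover have "0 < \<delta>" "\<delta> < 1" "0 \<le> max C 0" using d(1) by (auto simp: \<delta>_def)
  ultimately show ?thesis using that by blast
qed

text \<open>First-order condition for the doubled maximum in one of its space variables, with a
  maximiser of the sup-convolution held fixed at \<open>a\<close>. The right-hand side does not
  involve \<open>a\<close>, so all maximisers yield the same gradient.\<close>

lemma gradient_at_maximiser:
  fixes x :: "'a::euclidean_space"
  assumes xb: "x \<noteq> b"
    and min: "\<forall>\<^sub>F x' in nhds x. N * (norm (x - a))\<^sup>2 + L * norm (x - b) powr \<beta> + M * (norm (x - c))\<^sup>2
      \<le> N * (norm (x' - a))\<^sup>2 + L * norm (x' - b) powr \<beta> + M * (norm (x' - c))\<^sup>2"
  shows "(2 * N) *\<^sub>R (a - x) = (L * \<beta> * norm (x - b) powr \<beta> / (norm (x - b))\<^sup>2) *\<^sub>R (x - b) + (2 * M) *\<^sub>R (x - c)"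
proof -
  have sq: "((\<lambda>x'. (norm (x' - a))\<^sup>2) has_derivative (\<lambda>h. 2 * ((x - a) \<bullet> h))) (at x)" for a
    unfolding power2_norm_eq_inner by (auto intro!: derivative_eq_intros simp: inner_commute)
  have nm: "((\<lambda>x'. norm (x' - b)) has_derivative (\<lambda>h. h \<bullet> sgn (x - b))) (at x)"
  proof (rule has_derivative_compose[of "\<lambda>x'. x' - b" "\<lambda>h. h" x UNIV norm "\<lambda>h. h \<bullet> sgn (x - b)"])
    show "((\<lambda>x'. x' - b) has_derivative (\<lambda>h. h)) (at x)" by (auto intro!: derivative_eq_intros)
    show "(norm has_derivative (\<lambda>h. h \<bullet> sgn (x - b))) (at (x - b))"
      using has_derivative_norm[of "x - b"] xb by simp
  qed
  have "((\<lambda>x'. norm (x' - b) powr \<beta>) has_derivative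
      (\<lambda>h. norm (x - b) powr \<beta> * (0 * ln (norm (x - b)) + (h \<bullet> sgn (x - b)) * \<beta> / norm (x - b)))) (at x)"
    by (rule has_derivative_powr[OF nm has_derivative_const]) (use xb in auto)
  then have pw: "((\<lambda>x'. norm (x' - b) powr \<beta>) has_derivative
      (\<lambda>h. \<beta> * norm (x - b) powr \<beta> / (norm (x - b))\<^sup>2 * ((x - b) \<bullet> h))) (at x)"
  proof (rule has_derivative_eq_rhs, intro ext)
    fix h
    have "h \<bullet> sgn (x - b) = ((x - b) \<bullet> h) / norm (x - b)"
      by (simp add: sgn_div_norm inner_commute divide_inverse)
    then show "norm (x - b) powr \<beta> * (0 * ln (norm (x - b)) + (h \<bullet> sgn (x - b)) * \<beta> / norm (x - b))
        = \<beta> * norm (x - b) powr \<beta> / (norm (x - b))\<^sup>2 * ((x - b) \<bullet> h)"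
      by (simp add: power2_eq_square)
  qed
  define v where "v = (2 * N) *\<^sub>R (x - a) + (L * \<beta> * norm (x - b) powr \<beta> / (norm (x - b))\<^sup>2) *\<^sub>R (x - b) + (2 * M) *\<^sub>R (x - c)"
  have "((\<lambda>x'. N * (norm (x' - a))\<^sup>2 + L * norm (x' - b) powr \<beta> + M * (norm (x' - c))\<^sup>2) has_derivative
      (\<lambda>h. N * (2 * ((x - a) \<bullet> h)) + L * (\<beta> * norm (x - b) powr \<beta> / (norm (x - b))\<^sup>2 * ((x - b) \<bullet> h))
        + M * (2 * ((x - c) \<bullet> h)))) (at x)"
    by (intro has_derivative_add has_derivative_mult_right sq pw)
  from has_derivative_local_min[OF this] min
  have "(\<lambda>h. N * (2 * ((x - a) \<bullet> h)) + L * (\<beta> * norm (x - b) powr \<beta> / (norm (x - b))\<^sup>2 * ((x - b) \<bullet> h))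
        + M * (2 * ((x - c) \<bullet> h))) = (\<lambda>h. 0)"
    by (simp add: eventually_nhds_conv_at)
  moreover have "v \<bullet> h = N * (2 * ((x - a) \<bullet> h)) + L * (\<beta> * norm (x - b) powr \<beta> / (norm (x - b))\<^sup>2 * ((x - b) \<bullet> h))
        + M * (2 * ((x - c) \<bullet> h))" for h
    unfolding v_def inner_add_left inner_scaleR_left by simp
  ultimately have "v \<bullet> v = 0" by metis
  then have "(2 * N) *\<^sub>R (x - a) + ((L * \<beta> * norm (x - b) powr \<beta> / (norm (x - b))\<^sup>2) *\<^sub>R (x - b) + (2 * M) *\<^sub>R (x - c)) = 0"
    by (simp add: v_def add.assoc)
  then show ?thesis
    by (metis add.inverse_inverse add_eq_0_iff minus_diff_eq scaleR_minus_right)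
qed

text \<open>Degree 4 is what occurs: the test function of the doubling is quadratic in a quantity
  that is itself quadratic along lines.\<close>

lemma rpf_line_quartic:
  assumes f: "real_polynomial_function f"
    and eq: "\<And>s::real. f (z + s *\<^sub>R v) = c0 + c1 * s + c2 * s ^ 2 + c3 * s ^ 3 + c4 * s ^ 4"
  shows "dd v f z = c1" "dd v (dd v f) z = 2 * c2"
proof -
  have "((\<lambda>s. c0 + c1 * s + c2 * s ^ 2 + c3 * s ^ 3 + c4 * s ^ 4) has_real_derivative
      c1 + 2 * c2 * s + 3 * c3 * s ^ 2 + 4 * c4 * s ^ 3) (at s)" for s
    by (auto intro!: derivative_eq_intros)
  then have first: "dd v f (z + s *\<^sub>R v) = c1 + 2 * c2 * s + 3 * c3 * s ^ 2 + 4 * c4 * s ^ 3" for s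
    using rpf_line_deriv[OF f, of z v s] DERIV_unique unfolding eq by blast
  have "((\<lambda>s. c1 + 2 * c2 * s + 3 * c3 * s ^ 2 + 4 * c4 * s ^ 3) has_real_derivative 2 * c2) (at 0)"
    by (auto intro!: derivative_eq_intros)
  moreover have "((\<lambda>s. c1 + 2 * c2 * s + 3 * c3 * s ^ 2 + 4 * c4 * s ^ 3) has_real_derivative
      dd v (dd v f) (z + 0 *\<^sub>R v)) (at 0)"
    using rpf_line_deriv[OF rpf_dd[OF f, of v], where z=z and v=v and s=0] unfolding first .
  ultimately show "dd v (dd v f) z = 2 * c2" using DERIV_unique by fastforce
  show "dd v f z = c1" using first[of 0] by simp
qed

text \<open>Second-order Taylor bound, relaxed by \<epsilon> so that the difference has a positive
  second derivative at 0. It provides a polynomial that touches the power from above.\<close>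

lemma powr_quadratic_upper:
  fixes \<alpha> \<epsilon> :: real
  assumes "\<epsilon> > 0"
  obtains r where "0 < r" "r < 1"
    "\<And>y. \<bar>y\<bar> < r \<Longrightarrow> (1 + y) powr \<alpha> \<le> 1 + \<alpha> * y - (\<alpha> * (1 - \<alpha>) / 2 - \<epsilon>) * y\<^sup>2"
proof -
  define k where "k = \<alpha> * (1 - \<alpha>) / 2 - \<epsilon>"
  define g where "g = (\<lambda>y. 1 + \<alpha> * y - k * y\<^sup>2 - (1 + y) powr \<alpha>)"
  define g' where "g' = (\<lambda>y. \<alpha> - 2 * k * y - \<alpha> * (1 + y) powr (\<alpha> - 1))"
  have g: "(g has_real_derivative g' y) (at y)" if "\<bar>y\<bar> < 1" for y
    unfolding g_def g'_def using that
    by (auto intro!: derivative_eq_intros simp: powr_diff)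
  have "(g' has_real_derivative - 2 * k - \<alpha> * (\<alpha> - 1)) (at 0)"
    unfolding g'_def by (auto intro!: derivative_eq_intros)
  moreover have "2 * k = \<alpha> * (1 - \<alpha>) - 2 * \<epsilon>" by (simp add: k_def)
  then have "- 2 * k - \<alpha> * (\<alpha> - 1) > 0" using assms by (simp add: algebra_simps)
  ultimately obtain d1 d2 where d: "d1 > 0" "\<And>h. 0 < h \<Longrightarrow> h < d1 \<Longrightarrow> g' 0 < g' (0 + h)"
      "d2 > 0" "\<And>h. 0 < h \<Longrightarrow> h < d2 \<Longrightarrow> g' (0 - h) < g' 0"
    using DERIV_pos_inc_right[of g' _ 0] DERIV_pos_inc_left[of g' _ 0] by metis
  have zero: "g 0 = 0" "g' 0 = 0" by (simp_all add: g_def g'_def)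
  show ?thesis
  proof (rule that[of "min (1/2) (min d1 d2)"])
    fix y assume y: "\<bar>y\<bar> < min (1/2) (min d1 d2)"
    have "g y \<ge> 0"
    proof (cases y "0::real" rule: linorder_cases)
      case less
      obtain x where x: "y < x" "x < 0" "g 0 - g y = (0 - y) * g' x"
        using MVT2[OF less, of g g'] g y by auto
      have "g' x < 0" using d(4)[of "- x"] x y zero by auto
      then have "(0 - y) * g' x \<le> 0" using less by (intro mult_nonneg_nonpos) auto
      then show ?thesis using x zero by simp
    next
      case greater
      obtain x where x: "0 < x" "x < y" "g y - g 0 = (y - 0) * g' x"
        using MVT2[OF greater, of g g'] g y by auto
      have "g' x > 0" using d(2)[of x] x y zero by auto
      then have "(y - 0) * g' x \<ge> 0" using greater by simp
      then show ?thesis using x zero by simp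
    qed (simp add: zero)
    then show "(1 + y) powr \<alpha> \<le> 1 + \<alpha> * y - (\<alpha> * (1 - \<alpha>) / 2 - \<epsilon>) * y\<^sup>2"
      by (simp add: g_def k_def)
  qed (use d in auto)
qed

section \<open>Doubling the space variable\<close>

text \<open>With e = x - y and \<open>s\<close> the square of |e|, |e + S1 w - S2 w|^2 = s (1 + Y
  w). With c = L |e|^\<beta> and \<alpha> = \<beta>/2, \<theta> is then the quadratic majorant of L
  |x - y|^\<beta> = c (1 + Y)^\<alpha>, plus the localisation.\<close>

lemma coupled_test_function:
  fixes S1 S2 :: "'a::euclidean_space \<Rightarrow> 'a" and e v1 v2 :: 'a and c \<alpha> k M s t0 :: real
  assumes S: "linear S1" "linear S2"
  defines "Y \<equiv> \<lambda>w. (2 * (e \<bullet> (S1 w - S2 w)) + (norm (S1 w - S2 w))\<^sup>2) / s"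
  defines "\<theta> \<equiv> \<lambda>\<zeta>. c * (1 + \<alpha> * Y (fst \<zeta>) - k * (Y (fst \<zeta>))\<^sup>2)
      + M * ((norm (v1 + S1 (fst \<zeta>)))\<^sup>2 + (norm (v2 + S2 (fst \<zeta>)))\<^sup>2 + (snd \<zeta> - t0)\<^sup>2)"
  shows "real_polynomial_function \<theta>"
    and "heat \<theta> (0, \<tau>) = 2 * M * (\<tau> - t0) - (\<Sum>b\<in>Basis.
        2 * (c * (\<alpha> * ((norm (S1 b - S2 b))\<^sup>2 / s) - k * (2 * (e \<bullet> (S1 b - S2 b)) / s)\<^sup>2))
        + 2 * M * ((norm (S1 b))\<^sup>2 + (norm (S2 b))\<^sup>2))"
proof -
  have bl: "bounded_linear (\<lambda>\<zeta>::'a \<times> real. f (fst \<zeta>))" if "linear f" for f :: "'a \<Rightarrow> 'a"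
    using bounded_linear_compose[OF _ bounded_linear_fst] that unfolding linear_conv_bounded_linear by blast
  have D: "linear (\<lambda>w. S1 w - S2 w)" using S by (rule linear_compose_sub)
  have norm_rpf: "real_polynomial_function (\<lambda>\<zeta>::'a \<times> real. (norm (v + f (fst \<zeta>)))\<^sup>2)"
    if "linear f" for v and f :: "'a \<Rightarrow> 'a"
    unfolding power2_norm_eq_inner by (rule rpf_affine[OF rpf_norm_sq bl[OF that]])
  have Y: "real_polynomial_function (\<lambda>\<zeta>::'a \<times> real. Y (fst \<zeta>))"
    unfolding Y_def
  proof (intro real_polynomial_function_divide real_polynomial_function.intros(3) rpf_cmult)
    show "real_polynomial_function (\<lambda>\<zeta>::'a \<times> real. e \<bullet> (S1 (fst \<zeta>) - S2 (fst \<zeta>)))"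
      by (intro real_polynomial_function.intros(1) bounded_linear_inner_right_comp bl[OF D])
    show "real_polynomial_function (\<lambda>\<zeta>::'a \<times> real. (norm (S1 (fst \<zeta>) - S2 (fst \<zeta>)))\<^sup>2)"
      using norm_rpf[OF D, of 0] by simp
  qed
  show \<theta>: "real_polynomial_function \<theta>"
    unfolding \<theta>_def
    by (intro real_polynomial_function.intros(2,3) rpf_cmult real_polynomial_function_diff
        real_polynomial_function_power Y norm_rpf S rpf_snd_power)
  have zero: "S1 0 = 0" "S2 0 = 0" "Y 0 = 0"
    by (simp_all add: Y_def linear_0[OF S(1)] linear_0[OF S(2)])
  have sq: "(norm (v + \<sigma> *\<^sub>R w))\<^sup>2 = (norm v)\<^sup>2 + 2 * (v \<bullet> w) * \<sigma> + (norm w)\<^sup>2 * \<sigma>\<^sup>2" for v w :: 'a and \<sigma>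
    unfolding power2_norm_eq_inner
    by (simp add: inner_add_left inner_add_right inner_commute power2_eq_square algebra_simps)
  have time: "dd (0, 1) \<theta> (0, \<tau>) = 2 * M * (\<tau> - t0)"
  proof (rule rpf_line_quartic(1)[OF \<theta>])
    show "\<theta> ((0, \<tau>) + \<sigma> *\<^sub>R (0, 1)) = (c + M * ((norm v1)\<^sup>2 + (norm v2)\<^sup>2 + (\<tau> - t0)\<^sup>2))
        + 2 * M * (\<tau> - t0) * \<sigma> + M * \<sigma>\<^sup>2 + 0 * \<sigma> ^ 3 + 0 * \<sigma> ^ 4" for \<sigma>
      by (simp add: \<theta>_def zero power2_eq_square algebra_simps)
  qed
  have space: "dd (b, 0) (dd (b, 0) \<theta>) (0, \<tau>)
      = 2 * (c * (\<alpha> * ((norm (S1 b - S2 b))\<^sup>2 / s) - k * (2 * (e \<bullet> (S1 b - S2 b)) / s)\<^sup>2)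
        + M * ((norm (S1 b))\<^sup>2 + (norm (S2 b))\<^sup>2))" for b
  proof (rule rpf_line_quartic(2)[OF \<theta>])
    define p1 where "p1 = 2 * (e \<bullet> (S1 b - S2 b)) / s"
    define p2 where "p2 = (norm (S1 b - S2 b))\<^sup>2 / s"
    fix \<sigma> :: real
    have "S1 (\<sigma> *\<^sub>R b) - S2 (\<sigma> *\<^sub>R b) = \<sigma> *\<^sub>R (S1 b - S2 b)"
      by (simp add: linear_scale[OF S(1)] linear_scale[OF S(2)] scaleR_right_diff_distrib)
    then have "Y (\<sigma> *\<^sub>R b) = (2 * (e \<bullet> (\<sigma> *\<^sub>R (S1 b - S2 b))) + (norm (\<sigma> *\<^sub>R (S1 b - S2 b)))\<^sup>2) / s"
      unfolding Y_def by simp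
    also have "\<dots> = p1 * \<sigma> + p2 * \<sigma>\<^sup>2"
      by (simp add: p1_def p2_def power_mult_distrib add_divide_distrib mult_ac)
    finally have Yb: "Y (\<sigma> *\<^sub>R b) = p1 * \<sigma> + p2 * \<sigma>\<^sup>2" .
    have "\<theta> ((0, \<tau>) + \<sigma> *\<^sub>R (b, 0)) = c * (1 + \<alpha> * (p1 * \<sigma> + p2 * \<sigma>\<^sup>2) - k * (p1 * \<sigma> + p2 * \<sigma>\<^sup>2)\<^sup>2)
      + M * (((norm v1)\<^sup>2 + 2 * (v1 \<bullet> S1 b) * \<sigma> + (norm (S1 b))\<^sup>2 * \<sigma>\<^sup>2)
        + ((norm v2)\<^sup>2 + 2 * (v2 \<bullet> S2 b) * \<sigma> + (norm (S2 b))\<^sup>2 * \<sigma>\<^sup>2) + (\<tau> - t0)\<^sup>2)"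
      by (simp add: \<theta>_def Yb linear_scale[OF S(1)] linear_scale[OF S(2)] sq)
    also have "\<dots> = (c + M * ((norm v1)\<^sup>2 + (norm v2)\<^sup>2 + (\<tau> - t0)\<^sup>2))
        + (c * \<alpha> * p1 + 2 * M * (v1 \<bullet> S1 b + v2 \<bullet> S2 b)) * \<sigma>
        + (c * (\<alpha> * p2 - k * p1\<^sup>2) + M * ((norm (S1 b))\<^sup>2 + (norm (S2 b))\<^sup>2)) * \<sigma>\<^sup>2
        + (- 2 * k * c * p1 * p2) * \<sigma> ^ 3 + (- k * c * p2\<^sup>2) * \<sigma> ^ 4"
      by algebra
    finally show "\<theta> ((0, \<tau>) + \<sigma> *\<^sub>R (b, 0)) = (c + M * ((norm v1)\<^sup>2 + (norm v2)\<^sup>2 + (\<tau> - t0)\<^sup>2))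
        + (c * \<alpha> * p1 + 2 * M * (v1 \<bullet> S1 b + v2 \<bullet> S2 b)) * \<sigma>
        + (c * (\<alpha> * ((norm (S1 b - S2 b))\<^sup>2 / s) - k * (2 * (e \<bullet> (S1 b - S2 b)) / s)\<^sup>2)
          + M * ((norm (S1 b))\<^sup>2 + (norm (S2 b))\<^sup>2)) * \<sigma>\<^sup>2
        + (- 2 * k * c * p1 * p2) * \<sigma> ^ 3 + (- k * c * p2\<^sup>2) * \<sigma> ^ 4"
      unfolding p1_def p2_def .
  qed
  show "heat \<theta> (0, \<tau>) = 2 * M * (\<tau> - t0) - (\<Sum>b\<in>Basis.
        2 * (c * (\<alpha> * ((norm (S1 b - S2 b))\<^sup>2 / s) - k * (2 * (e \<bullet> (S1 b - S2 b)) / s)\<^sup>2))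
        + 2 * M * ((norm (S1 b))\<^sup>2 + (norm (S2 b))\<^sup>2))"
    unfolding heat_def time space by (simp add: algebra_simps)
qed

text \<open>The strict concavity of \<open>s\<^sup>\<beta>\<close> along the reflected direction, of order
  \<open>L s\<^bsup>\<beta>-2\<^esup> \<Lambda>\<^sup>\<gamma>\<close>, dominates all the other terms.\<close>

lemma coupled_heat_lower_bound:
  fixes K F L M \<beta> \<gamma> \<kappa> C s \<sigma> \<Lambda> \<epsilon> A B D t :: real
  assumes \<beta>: "0 < \<beta>" "\<beta> < 1" and \<gamma>: "-1 < \<gamma>" and \<kappa>: "\<kappa> > 0" and C: "C \<ge> 0"
    and s: "0 < s" "s \<le> \<sigma>" "\<sigma> \<le> 1" and L: "L > 0" and M: "M \<ge> 0"
    and \<Lambda>: "\<Lambda> = L * \<beta> * \<sigma> / s"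
    and A: "A - (2 - \<beta>) * B \<le> - 3 * \<kappa>" and B: "0 \<le> B" "B \<le> C" and D: "D \<le> C"
    and \<epsilon>: "\<epsilon> \<ge> 0" "8 * \<epsilon> * C \<le> \<beta> * \<kappa>"
    and MC: "2 * M * C \<le> \<kappa> * (L * \<beta>)" and t: "\<bar>t\<bar> \<le> 1/64"
  shows "2 * M * t - (2 * (L * \<sigma>) * (\<beta> / 2 * (\<Lambda> powr \<gamma> * A / s\<^sup>2)
      - (\<beta> / 2 * (1 - \<beta> / 2) / 2 - \<epsilon>) * (4 * (\<Lambda> powr \<gamma> * B) / s\<^sup>2)) + 2 * M * (\<Lambda> powr \<gamma> * D))
    \<ge> \<kappa> * (L * \<beta>) powr (1 + \<gamma>) - M / 32"
proof -
  define l where "l = \<Lambda> powr \<gamma>"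
  have Lb: "L * \<beta> > 0" using L \<beta> by simp
  have "1 \<le> \<sigma> / s" using s by simp
  from mult_left_mono[OF this less_imp_le[OF Lb]] have \<Lambda>_ge: "\<Lambda> \<ge> L * \<beta>" using \<Lambda> by simp
  have l: "l > 0" unfolding l_def using \<Lambda>_ge Lb by simp
  \<comment> \<open>The common factor: \<beta> G = \<Lambda>^(1+\<gamma>) / s, which is at least (L
    \<beta>)^(1+\<gamma>) since s \<le> 1 \<le> \<sigma>/s.\<close>
  define G where "G = L * \<sigma> * l / s\<^sup>2"
  have G0: "G \<ge> 0" unfolding G_def using L s l by simp
  have "2 * (L * \<sigma>) * (\<beta> / 2 * (l * A / s\<^sup>2)
      - (\<beta> / 2 * (1 - \<beta> / 2) / 2 - \<epsilon>) * (4 * (l * B) / s\<^sup>2))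
      = G * (\<beta> * (A - (2 - \<beta>) * B) + 8 * \<epsilon> * B)"
  proof -
    define x h j where "x = 1 / s\<^sup>2" and "h = \<beta> / 2" and "j = h * (1 - h) / 2"
    have rel: "\<beta> = 2 * h" "2 * j = h * (1 - h)" by (simp_all add: h_def j_def)
    have "2 * (L * \<sigma>) * (h * (l * A * x) - (j - \<epsilon>) * (4 * (l * B) * x))
        = (L * \<sigma> * l * x) * (\<beta> * (A - (2 - \<beta>) * B) + 8 * \<epsilon> * B)"
      using rel by algebra
    then show ?thesis by (simp only: G_def x_def h_def j_def times_divide_eq_right mult_1_right)
  qed
  also have "\<dots> \<le> G * (\<beta> * (- 3 * \<kappa>) + \<beta> * \<kappa>)"
  proof (intro mult_left_mono add_mono G0)
    show "A - (2 - \<beta>) * B \<le> - 3 * \<kappa>" by (rule A)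
    have "8 * \<epsilon> * B \<le> 8 * \<epsilon> * C" using B(2) \<epsilon>(1) by (intro mult_left_mono) auto
    then show "8 * \<epsilon> * B \<le> \<beta> * \<kappa>" using \<epsilon>(2) by linarith
  qed (use \<beta> in simp)
  also have "\<dots> = - 2 * \<kappa> * (\<beta> * G)" by (simp add: algebra_simps)
  finally have main: "2 * (L * \<sigma>) * (\<beta> / 2 * (l * A / s\<^sup>2)
      - (\<beta> / 2 * (1 - \<beta> / 2) / 2 - \<epsilon>) * (4 * (l * B) / s\<^sup>2)) \<le> - 2 * \<kappa> * (\<beta> * G)" .
  have bG: "\<beta> * G = l * \<Lambda> / s"
    unfolding G_def \<Lambda> by (simp add: power2_eq_square divide_inverse mult_ac)
  have "1 \<le> 1 / s" using s by simp
  moreover have "0 \<le> l * \<Lambda>" using l \<Lambda>_ge Lb by simp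
  ultimately have "l * \<Lambda> * 1 \<le> l * \<Lambda> * (1 / s)" by (rule mult_left_mono)
  then have ge1: "\<beta> * G \<ge> l * \<Lambda>" using bG by simp
  have "l * (L * \<beta>) \<le> l * \<Lambda>" using l \<Lambda>_ge by simp
  with ge1 have ge2: "l * (L * \<beta>) \<le> \<beta> * G" by linarith
  \<comment> \<open>For negative \<gamma> the factor \<Lambda>^\<gamma> alone is not bounded below
    in terms of L \<beta>; with one more factor \<Lambda> the exponent is positive.\<close>
  have "(L * \<beta>) powr (1 + \<gamma>) \<le> \<Lambda> powr (1 + \<gamma>)"
    using \<Lambda>_ge Lb \<gamma> by (intro powr_mono2) auto
  also have "\<dots> = l * \<Lambda>" unfolding l_def using \<Lambda>_ge Lb by (simp add: powr_add)
  finally have ge3: "(L * \<beta>) powr (1 + \<gamma>) \<le> \<beta> * G" using ge1 by linarith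
  \<comment> \<open>One of the two units \<kappa> \<beta> G absorbs the second derivatives of the
    localisation.\<close>
  have "2 * M * (l * D) \<le> 2 * M * (l * C)" using M l D by (intro mult_left_mono) auto
  also have "\<dots> = l * (2 * M * C)" by simp
  also have "\<dots> \<le> l * (\<kappa> * (L * \<beta>))" using MC l by simp
  also have "\<dots> = \<kappa> * (l * (L * \<beta>))" by simp
  also have "\<dots> \<le> \<kappa> * (\<beta> * G)" using ge2 \<kappa> by simp
  finally have m: "2 * M * (l * D) \<le> \<kappa> * (\<beta> * G)" .
  have "\<kappa> * (L * \<beta>) powr (1 + \<gamma>) \<le> \<kappa> * (\<beta> * G)" using ge3 \<kappa> by simp
  moreover have "2 * M * t \<ge> - (M / 32)"
  proof -
    have "M * (- t) \<le> M * (1/64)" using t M by (intro mult_left_mono) auto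
    then show ?thesis by simp
  qed
  ultimately show ?thesis using main m unfolding l_def[symmetric] by linarith
qed

lemma tendsto_fst_fun:
  fixes f :: "'a::euclidean_space \<Rightarrow> 'b::real_normed_vector"
  assumes "continuous_on UNIV f"
  shows "((\<lambda>\<zeta>. f (fst \<zeta>)) \<longlongrightarrow> f a) (nhds (a, b))"
proof -
  have "(f \<longlongrightarrow> f a) (nhds a)"
    using assms by (simp add: continuous_on_eq_continuous_at continuous_at tendsto_at_iff_tendsto_nhds)
  moreover have "filterlim fst (nhds a) (nhds (a, b))"
    using tendsto_fst[OF filterlim_ident, of "(a, b)"] by simp
  ultimately show ?thesis by (rule filterlim_compose)
qed

lemma square_powr_half:
  fixes x :: real
  assumes "0 \<le> x"
  shows "(x\<^sup>2) powr (b / 2) = x powr b"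
proof (cases "x = 0")
  case False
  then have "x\<^sup>2 = x powr 2" using assms by (simp add: powr_numeral)
  then show ?thesis by (simp add: powr_powr)
qed simp

text \<open>Of the conditions on \<open>L\<close>, the first gives s \<le> 1, the second makes the
  localisation gradient at most \<delta> \<Lambda>, the third absorbs the second derivatives of the
  localisation, and the fourth is the strict inequality that the sum of the two equations
  contradicts.\<close>

lemma doubling_estimate:
  fixes u :: "'a::euclidean_space \<times> real \<Rightarrow> real" and K F L \<beta> \<gamma> p \<delta> C :: real
  assumes \<gamma>: "-1 < \<gamma>" and p: "1 < p" and \<beta>: "0 < \<beta>" "\<beta> < 1"
    and \<delta>: "0 < \<delta>" "\<delta> < 1" and C: "0 \<le> C"
    and coupling: "coupling_bound TYPE('a) \<gamma> p \<beta> \<delta> C"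
    and u: "continuous_on (ball 0 1 \<times> {-1<..0}) u" "\<And>z. z \<in> ball 0 1 \<times> {-1<..0} \<Longrightarrow> \<bar>u z\<bar> \<le> K"
    and K: "K > 0"
    and sub: "touch_subsol \<gamma> p F (ball 0 1 \<times> {-1<..0}) u"
      "touch_subsol \<gamma> p F (ball 0 1 \<times> {-1<..0}) (\<lambda>z. - u z)"
    and L: "2 * K \<le> L" "16384 * K \<le> \<delta> * (L * \<beta>)" "16384 * K * C \<le> (1 - \<beta>) * (p - 1) * (L * \<beta>)"
      "2 * F + 256 * K < (1 - \<beta>) * (p - 1) * (L * \<beta>) powr (1 + \<gamma>)"
    and xy: "x0 \<in> ball 0 (15/16)" "y0 \<in> ball 0 (15/16)" "- ((15/16)\<^sup>2) < t0" "t0 \<le> 0"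
  shows "u (x0, t0) - u (y0, t0) \<le> L * norm (x0 - y0) powr \<beta>"
proof (rule ccontr)
  assume contra: "\<not> ?thesis"
  define \<Omega> where "\<Omega> = ball (0::'a) 1 \<times> {-1<..0::real}"
  note u = u[folded \<Omega>_def] and sub = sub[folded \<Omega>_def]
  define m where "m = u (x0, t0) - u (y0, t0) - L * norm (x0 - y0) powr \<beta>"
  have m: "m > 0" using contra by (simp add: m_def)
  have L0: "L > 0" using L(1) K by linarith
  have t0: "t0 > - 225/256" using xy(3) by (simp add: power2_eq_square)
  \<comment> \<open>1/16 is the gap between 15/16 and 1; in time, 225/256 + 1/16 < 1 leaves room
    below \<open>t0\<close>.\<close>
  define I where "I = {t0 - 1/16..0}"
  define K1 where "K1 = cball x0 (1/16) \<times> I"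
  define K2 where "K2 = cball y0 (1/16) \<times> I"
  have t0I: "t0 \<in> I" using xy(4) by (simp add: I_def)
  have K1: "compact K1" "(x0, t0) \<in> K1" and K2: "compact K2" "(y0, t0) \<in> K2"
    using t0I unfolding K1_def K2_def I_def by (auto intro!: compact_Times)
  then have ne: "K1 \<noteq> {}" "K2 \<noteq> {}" by auto
  have incl: "cball x (1/16) \<times> I \<subseteq> \<Omega>" if "x \<in> ball 0 (15/16)" for x :: 'a
  proof -
    have "norm y < 1" if "dist x y \<le> 1/16" for y
      using norm_triangle_ineq2[of y x] that \<open>x \<in> ball 0 (15/16)\<close> by (simp add: dist_norm norm_minus_commute)
    then show ?thesis using t0 by (auto simp: \<Omega>_def I_def)
  qed
  have K1\<Omega>: "K1 \<subseteq> \<Omega>" and K2\<Omega>: "K2 \<subseteq> \<Omega>" unfolding K1_def K2_def by (intro incl xy)+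
  have u1: "continuous_on K1 u" and u2: "continuous_on K2 (\<lambda>z. - u z)"
    using u(1) K1\<Omega> K2\<Omega> by (auto intro: continuous_on_subset intro!: continuous_on_minus)
  have "uniformly_continuous_on (K1 \<union> K2) u"
    using u(1) K1\<Omega> K2\<Omega> K1(1) K2(1)
    by (intro compact_uniformly_continuous compact_Un) (auto intro: continuous_on_subset)
  then obtain \<rho> where \<rho>: "\<rho> > 0"
    "\<And>z z'. z \<in> K1 \<union> K2 \<Longrightarrow> z' \<in> K1 \<union> K2 \<Longrightarrow> dist z' z < \<rho> \<Longrightarrow> dist (u z') (u z) < m"
    using m unfolding uniformly_continuous_on_def by meson
  \<comment> \<open>The sup-convolution moves points by at most \<open>r\<close>: \<open>N\<close>
    is chosen so that a longer move costs more than the oscillation 2 K. As r \<le> \<rho>/4,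
    maximisers over the same centre are closer than \<rho>.\<close>
  define r where "r = min (1/64) (\<rho> / 4)"
  have r: "r > 0" "r \<le> 1/64" "r \<le> \<rho> / 4" using \<rho>(1) by (auto simp: r_def)
  define N where "N = 2 * K / r\<^sup>2"
  have N: "N > 0" "N * r\<^sup>2 = 2 * K" using K r(1) by (auto simp: N_def)
  \<comment> \<open>8192 = 2 * 64^2, so M d^2 \<le> 2 K forces d \<le> 1/64.\<close>
  define M where "M = 8192 * K"
  have M: "M > 0" using K by (simp add: M_def)
  define A1 where "A1 = supconv N K1 u"
  define A2 where "A2 = supconv N K2 (\<lambda>z. - u z)"
  have A1c: "continuous_on UNIV A1" unfolding A1_def by (rule continuous_supconv[OF K1(1) ne(1) u1 N(1)])
  have A2c: "continuous_on UNIV A2" unfolding A2_def by (rule continuous_supconv[OF K2(1) ne(2) u2 N(1)])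
  define \<Phi> where "\<Phi> = (\<lambda>w::'a \<times> 'a \<times> real. A1 (fst w, snd (snd w)) + A2 (fst (snd w), snd (snd w))
    - L * norm (fst w - fst (snd w)) powr \<beta>
    - M * ((norm (fst w - x0))\<^sup>2 + (norm (fst (snd w) - y0))\<^sup>2 + (snd (snd w) - t0)\<^sup>2))"
  \<comment> \<open>The times of \<open>W\<close> may exceed 0. The sup-convolutions are defined
    there, so the maximum point can be interior even for t0 = 0.\<close>
  define W where "W = cball x0 (1/16) \<times> cball y0 (1/16) \<times> {t0 - 1/16..t0 + 1/16}"
  have "compact W" unfolding W_def by (intro compact_Times) auto
  moreover have "W \<noteq> {}" unfolding W_def by auto
  moreover have "continuous_on W \<Phi>"
    unfolding \<Phi>_def using \<beta>
    by (intro continuous_intros continuous_on_compose2[OF A1c] continuous_on_compose2[OF A2c]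
        continuous_on_powr') auto
  ultimately obtain wh where wh: "wh \<in> W" "\<And>w. w \<in> W \<Longrightarrow> \<Phi> w \<le> \<Phi> wh"
    using continuous_attains_sup[of W \<Phi>] by auto
  obtain xh yh th where w: "wh = (xh, yh, th)" by (cases wh)
  have "A1 (x0, t0) \<ge> u (x0, t0)" "A2 (y0, t0) \<ge> - u (y0, t0)"
    using supconv_ge[OF K1(1) ne(1) u1 N(1) K1(2), of "(x0, t0)"]
      supconv_ge[OF K2(1) ne(2) u2 N(1) K2(2), of "(y0, t0)"] by (simp_all add: A1_def A2_def)
  then have "\<Phi> (x0, y0, t0) \<ge> m" by (simp add: \<Phi>_def m_def)
  moreover have "(x0, y0, t0) \<in> W" by (simp add: W_def)
  ultimately have \<Phi>m: "\<Phi> wh \<ge> m" using wh(2) by fastforce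
  \<comment> \<open>As \<open>m\<close> is positive and \<open>u\<close> oscillates by at most 2 K,
    this bounds every penalty term separately by 2 K.\<close>
  have key: "m + N * (dist (xh, th) z1)\<^sup>2 + N * (dist (yh, th) z2)\<^sup>2 + L * norm (xh - yh) powr \<beta>
      + M * ((norm (xh - x0))\<^sup>2 + (norm (yh - y0))\<^sup>2 + (th - t0)\<^sup>2) \<le> u z1 - u z2"
    if "u z1 - N * (dist (xh, th) z1)\<^sup>2 = A1 (xh, th)" "- u z2 - N * (dist (yh, th) z2)\<^sup>2 = A2 (yh, th)" for z1 z2
    using \<Phi>m that unfolding \<Phi>_def w by simp
  have nonneg: "0 \<le> N * (dist (xh, th) z1)\<^sup>2" "0 \<le> N * (dist (yh, th) z2)\<^sup>2"
    "0 \<le> L * norm (xh - yh) powr \<beta>" "0 \<le> M * (norm (xh - x0))\<^sup>2" "0 \<le> M * (norm (yh - y0))\<^sup>2"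
    "0 \<le> M * (th - t0)\<^sup>2" for z1 z2
    using N(1) L0 M by auto
  have dist_r: "d \<le> r" if "N * d\<^sup>2 \<le> 2 * K" for d
  proof -
    have "N * d\<^sup>2 \<le> N * r\<^sup>2" using that N(2) by simp
    then have "d\<^sup>2 \<le> r\<^sup>2" using N(1) by simp
    then show ?thesis using r(1) by (intro power2_le_imp_le[of d r]) auto
  qed
  have dist_64: "d \<le> 1/64" if "M * d\<^sup>2 \<le> 2 * K" for d
  proof -
    have "8192 * K * d\<^sup>2 \<le> 2 * K" using that by (simp add: M_def)
    then have "K * (8192 * d\<^sup>2) \<le> K * 2" by (simp add: mult_ac)
    then have "8192 * d\<^sup>2 \<le> 2" using K by (simp only: mult_le_cancel_left_pos)
    then have "d\<^sup>2 \<le> (1/64)\<^sup>2" by (simp add: power2_eq_square)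
    then show ?thesis by (intro power2_le_imp_le[of d]) auto
  qed
  obtain z1 where z1: "z1 \<in> K1" "A1 (xh, th) = u z1 - N * (dist (xh, th) z1)\<^sup>2"
    using supconv_attained[OF K1(1) ne(1) u1 N(1), of "(xh, th)"] unfolding A1_def by blast
  obtain z2 where z2: "z2 \<in> K2" "A2 (yh, th) = - u z2 - N * (dist (yh, th) z2)\<^sup>2"
    using supconv_attained[OF K2(1) ne(2) u2 N(1), of "(yh, th)"] unfolding A2_def by blast
  have osc: "u y - u y' \<le> 2 * K" if "y \<in> K1" "y' \<in> K2" for y y'
  proof -
    have "y \<in> \<Omega>" "y' \<in> \<Omega>" using that K1\<Omega> K2\<Omega> by auto
    from u(2)[OF this(1)] u(2)[OF this(2)] show ?thesis by linarith
  qed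
  have bounds: "dist (xh, th) y \<le> r \<and> dist (yh, th) y' \<le> r \<and> L * norm (xh - yh) powr \<beta> \<le> 2 * K \<and>
      norm (xh - x0) \<le> 1/64 \<and> norm (yh - y0) \<le> 1/64 \<and> \<bar>th - t0\<bar> \<le> 1/64 \<and> m \<le> u y - u y'"
    if "y \<in> K1" "y' \<in> K2" "u y - N * (dist (xh, th) y)\<^sup>2 = A1 (xh, th)"
      "- u y' - N * (dist (yh, th) y')\<^sup>2 = A2 (yh, th)" for y y'
  proof -
    note k = key[OF that(3,4)] and o = osc[OF that(1,2)] and n = nonneg(1)[of y] nonneg(2)[of y'] nonneg(3-6)
    have k': "m + N * (dist (xh, th) y)\<^sup>2 + N * (dist (yh, th) y')\<^sup>2 + L * norm (xh - yh) powr \<beta>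
      + M * (norm (xh - x0))\<^sup>2 + M * (norm (yh - y0))\<^sup>2 + M * (th - t0)\<^sup>2 \<le> u y - u y'"
      using k by (simp add: distrib_left)
    have "dist (xh, th) y \<le> r" by (rule dist_r) (use k' o n m in linarith)
    moreover have "dist (yh, th) y' \<le> r" by (rule dist_r) (use k' o n m in linarith)
    moreover have "L * norm (xh - yh) powr \<beta> \<le> 2 * K" using k' o n m by linarith
    moreover have "norm (xh - x0) \<le> 1/64" by (rule dist_64) (use k' o n m in linarith)
    moreover have "norm (yh - y0) \<le> 1/64" by (rule dist_64) (use k' o n m in linarith)
    moreover have "\<bar>th - t0\<bar> \<le> 1/64" by (rule dist_64) (use k' o n m in \<open>simp only: power2_abs; linarith\<close>)
    moreover have "m \<le> u y - u y'" using k' n by linarith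
    ultimately show ?thesis by blast
  qed
  note b = bounds[OF z1(1) z2(1) z1(2)[symmetric] z2(2)[symmetric]]
  \<comment> \<open>If the points coincided, the two maximisers would be closer than \<rho>, but the
    values of \<open>u\<close> there differ by at least \<open>m\<close>.\<close>
  have xy_ne: "xh \<noteq> yh"
  proof
    assume eq: "xh = yh"
    have "dist z1 z2 \<le> dist (xh, th) z1 + dist (yh, th) z2"
      using dist_triangle[of z1 z2 "(xh, th)"] by (simp add: eq dist_commute)
    also have "\<dots> < \<rho>" using b r(3) \<rho>(1) by linarith
    finally have "dist (u z1) (u z2) < m" using \<rho>(2)[of z2 z1] z1(1) z2(1) by auto
    then show False using b unfolding dist_real_def by linarith
  qed
  define e where "e = xh - yh"
  define s where "s = norm e"
  have s0: "s > 0" using xy_ne by (simp add: s_def e_def)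
  define \<sigma> where "\<sigma> = s powr \<beta>"
  have s1: "s \<le> 1"
  proof (rule ccontr)
    assume "\<not> s \<le> 1"
    then have "s powr \<beta> > 1" using \<beta> by simp
    then have "L * s powr \<beta> > L" using L0 by simp
    then show False using b L(1) by (simp add: s_def e_def)
  qed
  have \<sigma>: "s \<le> \<sigma>" "\<sigma> \<le> 1" "\<sigma> > 0"
    using powr_mono'[of \<beta> 1 s] powr_le_one_le[of s \<beta>] s0 s1 \<beta> powr_mono2[of \<beta> s 1] by (auto simp: \<sigma>_def)
  define \<eta> where "\<eta> = e /\<^sub>R s"
  have \<eta>: "norm \<eta> = 1" "e = s *\<^sub>R \<eta>" using s0 by (auto simp: \<eta>_def s_def)
  \<comment> \<open>Norm of the gradient of L |x - y|^\<beta>; it is at least L \<beta> because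
    s^\<beta> \<ge> s.\<close>
  define \<Lambda> where "\<Lambda> = L * \<beta> * \<sigma> / s"
  have "L * \<beta> > 0" using L0 \<beta> by simp
  moreover have "1 \<le> \<sigma> / s" using s0 \<sigma> by simp
  from mult_left_mono[OF this less_imp_le[OF calculation]]
  have "\<Lambda> \<ge> L * \<beta>" by (simp add: \<Lambda>_def)
  ultimately have \<Lambda>: "\<Lambda> \<ge> L * \<beta>" "\<Lambda> > 0" by simp_all
  \<comment> \<open>Gradients of the localisation relative to \<Lambda>. The sign in
    \<open>a'\<close> is such that the two full gradients are \<Lambda> (\<eta> + a) and -\<Lambda>
    (\<eta> + a').\<close>
  define a where "a = (2 * M / \<Lambda>) *\<^sub>R (xh - x0)"
  define a' where "a' = (2 * M / \<Lambda>) *\<^sub>R (y0 - yh)"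
  have small: "norm ((2 * M / \<Lambda>) *\<^sub>R v) \<le> \<delta>" if "norm v \<le> 1/64" for v :: 'a
  proof -
    have "\<delta> * (L * \<beta>) \<le> \<delta> * \<Lambda>" using \<Lambda>(1) \<delta>(1) by (intro mult_left_mono) auto
    then have "2 * M \<le> \<delta> * \<Lambda>" using L(2) unfolding M_def by linarith
    then have "2 * M / \<Lambda> \<le> \<delta>" using \<Lambda>(2) by (simp add: divide_le_eq)
    then have "2 * M / \<Lambda> * norm v \<le> \<delta> * 1" using that M \<Lambda>(2) \<delta>(1) by (intro mult_mono) auto
    then show ?thesis using M \<Lambda>(2) by simp
  qed
  have a: "norm a \<le> \<delta>" "norm a' \<le> \<delta>"
    unfolding a_def a'_def using b norm_minus_commute[of yh y0] by (intro small; simp)+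
  define \<xi>1 where "\<xi>1 = \<Lambda> *\<^sub>R (\<eta> + a)"
  define \<xi>2 where "\<xi>2 = - (\<Lambda> *\<^sub>R (\<eta> + a'))"
  have \<Lambda>\<eta>: "(L * \<beta> * norm (xh - yh) powr \<beta> / (norm (xh - yh))\<^sup>2) *\<^sub>R (xh - yh) = \<Lambda> *\<^sub>R \<eta>"
  proof -
    have "\<Lambda> * inverse s = L * \<beta> * \<sigma> / s\<^sup>2"
      by (simp add: \<Lambda>_def power2_eq_square divide_inverse)
    then show ?thesis
      unfolding e_def[symmetric] s_def[symmetric] \<sigma>_def[symmetric] \<eta>_def by (simp only: scaleR_scaleR)
  qed
  have \<xi>1_eq: "\<xi>1 = (L * \<beta> * norm (xh - yh) powr \<beta> / (norm (xh - yh))\<^sup>2) *\<^sub>R (xh - yh) + (2 * M) *\<^sub>R (xh - x0)"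
    unfolding \<Lambda>\<eta> \<xi>1_def a_def using \<Lambda>(2) by (simp add: scaleR_right_distrib)
  have \<xi>2_eq: "\<xi>2 = (L * \<beta> * norm (yh - xh) powr \<beta> / (norm (yh - xh))\<^sup>2) *\<^sub>R (yh - xh) + (2 * M) *\<^sub>R (yh - y0)"
  proof -
    have "(L * \<beta> * norm (yh - xh) powr \<beta> / (norm (yh - xh))\<^sup>2) *\<^sub>R (yh - xh) = - (\<Lambda> *\<^sub>R \<eta>)"
      unfolding \<Lambda>\<eta>[symmetric] norm_minus_commute[of yh xh] by (simp flip: scaleR_minus_right)
    moreover have "\<Lambda> *\<^sub>R a' = - ((2 * M) *\<^sub>R (yh - y0))"
      unfolding a'_def using \<Lambda>(2) by (simp flip: scaleR_minus_right)
    ultimately show ?thesis unfolding \<xi>2_def scaleR_right_distrib by simp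
  qed
  have \<xi>_ne: "\<xi>1 \<noteq> 0" "\<xi>2 \<noteq> 0"
  proof -
    have "norm (\<eta> + a) > 0" "norm (\<eta> + a') > 0"
      using norm_diff_ineq[of \<eta> a] norm_diff_ineq[of \<eta> a'] \<eta>(1) a \<delta>(2) by linarith+
    then show "\<xi>1 \<noteq> 0" "\<xi>2 \<noteq> 0" using \<Lambda>(2) by (simp_all add: \<xi>1_def \<xi>2_def)
  qed
  have W_nhds: "\<forall>\<^sub>F x in nhds xh. x \<in> cball x0 (1/16)" "\<forall>\<^sub>F y in nhds yh. y \<in> cball y0 (1/16)"
  proof -
    have "xh \<in> ball x0 (1/16)" "yh \<in> ball y0 (1/16)"
      using b norm_minus_commute[of x0 xh] norm_minus_commute[of y0 yh]
      unfolding mem_ball dist_norm by linarith+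
    from eventually_nhds_in_open[OF open_ball this(1)] eventually_nhds_in_open[OF open_ball this(2)]
    show "\<forall>\<^sub>F x in nhds xh. x \<in> cball x0 (1/16)" "\<forall>\<^sub>F y in nhds yh. y \<in> cball y0 (1/16)"
      by (auto elim!: eventually_mono)
  qed
  have yhW: "yh \<in> cball y0 (1/16)" and xhW: "xh \<in> cball x0 (1/16)" and thW: "th \<in> {t0 - 1/16..t0 + 1/16}"
    using wh(1) by (auto simp: w W_def)
  have dist_sq: "(dist (x, t) z)\<^sup>2 = (norm (x - fst z))\<^sup>2 + (t - snd z)\<^sup>2" for x :: 'a and t z
    by (cases z) (simp add: dist_norm norm_Pair)
  have interior: "y \<in> ball x (1/16) \<times> {t0 - 1/16<..}"
    if "dist (xx, th) y \<le> r" "norm (xx - x) \<le> 1/64" for x xx :: 'a and y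
  proof -
    have d: "dist xx (fst y) \<le> 1/64" "dist th (snd y) \<le> 1/64"
      using dist_fst_le[of "(xx, th)" y] dist_snd_le[of "(xx, th)" y] that(1) r(2) unfolding fst_conv snd_conv by linarith+
    have "dist x (fst y) \<le> dist xx x + dist xx (fst y)" using dist_triangle3[of x "fst y" xx] .
    moreover have "dist xx x \<le> 1/64" using that(2) by (simp only: dist_norm)
    ultimately have "dist x (fst y) < 1/16" using d(1) by linarith
    moreover have "snd y > t0 - 1/16" using d(2) b unfolding dist_real_def by linarith
    ultimately show ?thesis by (cases y) auto
  qed
  \<comment> \<open>Uniqueness of the gradient concerns every maximiser, not only \<open>z1\<close>;
    the other sup-convolution keeps its maximiser \<open>z2\<close>.\<close>
  have arg1: "y \<in> ball x0 (1/16) \<times> {t0 - 1/16<..} \<and> (2 * N) *\<^sub>R (fst y - xh) = \<xi>1"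
    if y: "y \<in> K1" "u y - N * (dist (xh, th) y)\<^sup>2 = supconv N K1 u (xh, th)" for y
  proof
    have yA: "u y - N * (dist (xh, th) y)\<^sup>2 = A1 (xh, th)" using y(2) by (simp add: A1_def)
    note b' = bounds[OF y(1) z2(1) yA z2(2)[symmetric]]
    show "y \<in> ball x0 (1/16) \<times> {t0 - 1/16<..}" by (rule interior[where xx=xh]) (use b' in auto)
    have "\<forall>\<^sub>F x in nhds xh. N * (norm (xh - fst y))\<^sup>2 + L * norm (xh - yh) powr \<beta> + M * (norm (xh - x0))\<^sup>2
      \<le> N * (norm (x - fst y))\<^sup>2 + L * norm (x - yh) powr \<beta> + M * (norm (x - x0))\<^sup>2"
      using W_nhds(1)
    proof eventually_elim
      case (elim x)
      then have "(x, yh, th) \<in> W" using yhW thW by (simp add: W_def)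
      from wh(2)[OF this] have "A1 (x, th) - L * norm (x - yh) powr \<beta> - M * (norm (x - x0))\<^sup>2
          \<le> A1 (xh, th) - L * norm (xh - yh) powr \<beta> - M * (norm (xh - x0))\<^sup>2"
        unfolding \<Phi>_def w by (simp add: distrib_left)
      moreover have "u y - N * (dist (x, th) y)\<^sup>2 \<le> A1 (x, th)"
        unfolding A1_def by (rule supconv_ge[OF K1(1) ne(1) u1 N(1) y(1)])
      ultimately show ?case using yA unfolding dist_sq distrib_left by linarith
    qed
    from gradient_at_maximiser[OF xy_ne this] show "(2 * N) *\<^sub>R (fst y - xh) = \<xi>1" unfolding \<xi>1_eq .
  qed
  have arg2: "y \<in> ball y0 (1/16) \<times> {t0 - 1/16<..} \<and> (2 * N) *\<^sub>R (fst y - yh) = \<xi>2"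
    if y: "y \<in> K2" "- u y - N * (dist (yh, th) y)\<^sup>2 = supconv N K2 (\<lambda>z. - u z) (yh, th)" for y
  proof
    have yA: "- u y - N * (dist (yh, th) y)\<^sup>2 = A2 (yh, th)" using y(2) by (simp add: A2_def)
    note b' = bounds[OF z1(1) y(1) z1(2)[symmetric] yA]
    show "y \<in> ball y0 (1/16) \<times> {t0 - 1/16<..}" by (rule interior[where xx=yh]) (use b' in auto)
    have "\<forall>\<^sub>F x in nhds yh. N * (norm (yh - fst y))\<^sup>2 + L * norm (yh - xh) powr \<beta> + M * (norm (yh - y0))\<^sup>2
      \<le> N * (norm (x - fst y))\<^sup>2 + L * norm (x - xh) powr \<beta> + M * (norm (x - y0))\<^sup>2"
      using W_nhds(2)
    proof eventually_elim
      case (elim x)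
      then have "(xh, x, th) \<in> W" using xhW thW by (simp add: W_def)
      from wh(2)[OF this] have "A2 (x, th) - L * norm (x - xh) powr \<beta> - M * (norm (x - y0))\<^sup>2
          \<le> A2 (yh, th) - L * norm (yh - xh) powr \<beta> - M * (norm (yh - y0))\<^sup>2"
        unfolding \<Phi>_def w by (simp add: distrib_left norm_minus_commute)
      moreover have "- u y - N * (dist (x, th) y)\<^sup>2 \<le> A2 (x, th)"
        unfolding A2_def by (rule supconv_ge[OF K2(1) ne(2) u2 N(1) y(1)])
      ultimately show ?case using yA unfolding dist_sq distrib_left by linarith
    qed
    from gradient_at_maximiser[OF xy_ne[symmetric] this] show "(2 * N) *\<^sub>R (fst y - yh) = \<xi>2" unfolding \<xi>2_eq .
  qed
  have open_G: "open (ball x (1/16) \<times> {t0 - 1/16<..})" for x :: 'a by (intro open_Times) auto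
  have G1: "ball x0 (1/16) \<times> {t0 - 1/16<..} \<inter> \<Omega> \<subseteq> K1" and G2: "ball y0 (1/16) \<times> {t0 - 1/16<..} \<inter> \<Omega> \<subseteq> K2"
    unfolding K1_def K2_def I_def \<Omega>_def by auto
  define S1 where "S1 = diff_root \<gamma> p \<xi>1 0"
  \<comment> \<open>Only the second root is composed with the reflection; without it S1 - S2 would
    be small compared with the roots and the concavity would be lost.\<close>
  define S2 where "S2 = diff_root \<gamma> p \<xi>2 \<eta>"
  have lin: "linear S1" "linear S2" unfolding S1_def S2_def by (rule linear_diff_root)+
  have S_zero: "S1 0 = 0" "S2 0 = 0" using lin by (simp_all add: linear_0)
  define U1 where "U1 = (\<lambda>\<zeta>. A1 (xh + S1 (fst \<zeta>), snd \<zeta>))"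
  define U2 where "U2 = (\<lambda>\<zeta>. A2 (yh + S2 (fst \<zeta>), snd \<zeta>))"
  have Sc: "continuous_on UNIV S1" "continuous_on UNIV S2"
    using lin by (auto simp: linear_conv_bounded_linear intro: linear_continuous_on)
  have U1c: "continuous_on UNIV U1" unfolding U1_def
    by (intro continuous_on_compose2[OF A1c] continuous_on_compose2[OF Sc(1)] continuous_intros) auto
  have U2c: "continuous_on UNIV U2" unfolding U2_def
    by (intro continuous_on_compose2[OF A2c] continuous_on_compose2[OF Sc(2)] continuous_intros) auto
  define \<kappa> where "\<kappa> = (1 - \<beta>) * (p - 1)"
  have \<kappa>: "\<kappa> > 0" using \<beta> p by (simp add: \<kappa>_def)
  \<comment> \<open>A quarter of the slack in the last condition on \<open>L\<close>. Freezing costs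
    \<open>err\<close> twice, so half of the slack remains.\<close>
  define err where "err = (\<kappa> * (L * \<beta>) powr (1 + \<gamma>) - 2 * F - 256 * K) / 4"
  have err: "err > 0" using L(4) by (simp add: err_def \<kappa>_def)
  have sub1: "\<forall>\<^sub>F \<zeta> in nhds (0, th). \<forall>\<psi>. real_polynomial_function \<psi> \<longrightarrow>
      (\<forall>\<^sub>F \<zeta>' in nhds \<zeta>. U1 \<zeta>' - \<psi> \<zeta>' \<le> U1 \<zeta> - \<psi> \<zeta>) \<longrightarrow> heat \<psi> \<zeta> \<le> F + err"
    unfolding U1_def S1_def A1_def
    by (rule frozen_subsolution[OF p sub(1) K1(1) ne(1) K1\<Omega> u1 N(1) \<xi>_ne(1) _ open_G G1 arg1 err]) auto
  have sub2: "\<forall>\<^sub>F \<zeta> in nhds (0, th). \<forall>\<psi>. real_polynomial_function \<psi> \<longrightarrow>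
      (\<forall>\<^sub>F \<zeta>' in nhds \<zeta>. U2 \<zeta>' - \<psi> \<zeta>' \<le> U2 \<zeta> - \<psi> \<zeta>) \<longrightarrow> heat \<psi> \<zeta> \<le> F + err"
    unfolding U2_def S2_def A2_def
    by (rule frozen_subsolution[OF p sub(2) K2(1) ne(2) K2\<Omega> u2 N(1) \<xi>_ne(2) _ open_G G2 arg2 err]) (use \<eta>(1) in auto)
  \<comment> \<open>So small that relaxing the Taylor bound costs at most one of the three units
    \<kappa> in the first coupling bound.\<close>
  define \<epsilon> where "\<epsilon> = \<beta> * \<kappa> / (8 * (C + 1))"
  have \<epsilon>: "\<epsilon> > 0" using \<beta> \<kappa> C by (simp add: \<epsilon>_def)
  have "\<epsilon> * (8 * (C + 1)) = \<beta> * \<kappa>" using C by (simp add: \<epsilon>_def)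
  then have \<epsilon>C: "8 * \<epsilon> * C \<le> \<beta> * \<kappa>" using \<epsilon> by (simp add: algebra_simps)
  define \<alpha> where "\<alpha> = \<beta> / 2"
  define k where "k = \<alpha> * (1 - \<alpha>) / 2 - \<epsilon>"
  obtain q where q: "0 < q" "q < 1" "\<And>y. \<bar>y\<bar> < q \<Longrightarrow> (1 + y) powr \<alpha> \<le> 1 + \<alpha> * y - k * y\<^sup>2"
    using powr_quadratic_upper[OF \<epsilon>, of \<alpha>] unfolding k_def by metis
  define Y where "Y = (\<lambda>w. (2 * (e \<bullet> (S1 w - S2 w)) + (norm (S1 w - S2 w))\<^sup>2) / s\<^sup>2)"
  define \<theta> where "\<theta> = (\<lambda>\<zeta>. L * \<sigma> * (1 + \<alpha> * Y (fst \<zeta>) - k * (Y (fst \<zeta>))\<^sup>2)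
      + M * ((norm ((xh - x0) + S1 (fst \<zeta>)))\<^sup>2 + (norm ((yh - y0) + S2 (fst \<zeta>)))\<^sup>2 + (snd \<zeta> - t0)\<^sup>2))"
  have test: "real_polynomial_function \<theta>"
    unfolding \<theta>_def Y_def by (rule coupled_test_function(1)[OF lin])
  have heat_\<theta>: "heat \<theta> (0, th) = 2 * M * (th - t0) - (\<Sum>i\<in>Basis.
        2 * (L * \<sigma> * (\<alpha> * ((norm (S1 i - S2 i))\<^sup>2 / s\<^sup>2) - k * (2 * (e \<bullet> (S1 i - S2 i)) / s\<^sup>2)\<^sup>2))
        + 2 * M * ((norm (S1 i))\<^sup>2 + (norm (S2 i))\<^sup>2))"
    unfolding \<theta>_def Y_def by (rule coupled_test_function(2)[OF lin])
  have touch: "\<forall>\<^sub>F \<zeta> in nhds (0, th). U1 \<zeta> + U2 \<zeta> - \<theta> \<zeta> \<le> U1 (0, th) + U2 (0, th) - \<theta> (0, th)"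
  proof -
    have "\<forall>\<^sub>F \<zeta> in nhds (0, th). xh + S1 (fst \<zeta>) \<in> cball x0 (1/16)"
    proof (rule eventually_compose_filterlim[OF W_nhds(1)])
      show "filterlim (\<lambda>\<zeta>. xh + S1 (fst \<zeta>)) (nhds xh) (nhds (0, th))"
        using tendsto_add[OF tendsto_const tendsto_fst_fun[OF Sc(1), of 0 th], of xh] by (simp add: S_zero)
    qed
    moreover have "\<forall>\<^sub>F \<zeta> in nhds (0, th). yh + S2 (fst \<zeta>) \<in> cball y0 (1/16)"
    proof (rule eventually_compose_filterlim[OF W_nhds(2)])
      show "filterlim (\<lambda>\<zeta>. yh + S2 (fst \<zeta>)) (nhds yh) (nhds (0, th))"
        using tendsto_add[OF tendsto_const tendsto_fst_fun[OF Sc(2), of 0 th], of yh] by (simp add: S_zero)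
    qed
    moreover have "\<forall>\<^sub>F \<zeta> in nhds (0::'a, th). snd \<zeta> \<in> {t0 - 1/16..t0 + 1/16}"
    proof -
      have "t0 - 1/16 < th" "th < t0 + 1/16" using b by linarith+
      then have "th \<in> {t0 - 1/16<..<t0 + 1/16}" by simp
      from eventually_nhds_in_open[OF open_greaterThanLessThan this]
      have "\<forall>\<^sub>F t in nhds th. t \<in> {t0 - 1/16..t0 + 1/16}" by (auto elim!: eventually_mono)
      moreover have "filterlim snd (nhds th) (nhds (0::'a, th))"
        using tendsto_snd[OF filterlim_ident, of "(0::'a, th)"] by simp
      ultimately show ?thesis by (rule eventually_compose_filterlim)
    qed
    moreover have "\<forall>\<^sub>F \<zeta> in nhds (0::'a, th). \<bar>Y (fst \<zeta>)\<bar> < q"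
    proof (rule order_tendstoD(2))
      have "continuous_on UNIV Y" unfolding Y_def using s0 by (intro continuous_intros Sc) auto
      from tendsto_rabs[OF tendsto_fst_fun[OF this]] show "((\<lambda>\<zeta>. \<bar>Y (fst \<zeta>)\<bar>) \<longlongrightarrow> \<bar>Y 0\<bar>) (nhds (0::'a, th))" .
      show "\<bar>Y 0\<bar> < q" using q(1) by (simp add: Y_def S_zero)
    qed
    ultimately show ?thesis
    proof eventually_elim
      case (elim \<zeta>)
      let ?x = "xh + S1 (fst \<zeta>)" and ?y = "yh + S2 (fst \<zeta>)"
      have "(?x, ?y, snd \<zeta>) \<in> W" using elim by (simp add: W_def)
      from wh(2)[OF this] have le: "U1 \<zeta> + U2 \<zeta> - L * norm (?x - ?y) powr \<beta>
          - M * ((norm (?x - x0))\<^sup>2 + (norm (?y - y0))\<^sup>2 + (snd \<zeta> - t0)\<^sup>2) \<le> \<Phi> wh"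
        unfolding \<Phi>_def U1_def U2_def by simp
      define d where "d = S1 (fst \<zeta>) - S2 (fst \<zeta>)"
      have xy: "?x - ?y = e + d" and x: "?x - x0 = (xh - x0) + S1 (fst \<zeta>)"
        and y: "?y - y0 = (yh - y0) + S2 (fst \<zeta>)" by (simp_all add: e_def d_def)
      have "s\<^sup>2 * Y (fst \<zeta>) = 2 * (e \<bullet> d) + (norm d)\<^sup>2" using s0 by (simp add: Y_def d_def)
      moreover have "(norm (e + d))\<^sup>2 = s\<^sup>2 + 2 * (e \<bullet> d) + (norm d)\<^sup>2"
        unfolding s_def power2_norm_eq_inner by (simp add: inner_add_left inner_add_right inner_commute)
      ultimately have nsq: "(norm (?x - ?y))\<^sup>2 = s\<^sup>2 * (1 + Y (fst \<zeta>))"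
        unfolding xy by (simp add: distrib_left)
      \<comment> \<open>Writing |x - y|^\<beta> as the power \<beta>/2 of the square makes the
        relative increment \<open>Y\<close> a polynomial in the displacement.\<close>
      have "norm (?x - ?y) powr \<beta> = ((norm (?x - ?y))\<^sup>2) powr \<alpha>"
        unfolding \<alpha>_def by (simp only: square_powr_half norm_ge_zero)
      also have "\<dots> = (s\<^sup>2) powr \<alpha> * (1 + Y (fst \<zeta>)) powr \<alpha>"
        unfolding nsq by (rule powr_mult)
      also have "(s\<^sup>2) powr \<alpha> = \<sigma>"
        unfolding \<alpha>_def \<sigma>_def by (rule square_powr_half[OF less_imp_le[OF s0]])
      also have "\<sigma> * (1 + Y (fst \<zeta>)) powr \<alpha> \<le> \<sigma> * (1 + \<alpha> * Y (fst \<zeta>) - k * (Y (fst \<zeta>))\<^sup>2)"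
        using q(3)[OF elim(4)] \<sigma>(3) by (intro mult_left_mono) auto
      finally have "L * norm (?x - ?y) powr \<beta> \<le> L * (\<sigma> * (1 + \<alpha> * Y (fst \<zeta>) - k * (Y (fst \<zeta>))\<^sup>2))"
        using L0 by (intro mult_left_mono) auto
      then have "U1 \<zeta> + U2 \<zeta> - \<theta> \<zeta> \<le> \<Phi> wh"
        using le unfolding \<theta>_def x y mult.assoc by linarith
      also have "\<Phi> wh = U1 (0, th) + U2 (0, th) - \<theta> (0, th)"
        unfolding \<Phi>_def w \<theta>_def U1_def U2_def by (simp add: S_zero Y_def \<sigma>_def s_def e_def)
      finally show ?case .
    qed
  qed
  have heat_le: "heat \<theta> (0, th) \<le> (F + err) + (F + err)"
    by (rule heat_subsolution_sum[OF U1c U2c sub1 sub2 test touch])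
  define R1 where "R1 = diff_root \<gamma> p (\<eta> + a) 0"
  define R2 where "R2 = diff_root \<gamma> p (\<eta> + a') \<eta>"
  define g where "g = \<Lambda> powr (\<gamma> / 2)"
  have g: "g\<^sup>2 = \<Lambda> powr \<gamma>" by (simp add: g_def power2_eq_square powr_add[symmetric])
  \<comment> \<open>Both gradients have scale \<Lambda> and the roots are even in the gradient, so a
    common factor comes out.\<close>
  have S_R: "S1 v = g *\<^sub>R R1 v" "S2 v = g *\<^sub>R R2 v" for v
    unfolding S1_def S2_def \<xi>1_def \<xi>2_def diff_root_minus diff_root_scale[OF \<Lambda>(2)] g_def R1_def R2_def by simp_all
  define A where "A = (\<Sum>i\<in>Basis. (norm (R1 i - R2 i))\<^sup>2)"
  define B where "B = (\<Sum>i\<in>Basis. (\<eta> \<bullet> (R1 i - R2 i))\<^sup>2)"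
  define D where "D = (\<Sum>i\<in>Basis. (norm (R1 i))\<^sup>2 + (norm (R2 i))\<^sup>2)"
  have ABD: "A - (2 - \<beta>) * B \<le> - 3 * \<kappa>" "0 \<le> B" "B \<le> C" "D \<le> C"
    using coupling[unfolded coupling_bound_def, rule_format, OF \<eta>(1) a] unfolding A_def B_def D_def R1_def R2_def \<kappa>_def by (auto intro!: sum_nonneg)
  have "heat \<theta> (0, th) = 2 * M * (th - t0) - (2 * (L * \<sigma>) * (\<beta> / 2 * (\<Lambda> powr \<gamma> * A / s\<^sup>2)
      - (\<beta> / 2 * (1 - \<beta> / 2) / 2 - \<epsilon>) * (4 * (\<Lambda> powr \<gamma> * B) / s\<^sup>2)) + 2 * M * (\<Lambda> powr \<gamma> * D))"
  proof -
    have expand: "2 * (c * (a * (l * n1 * x) - b * (4 * l * x * n2))) + 2 * M * (l * n3)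
        = 2 * c * a * l * x * n1 - 2 * c * b * 4 * l * x * n2 + 2 * M * l * n3" for a b c l n1 n2 n3 x
      by algebra
    have summand: "2 * (L * \<sigma> * (\<alpha> * ((norm (S1 i - S2 i))\<^sup>2 / s\<^sup>2) - k * (2 * (e \<bullet> (S1 i - S2 i)) / s\<^sup>2)\<^sup>2))
        + 2 * M * ((norm (S1 i))\<^sup>2 + (norm (S2 i))\<^sup>2)
      = 2 * (L * \<sigma>) * \<alpha> * (\<Lambda> powr \<gamma>) / s\<^sup>2 * (norm (R1 i - R2 i))\<^sup>2
        - 2 * (L * \<sigma>) * k * 4 * (\<Lambda> powr \<gamma>) / s\<^sup>2 * (\<eta> \<bullet> (R1 i - R2 i))\<^sup>2
        + 2 * M * (\<Lambda> powr \<gamma>) * ((norm (R1 i))\<^sup>2 + (norm (R2 i))\<^sup>2)" for i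
    proof -
      have d: "S1 i - S2 i = g *\<^sub>R (R1 i - R2 i)" by (simp add: S_R scaleR_right_diff_distrib)
      have "(norm (S1 i - S2 i))\<^sup>2 = \<Lambda> powr \<gamma> * (norm (R1 i - R2 i))\<^sup>2"
        unfolding d by (simp add: power_mult_distrib g)
      moreover have "(2 * (e \<bullet> (S1 i - S2 i)) / s\<^sup>2)\<^sup>2 = 4 * (\<Lambda> powr \<gamma>) / s\<^sup>2 * (\<eta> \<bullet> (R1 i - R2 i))\<^sup>2"
      proof -
        have "2 * (e \<bullet> (S1 i - S2 i)) / s\<^sup>2 = 2 * g * (\<eta> \<bullet> (R1 i - R2 i)) / s"
          unfolding d \<eta>(2) using s0 by (simp add: power2_eq_square)
        then show ?thesis by (simp add: power_mult_distrib power_divide g)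
      qed
      moreover have "(norm (S1 i))\<^sup>2 + (norm (S2 i))\<^sup>2 = \<Lambda> powr \<gamma> * ((norm (R1 i))\<^sup>2 + (norm (R2 i))\<^sup>2)"
        by (simp add: S_R power_mult_distrib g distrib_left)
      ultimately show ?thesis
        unfolding divide_inverse by (simp only: expand)
    qed
    have "(\<Sum>i\<in>Basis. 2 * (L * \<sigma> * (\<alpha> * ((norm (S1 i - S2 i))\<^sup>2 / s\<^sup>2) - k * (2 * (e \<bullet> (S1 i - S2 i)) / s\<^sup>2)\<^sup>2))
        + 2 * M * ((norm (S1 i))\<^sup>2 + (norm (S2 i))\<^sup>2))
      = 2 * (L * \<sigma>) * \<alpha> * (\<Lambda> powr \<gamma>) / s\<^sup>2 * A - 2 * (L * \<sigma>) * k * 4 * (\<Lambda> powr \<gamma>) / s\<^sup>2 * B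
        + 2 * M * (\<Lambda> powr \<gamma>) * D"
      unfolding summand A_def B_def D_def sum_distrib_left
      by (simp only: sum.distrib sum_subtractf distrib_left)
    also have "\<dots> = 2 * (L * \<sigma>) * (\<alpha> * (\<Lambda> powr \<gamma> * A / s\<^sup>2) - k * (4 * (\<Lambda> powr \<gamma> * B) / s\<^sup>2))
        + 2 * M * (\<Lambda> powr \<gamma> * D)"
      unfolding divide_inverse by algebra
    finally show ?thesis unfolding heat_\<theta> by (simp only: k_def \<alpha>_def)
  qed
  moreover have "\<kappa> * (L * \<beta>) powr (1 + \<gamma>) - M / 32 \<le> 2 * M * (th - t0) -
      (2 * (L * \<sigma>) * (\<beta> / 2 * (\<Lambda> powr \<gamma> * A / s\<^sup>2)
        - (\<beta> / 2 * (1 - \<beta> / 2) / 2 - \<epsilon>) * (4 * (\<Lambda> powr \<gamma> * B) / s\<^sup>2)) + 2 * M * (\<Lambda> powr \<gamma> * D))"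
  proof (rule coupled_heat_lower_bound[OF \<beta> \<gamma> \<kappa> C s0 \<sigma>(1,2) L0 _ \<Lambda>_def ABD])
    show "2 * M * C \<le> \<kappa> * (L * \<beta>)" using L(3) by (simp add: M_def \<kappa>_def)
  qed (use M \<epsilon> \<epsilon>C b in auto)
  ultimately have "\<kappa> * (L * \<beta>) powr (1 + \<gamma>) - M / 32 \<le> (F + err) + (F + err)"
    using heat_le by linarith
  moreover have "M / 32 = 256 * K" by (simp add: M_def)
  moreover have "4 * err = \<kappa> * (L * \<beta>) powr (1 + \<gamma>) - 2 * F - 256 * K" by (simp add: err_def)
  ultimately show False using err by linarith
qed

section \<open>Choice of the constant and the final estimate\<close>

lemma constant_dominates:
  fixes \<gamma> \<kappa> K F X :: real
  assumes \<gamma>: "-1 < \<gamma>" and \<kappa>: "\<kappa> > 0" and K: "K > 0" and F: "F \<ge> 0"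
    and X: "(2000 / \<kappa>) powr (1 / (1 + \<gamma>)) * (K powr (1 / (1 + \<gamma>)) + F powr (1 / (1 + \<gamma>))) \<le> X"
  shows "2 * F + 256 * K < \<kappa> * X powr (1 + \<gamma>)"
proof -
  define q where "q = 1 / (1 + \<gamma>)"
  have q: "q * (1 + \<gamma>) = 1" using \<gamma> by (simp add: q_def)
  \<comment> \<open>m^q \<le> K^q + F^q for the maximum; raising the hypothesis to the power 1 +
    \<gamma> then gives \<kappa> X^(1+\<gamma>) \<ge> 2000 m, and 2000 exceeds 2 + 256.\<close>
  define m where "m = max K F"
  have m: "m > 0" "K \<le> m" "F \<le> m" using K by (auto simp: m_def)
  have "m powr q \<le> K powr q + F powr q" by (cases "K \<le> F") (simp_all add: m_def max_def)
  then have "(2000 / \<kappa>) powr q * m powr q \<le> (2000 / \<kappa>) powr q * (K powr q + F powr q)"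
    by (intro mult_left_mono) auto
  also have "\<dots> \<le> X" using X by (simp only: q_def)
  finally have "((2000 / \<kappa>) powr q * m powr q) powr (1 + \<gamma>) \<le> X powr (1 + \<gamma>)"
    using \<gamma> by (intro powr_mono2) auto
  also have "((2000 / \<kappa>) powr q * m powr q) powr (1 + \<gamma>) = 2000 / \<kappa> * m"
    using \<kappa> m(1) by (simp add: powr_mult powr_powr q)
  finally have "\<kappa> * (2000 / \<kappa> * m) \<le> \<kappa> * X powr (1 + \<gamma>)"
    using \<kappa> by (intro mult_left_mono) auto
  then have "2000 * m \<le> \<kappa> * X powr (1 + \<gamma>)" using \<kappa> by simp
  then show ?thesis using m by linarith
qed

theorem lemma6p1:
  fixes \<gamma> p \<beta> :: real
  assumes "-1 < \<gamma>" and "1 < p" and "0 < \<beta>" and "\<beta> < 1"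
  shows "\<exists>C>0. \<forall>(f :: (real^'n) \<times> real \<Rightarrow> real) u.
           continuous_on (Q 1) f \<longrightarrow> in_Linf (Q 1) f \<longrightarrow>
           bounded (u ` Q 1) \<longrightarrow> viscosity_solution \<gamma> p f u \<longrightarrow>
           (\<forall>x\<in>ball 0 (15/16). \<forall>y\<in>ball 0 (15/16). \<forall>t\<in>{-((15/16)^2) <.. 0}.
              \<bar>u (x, t) - u (y, t)\<bar>
                \<le> C * (Linf_norm (Q 1) u + Linf_norm (Q 1) u powr (1 / (1 + \<gamma>))
                        + Linf_norm (Q 1) f powr (1 / (1 + \<gamma>))) * norm (x - y) powr \<beta>)"
proof -
  obtain \<delta> C where \<delta>: "0 < \<delta>" "\<delta> < 1" and C: "0 \<le> C" and
    coupling: "coupling_bound TYPE(real^'n) \<gamma> p \<beta> \<delta> C"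
    by (rule coupling_bound_exists[OF assms(2-4)])
  define \<kappa> where "\<kappa> = (1 - \<beta>) * (p - 1)"
  have \<kappa>: "\<kappa> > 0" using assms by (simp add: \<kappa>_def)
  define q where "q = 1 / (1 + \<gamma>)"
  \<comment> \<open>\<open>E1\<close>, \<open>E2\<close> and \<open>E3\<close> solve the last three
    conditions on \<open>L\<close>; the summand 2 in \<open>E\<close> covers L \<ge> 2 K.\<close>
  define E1 where "E1 = 16384 / (\<delta> * \<beta>)"
  define E2 where "E2 = 16384 * C / (\<kappa> * \<beta>)"
  define E3 where "E3 = (2000 / \<kappa>) powr q / \<beta>"
  have E: "E1 \<ge> 0" "E2 \<ge> 0" "E3 \<ge> 0" "E1 * (\<delta> * \<beta>) = 16384" "E2 * (\<kappa> * \<beta>) = 16384 * C"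
    "E3 * \<beta> = (2000 / \<kappa>) powr q"
    using \<delta> C \<kappa> assms by (auto simp: E1_def E2_def E3_def)
  define E where "E = 2 + E1 + E2 + E3"
  have E_pos: "E > 0" using E by (simp add: E_def)
  have main: "u (x, t) - u (y, t) \<le> E * (Linf_norm (Q 1) u + Linf_norm (Q 1) u powr q
      + Linf_norm (Q 1) f powr q) * norm (x - y) powr \<beta>"
    if f: "continuous_on (Q 1) f" "in_Linf (Q 1) f" and bu: "bounded (u ` Q 1)"
      and sol: "viscosity_solution \<gamma> p f u"
      and xyt: "x \<in> ball 0 (15/16)" "y \<in> ball 0 (15/16)" "-((15/16)^2) < t" "t \<le> 0"
    for f u :: "(real^'n) \<times> real \<Rightarrow> real" and x y t
  proof -
    define K where "K = Linf_norm (Q 1) u"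
    define F where "F = Linf_norm (Q 1) f"
    have cu: "continuous_on (Q 1) u" and sub: "viscosity_subsolution \<gamma> p f u"
      and super: "viscosity_supersolution \<gamma> p f u"
      using sol by (auto simp: viscosity_solution_def)
    have uK: "\<bar>u z\<bar> \<le> K" if "z \<in> Q 1" for z
      unfolding K_def by (rule abs_le_Linf_norm[OF cu in_Linf_bounded[OF cu bu] that])
    have fF: "\<bar>f z\<bar> \<le> F" if "z \<in> Q 1" for z
      unfolding F_def by (rule abs_le_Linf_norm[OF f that])
    have Q1: "Q 1 = ball (0 :: real^'n) 1 \<times> {-1<..0::real}" by (simp add: Q_def)
    have "(0, 0) \<in> (Q 1 :: ((real^'n) \<times> real) set)" by (simp add: Q1)
    from uK[OF this] fF[OF this] have nonneg: "K \<ge> 0" "F \<ge> 0" by linarith+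
    define L where "L = E * (K + K powr q + F powr q)"
    have "u (x, t) - u (y, t) \<le> L * norm (x - y) powr \<beta>"
    \<comment> \<open>The penalties of the doubling are proportional to \<open>K\<close>, so a
      vanishing \<open>u\<close> is treated separately.\<close>
    proof (cases "K = 0")
      case True
      have "-1 < t" using xyt(3) by (simp add: power2_eq_square)
      then have "(x, t) \<in> Q 1" "(y, t) \<in> Q 1" using xyt by (auto simp: Q1)
      from uK[OF this(1)] uK[OF this(2)] True have "u (x, t) - u (y, t) = 0" by simp
      moreover have "0 \<le> L * norm (x - y) powr \<beta>"
        unfolding L_def using E_pos nonneg by (intro mult_nonneg_nonneg add_nonneg_nonneg) auto
      ultimately show ?thesis by linarith
    next
      case False
      then have K: "K > 0" using nonneg by simp
      define T where "T = K + K powr q + F powr q"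
      have T: "K \<le> T" "K powr q + F powr q \<le> T" "T > 0"
        using K powr_ge_zero[of K q] powr_ge_zero[of F q] unfolding T_def by linarith+
      have L_ge: "e * T \<le> L" if "e \<le> E" for e
        unfolding L_def T_def[symmetric] using that T(3) by (intro mult_right_mono) auto
      have L1: "2 * K \<le> L"
        using L_ge[of 2] T(1) E by (simp add: E_def)
      have Lb: "c * T \<le> a * (L * \<beta>)" if "e * (a * \<beta>) = c" "e \<le> E" "a \<ge> 0" for a c e
      proof -
        have "c * T = (a * \<beta>) * (e * T)" using that(1) by (simp add: mult_ac)
        also have "\<dots> \<le> (a * \<beta>) * L"
          using that(3) assms(3) by (intro mult_left_mono L_ge that(2)) auto
        finally show ?thesis by (simp add: mult_ac)
      qed
      have "16384 * T \<le> \<delta> * (L * \<beta>)" by (rule Lb[OF E(4)]) (use E \<delta> in \<open>auto simp: E_def\<close>)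
      then have L2: "16384 * K \<le> \<delta> * (L * \<beta>)" using T(1) by linarith
      have "16384 * C * T \<le> \<kappa> * (L * \<beta>)" by (rule Lb[OF E(5)]) (use E \<kappa> in \<open>auto simp: E_def\<close>)
      moreover have "16384 * C * K \<le> 16384 * C * T" using T(1) C by (intro mult_left_mono) auto
      ultimately have L3: "16384 * K * C \<le> (1 - \<beta>) * (p - 1) * (L * \<beta>)"
        unfolding \<kappa>_def by (simp add: mult.assoc mult.commute[of K])
      have "(2000 / \<kappa>) powr q * T \<le> 1 * (L * \<beta>)" by (rule Lb[of E3]) (use E in \<open>auto simp: E_def\<close>)
      moreover have "(2000 / \<kappa>) powr q * (K powr q + F powr q) \<le> (2000 / \<kappa>) powr q * T"
        using T(2) by (intro mult_left_mono) auto
      ultimately have L4: "2 * F + 256 * K < \<kappa> * (L * \<beta>) powr (1 + \<gamma>)"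
        by (intro constant_dominates[OF assms(1) \<kappa> K nonneg(2)]) (simp add: q_def)
      show ?thesis
      proof (rule doubling_estimate[OF assms \<delta> C coupling])
        show "continuous_on (ball 0 1 \<times> {-1<..0}) u" using cu unfolding Q1 .
        show "\<bar>u z\<bar> \<le> K" if "z \<in> ball 0 1 \<times> {-1<..0}" for z using uK that unfolding Q1 by blast
        show "touch_subsol \<gamma> p F (ball 0 1 \<times> {-1<..0}) u"
          unfolding Q1[symmetric] by (rule subsolution_imp_touch_subsol[OF sub]) (use fF in \<open>fastforce simp: abs_le_iff\<close>)
        show "touch_subsol \<gamma> p F (ball 0 1 \<times> {-1<..0}) (\<lambda>z. - u z)"
          unfolding Q1[symmetric] by (rule supersolution_imp_touch_subsol[OF super]) (use fF in \<open>fastforce simp: abs_le_iff\<close>)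
        show "2 * F + 256 * K < (1 - \<beta>) * (p - 1) * (L * \<beta>) powr (1 + \<gamma>)" using L4 unfolding \<kappa>_def .
      qed (use K L1 L2 L3 xyt in auto)
    qed
    then show ?thesis unfolding L_def K_def F_def .
  qed
  show ?thesis
  proof (intro exI[of _ E] conjI E_pos allI impI ballI)
    fix f u :: "(real^'n) \<times> real \<Rightarrow> real" and x y :: "real^'n" and t :: real
    assume A: "continuous_on (Q 1) f" "in_Linf (Q 1) f" "bounded (u ` Q 1)" "viscosity_solution \<gamma> p f u"
      and x: "x \<in> ball 0 (15/16)" and y: "y \<in> ball 0 (15/16)" and t: "t \<in> {-((15/16)^2) <.. 0::real}"
    have t': "-((15/16)^2) < t" "t \<le> 0" using t by auto
    show "\<bar>u (x, t) - u (y, t)\<bar> \<le> E * (Linf_norm (Q 1) u + Linf_norm (Q 1) u powr (1 / (1 + \<gamma>))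
        + Linf_norm (Q 1) f powr (1 / (1 + \<gamma>))) * norm (x - y) powr \<beta>"
      using main[OF A x y t'] main[OF A y x t'] unfolding q_def norm_minus_commute[of y x] by linarith
  qed
qed

end
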